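(* Let $d,m\ge1$ be integers and let $U\subseteq\mathbb{R}^m$ be open and bounded. Then the characteristic map $$\mathcal{E}:C^{0,1}(\overline U,\mathrm{Herm}(d))\to C^{0,1}_q(\overline U,\mathbb{R}^d),\qquad A\mapsto\lambda^\uparrow\circ A,$$ is continuous for all $1\le q<\infty$, where $C^{0,1}_q(\overline U,\mathbb{R}^d)$ denotes the set $C^{0,1}(\overline U,\mathbb{R}^d)$ equipped with the trace topology of the inclusion $C^{0,1}(\overline U,\mathbb{R}^d)\to W^{1,q}(U,\mathbb{R}^d)$ (i.e. the topology induced by the norm of $W^{1,q}(U,\mathbb{R}^d)$).
   Context: $M_d(\mathbb{C})$ is the space of complex $d\times d$ matrices with the Frobenius norm $\|A\|_2=(\sum_{i,j}|a_{ij}|^2)^{1/2}$, and $\mathrm{Herm}(d)=\{A\in M_d(\mathbb{C}):A^*=A\}$. The map $\lambda^{\uparrow}:\mathrm{Herm}(d)\to\mathbb{R}^d$ assigns to $A$ its eigenvalues (with multiplicity) in increasing order; it is $1$-Lipschitz for the $2$-norms. For a finite-dimensional real vector space $V$ with Euclidean norm $\|\cdot\|_2$, $C^{0,1}(\overline U,V)$ is the Banach space of maps $f:U\to V$, continuously extendable to $\overline U$, with finite norm $\|f\|_{C^{0,1}}=\sup_{x\in U}\|f(x)\|_2+\sup_{x\ne y\in U}\frac{\|f(x)-f(y)\|_2}{\|x-y\|_2}$; $C^{0,1}(\overline U,\mathrm{Herm}(d))$ carries this norm. $W^{1,q}(U,V)$ has the norm $\|f\|_{L^q}+\sum_{i=1}^m\|\partial_if\|_{L^q}$,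 where $\|f\|_{L^q(U,V)}=\big\|\,\|f\|_2\,\big\|_{L^q(U)}$. *)

theory Defs
  imports
    "HOL-Analysis.Analysis"
    "HOL-Computational_Algebra.Polynomial"
begin

section \<open>Hermitian matrices and their ordered eigenvalues\<close>

text \<open>
  The norm of type \<^typ>\<open>complex ^ 'd ^ 'd\<close> is the Frobenius norm and that of
  \<^typ>\<open>real ^ 'd\<close> the Euclidean norm.  To speak of vectors with increasing entries, the
  index type of size \<open>d\<close> carries a linear order.
\<close>

definition Herm :: "(complex ^ 'd ^ 'd) set" where
  "Herm = {A. (\<chi> i j. cnj (A $ j $ i)) = A}"

definition charpoly :: "complex ^ 'd ^ 'd \<Rightarrow> complex poly" where
  "charpoly A = det (\<chi> i j. (if i = j then [:0, 1:] else 0) - [:A $ i $ j:])"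

text \<open>
  The eigenvalues, listed increasingly with multiplicity; entry \<open>i\<close> of the vector is the list
  element whose position is the rank of \<open>i\<close> in the index type.  The eigenvalues of a Hermitian
  matrix are real, so that \<^const>\<open>Re\<close> only changes the type.
\<close>

definition ordered_eigenvalues ::
    "complex ^ ('d::{finite,linorder}) ^ ('d::{finite,linorder}) \<Rightarrow> real ^ ('d::{finite,linorder})" where
  "ordered_eigenvalues A =
     (\<chi> i. sorted_list_of_multiset (image_mset Re (proots (charpoly A))) ! card {..<i})"

section \<open>The topology of a seminorm on a set of functions\<close>

text \<open>
  \<open>N\<close> is only applied to differences of elements of \<open>S\<close>.  It may be a seminorm, as is the case
  for function spaces whose elements are represented by functions rather than by classes modulo
  equality almost everywhere.
\<close>

definition seminorm_topology ::
    "('a \<Rightarrow> 'v::real_vector) set \<Rightarrow> (('a \<Rightarrow> 'v) \<Rightarrow> real) \<Rightarrow> ('a \<Rightarrow> 'v) topology" where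
  "seminorm_topology S N =
     topology (\<lambda>T. T \<subseteq> S \<and> (\<forall>f\<in>T. \<exists>r>0. {g \<in> S. N (\<lambda>x. g x - f x) < r} \<subseteq> T))"

lemma openin_seminorm_topology:
  "openin (seminorm_topology S N) T \<longleftrightarrow>
     T \<subseteq> S \<and> (\<forall>f\<in>T. \<exists>r>0. {g \<in> S. N (\<lambda>x. g x - f x) < r} \<subseteq> T)"
proof -
  let ?P = "\<lambda>T. T \<subseteq> S \<and> (\<forall>f\<in>T. \<exists>r>0. {g \<in> S. N (\<lambda>x. g x - f x) < r} \<subseteq> T)"
  have "istopology ?P"
    unfolding istopology_def
  proof (intro conjI allI impI ballI)
    fix T T' f assume T: "?P T" and T': "?P T'" and f: "f \<in> T \<inter> T'"
    obtain r where r: "r > 0" "{g \<in> S. N (\<lambda>x. g x - f x) < r} \<subseteq> T" using T f by blast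
    obtain r' where r': "r' > 0" "{g \<in> S. N (\<lambda>x. g x - f x) < r'} \<subseteq> T'" using T' f by blast
    have "min r r' > 0" "{g \<in> S. N (\<lambda>x. g x - f x) < min r r'} \<subseteq> T \<inter> T'"
      using r r' by auto
    then show "\<exists>r>0. {g \<in> S. N (\<lambda>x. g x - f x) < r} \<subseteq> T \<inter> T'" by blast
  next
    fix \<K> f assume K: "\<forall>T\<in>\<K>. ?P T" and "f \<in> \<Union>\<K>"
    then obtain T where T: "T \<in> \<K>" "f \<in> T" by blast
    then obtain r where "r > 0" "{g \<in> S. N (\<lambda>x. g x - f x) < r} \<subseteq> T" using K by blast
    then show "\<exists>r>0. {g \<in> S. N (\<lambda>x. g x - f x) < r} \<subseteq> \<Union>\<K>" using T(1) by blast
  qed blast+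
  then show ?thesis
    unfolding seminorm_topology_def by (simp add: topology_inverse')
qed

lemma topspace_seminorm_topology: "topspace (seminorm_topology S N) = S"
proof
  show "topspace (seminorm_topology S N) \<subseteq> S"
    using openin_topspace openin_seminorm_topology by blast
  have "openin (seminorm_topology S N) S"
    unfolding openin_seminorm_topology by (auto intro: exI[of _ 1])
  then show "S \<subseteq> topspace (seminorm_topology S N)"
    by (rule openin_subset)
qed

section \<open>Lipschitz functions\<close>

text \<open>
  Maps from \<open>U\<close> to \<open>V\<close> are the extensional functions \<^term>\<open>U \<rightarrow>\<^sub>E V\<close>.  For \<open>U = {}\<close> the space is a
  singleton, so its topology does not depend on the unspecified \<^term>\<open>Sup ({} :: real set)\<close>.
\<close>

definition C01 ::
    "'a::real_normed_vector set \<Rightarrow> 'v::real_normed_vector set \<Rightarrow> ('a \<Rightarrow> 'v) set" where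
  "C01 U V = {f \<in> U \<rightarrow>\<^sub>E V.
     (\<exists>g \<in> closure U \<rightarrow> V. continuous_on (closure U) g \<and> (\<forall>x\<in>U. g x = f x)) \<and>
     bdd_above {norm (f x) | x. x \<in> U} \<and>
     bdd_above {norm (f x - f y) / norm (x - y) | x y. x \<in> U \<and> y \<in> U \<and> x \<noteq> y}}"

definition C01_norm ::
    "'a::real_normed_vector set \<Rightarrow> ('a \<Rightarrow> 'v::real_normed_vector) \<Rightarrow> real" where
  "C01_norm U f = Sup {norm (f x) | x. x \<in> U} +
     Sup {norm (f x - f y) / norm (x - y) | x y. x \<in> U \<and> y \<in> U \<and> x \<noteq> y}"

definition C01_topology ::
    "'a::real_normed_vector set \<Rightarrow> 'v::real_normed_vector set \<Rightarrow> ('a \<Rightarrow> 'v) topology" where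
  "C01_topology U V = seminorm_topology (C01 U V) (C01_norm U)"

section \<open>Sobolev spaces\<close>

definition Lq :: "real \<Rightarrow> 'a::euclidean_space set \<Rightarrow> ('a \<Rightarrow> 'v::euclidean_space) set" where
  "Lq q U = {f \<in> borel_measurable (lebesgue_on U).
     integrable (lebesgue_on U) (\<lambda>x. norm (f x) powr q)}"

definition Lq_norm ::
    "real \<Rightarrow> 'a::euclidean_space set \<Rightarrow> ('a \<Rightarrow> 'v::euclidean_space) \<Rightarrow> real" where
  "Lq_norm q U f = (LINT x|lebesgue_on U. norm (f x) powr q) powr (1 / q)"

definition partial_deriv :: "'m::finite \<Rightarrow> (real ^ 'm \<Rightarrow> real) \<Rightarrow> real ^ 'm \<Rightarrow> real" where
  "partial_deriv i \<phi> x = frechet_derivative \<phi> (at x) (axis i 1)"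

primrec Ck :: "nat \<Rightarrow> (real ^ 'm::finite \<Rightarrow> real) \<Rightarrow> bool" where
  "Ck 0 \<phi> \<longleftrightarrow> continuous_on UNIV \<phi>"
| "Ck (Suc k) \<phi> \<longleftrightarrow> \<phi> differentiable_on UNIV \<and> (\<forall>i. Ck k (partial_deriv i \<phi>))"

definition test_functions :: "(real ^ 'm::finite) set \<Rightarrow> (real ^ 'm \<Rightarrow> real) set" where
  "test_functions U = {\<phi>. (\<forall>k. Ck k \<phi>) \<and>
     compact (closure {x. \<phi> x \<noteq> 0}) \<and> closure {x. \<phi> x \<noteq> 0} \<subseteq> U}"

definition locally_integrable ::
    "'a::euclidean_space set \<Rightarrow> ('a \<Rightarrow> 'v::euclidean_space) \<Rightarrow> bool" where
  "locally_integrable U f \<longleftrightarrow> (\<forall>K. compact K \<and> K \<subseteq> U \<longrightarrow> f absolutely_integrable_on K)"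

definition has_weak_partial ::
    "(real ^ 'm::finite) set \<Rightarrow> 'm \<Rightarrow> (real ^ 'm \<Rightarrow> 'v::euclidean_space)
      \<Rightarrow> (real ^ 'm \<Rightarrow> 'v) \<Rightarrow> bool" where
  "has_weak_partial U i f g \<longleftrightarrow> locally_integrable U f \<and> locally_integrable U g \<and>
     (\<forall>\<phi> \<in> test_functions U.
        (LINT x|lebesgue_on U. partial_deriv i \<phi> x *\<^sub>R f x) =
        - (LINT x|lebesgue_on U. \<phi> x *\<^sub>R g x))"

text \<open>
  Weak derivatives are unique up to equality almost everywhere in \<open>U\<close>, so that the norm below
  does not depend on the choice made here.
\<close>

definition weak_partial ::
    "(real ^ 'm::finite) set \<Rightarrow> 'm \<Rightarrow> (real ^ 'm \<Rightarrow> 'v::euclidean_space) \<Rightarrow> real ^ 'm \<Rightarrow> 'v" where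
  "weak_partial U i f = (SOME g. has_weak_partial U i f g)"

definition W1q ::
    "real \<Rightarrow> (real ^ 'm::finite) set \<Rightarrow> (real ^ 'm \<Rightarrow> 'v::euclidean_space) set" where
  "W1q q U = {f \<in> Lq q U. \<forall>i. \<exists>g \<in> Lq q U. has_weak_partial U i f g}"

definition W1q_norm ::
    "real \<Rightarrow> (real ^ 'm::finite) set \<Rightarrow> (real ^ 'm \<Rightarrow> 'v::euclidean_space) \<Rightarrow> real" where
  "W1q_norm q U f = Lq_norm q U f + (\<Sum>i\<in>UNIV. Lq_norm q U (weak_partial U i f))"

text \<open>
  The trace topology of the inclusion into \<open>W\<^sup>1\<^sup>,\<^sup>q\<close>.  The points of a pullback topology are those
  that are mapped into the space, so a map continuous into this topology takes values in
  \<^term>\<open>C01 U UNIV \<inter> W1q q U\<close>.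
\<close>

definition C01_trace_topology ::
    "real \<Rightarrow> (real ^ 'm::finite) set \<Rightarrow> (real ^ 'm \<Rightarrow> 'v::euclidean_space) topology" where
  "C01_trace_topology q U =
     pullback_topology (C01 U UNIV) (\<lambda>f. f) (seminorm_topology (W1q q U) (W1q_norm q U))"

section \<open>The characteristic map\<close>

definition characteristic_map ::
    "(real ^ 'm) set \<Rightarrow> (real ^ 'm \<Rightarrow> complex ^ ('d::{finite,linorder}) ^ ('d::{finite,linorder}))
      \<Rightarrow> real ^ 'm \<Rightarrow> real ^ ('d::{finite,linorder})" where
  "characteristic_map U A = restrict (ordered_eigenvalues \<circ> A) U"

end

theory Submission
  imports Defs
begin

text \<open>
  By Ky Fan's principle, a sum of lowest eigenvalues of a Hermitian matrix is the minimum of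
  \<open>\<Sum>i\<in>I. w i \<bullet> (A *v w i)\<close> over orthonormal bases \<open>w\<close>, attained at eigenbases. Hence the ordered
  eigenvalues are Lipschitz, and wherever both a curve \<open>a\<close> of Hermitian matrices and its ordered
  eigenvalues are differentiable, the derivative of the \<open>j\<close>-th eigenvalue is \<open>v j \<bullet> (a' *v v j)\<close> for
  \<^emph>\<open>every\<close> eigenbasis \<open>v\<close> adapted to the ordering, whatever the multiplicities. As orthonormal
  bases form a compact set, these derivatives converge at every such point when both the
  matrices and their derivatives converge. Lipschitz functions are differentiable
  almost everywhere along the coordinate lines, and these derivatives are the weak ones, so
  dominated convergence gives convergence in \<open>W\<^sup>1\<^sup>,\<^sup>q\<close>.
\<close>

section \<open>Eigenvalues of Hermitian matrices\<close>

text \<open>Where eigenvalues cross, eigenvectors cannot be chosen continuously and single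
  eigenvalues need not be differentiable. Partial sums over initial segments of the index type
  replace single eigenvalues, because an inner eigenvalue alone is only a minimax, while such a sum
  is a minimum. Finiteness of \<open>q\<close> is essential: near x = 0 the matrices with rows (x,
  1/n) and (1/n, -x) converge to diag(x, -x) in the Lipschitz norm, but the derivatives x / sqrt(x^2
  + 1/n^2) of the larger eigenvalue do not converge uniformly to the sign of x. Only pointwise
  convergence off a null set can be hoped for. The null set may depend on the sequence, so
  continuity is tested on sequences, whose countably many exceptional sets still have a null union.
  The Sobolev norm speaks of a weak derivative picked by a choice operator. Pointwise derivatives
  say something about it only once two facts are known: the classical partial derivative of a
  Lipschitz function is a weak one, and any two weak ones agree almost everywhere.\<close>

definition hip :: "complex ^ 'n \<Rightarrow> complex ^ 'n \<Rightarrow> complex"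
  where "hip v w = (\<Sum>i\<in>UNIV. cnj (v $ i) * w $ i)"

lemma cnj_hip: "cnj (hip v w) = hip w v"
  by (simp add: hip_def mult.commute)

lemma hip_add_right: "hip v (w + w') = hip v w + hip v w'"
  by (simp add: hip_def algebra_simps sum.distrib)

lemma hip_diff_right: "hip v (w - w') = hip v w - hip v w'"
  by (simp add: hip_def algebra_simps sum_subtractf)

lemma hip_scale_right: "hip v (c *s w) = c * hip v w"
  by (simp add: hip_def algebra_simps sum_distrib_left)

lemma hip_scale_left: "hip (c *s v) w = cnj c * hip v w"
  by (simp add: hip_def algebra_simps sum_distrib_left)

lemma hip_scaleR_right: "hip v (r *\<^sub>R w) = of_real r * hip v w"
  unfolding hip_def vector_scaleR_component by (simp add: algebra_simps sum_distrib_left scaleR_conv_of_real)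

lemma hip_sum_right: "hip v (\<Sum>k\<in>S. f k) = (\<Sum>k\<in>S. hip v (f k))"
  by (induction S rule: infinite_finite_induct) (auto simp: hip_add_right, auto simp: hip_def)

text \<open>The link between complex orthogonality, which the spectral theorem needs, and the real
  inner product, which induces the norm and in which minima are taken.\<close>

lemma Re_hip: "Re (hip v w) = v \<bullet> w"
  by (simp add: hip_def inner_vec_def inner_complex_def)

lemma hip_self: "hip v v = of_real ((norm v)\<^sup>2)"
proof -
  have "Im (hip v v) = 0"
    by (simp add: hip_def)
  then show ?thesis
    by (simp add: complex_eq_iff Re_hip power2_norm_eq_inner)
qed

lemma hip_matrix_vector:
  assumes "A \<in> Herm"
  shows "hip v (A *v w) = hip (A *v v) w"
proof -
  have *: "cnj (A $ i $ j) = A $ j $ i" for i j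
    using assms by (auto simp: Herm_def vec_eq_iff)
  have "hip v (A *v w) = (\<Sum>i\<in>UNIV. \<Sum>j\<in>UNIV. cnj (v $ i) * (A $ i $ j * w $ j))"
    by (simp add: hip_def matrix_vector_mult_def sum_distrib_left)
  also have "\<dots> = (\<Sum>j\<in>UNIV. \<Sum>i\<in>UNIV. cnj (v $ i) * (A $ i $ j * w $ j))"
    by (rule sum.swap)
  also have "\<dots> = hip (A *v v) w"
    by (simp add: hip_def matrix_vector_mult_def sum_distrib_left sum_distrib_right * mult_ac)
  finally show ?thesis .
qed

lemma inner_matrix_vector:
  assumes "A \<in> Herm"
  shows "v \<bullet> (A *v w) = (A *v v) \<bullet> w"
  using hip_matrix_vector[OF assms] by (simp flip: Re_hip)

definition orthonormal_basis :: "('n \<Rightarrow> complex ^ 'n) \<Rightarrow> bool"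
  where "orthonormal_basis v \<longleftrightarrow> (\<forall>i j. hip (v i) (v j) = (if i = j then 1 else 0))"

text \<open>Orthonormality says that the matrix with columns \<open>v j\<close> has its adjoint as a
  left inverse. For square matrices this is also a right inverse, so the family spans without any
  dimension count.\<close>

lemma orthonormal_basis_expansion:
  assumes "orthonormal_basis v"
  shows "w = (\<Sum>k\<in>UNIV. hip (v k) w *s v k)"
proof -
  define V where "V = (\<chi> i j. v j $ i)"
  define V' where "V' = (\<chi> i j. cnj (v i $ j))"
  have "V' ** V = mat 1"
    using assms by (auto simp: V_def V'_def matrix_matrix_mult_def mat_def vec_eq_iff
        orthonormal_basis_def hip_def)
  then have "V ** V' = mat 1"
    by (simp add: matrix_left_right_inverse)
  then have "w = V *v (V' *v w)"
    by (metis matrix_vector_mul_assoc matrix_vector_mul_lid)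
  also have "\<dots> = (\<Sum>k\<in>UNIV. hip (v k) w *s v k)"
    by (simp add: vec_eq_iff V_def V'_def matrix_vector_mult_def hip_def sum_component mult.commute)
  finally show ?thesis .
qed

lemma orthonormal_basis_parseval:
  assumes "orthonormal_basis v"
  shows "(\<Sum>k\<in>UNIV. (cmod (hip (v k) w))\<^sup>2) = (norm w)\<^sup>2"
proof -
  have "hip w w = (\<Sum>k\<in>UNIV. hip (v k) w * hip w (v k))"
    by (subst (2) orthonormal_basis_expansion[OF assms, of w])
      (simp add: hip_sum_right hip_scale_right)
  also have "\<dots> = (\<Sum>k\<in>UNIV. of_real ((cmod (hip (v k) w))\<^sup>2))"
    by (rule sum.cong) (auto simp: complex_norm_square cnj_hip simp del: of_real_power)
  finally show ?thesis
    unfolding hip_self by (metis of_real_eq_iff of_real_sum)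
qed

lemma orthonormal_basis_norm: "orthonormal_basis v \<Longrightarrow> norm (v i) = 1"
  by (metis hip_self norm_ge_zero of_real_eq_1_iff orthonormal_basis_def power2_eq_1_iff
      real_norm_def zero_neq_neg_one abs_norm_cancel abs_minus_cancel norm_one)

section \<open>The spectral theorem by successive constrained minimisation\<close>

definition eigenbasis ::
    "complex ^ ('n::{finite,linorder}) ^ 'n::{finite,linorder} \<Rightarrow>
      ('n::{finite,linorder} \<Rightarrow> complex ^ 'n::{finite,linorder}) \<Rightarrow> ('n::{finite,linorder} \<Rightarrow> real) \<Rightarrow> bool"
  where "eigenbasis A v l \<longleftrightarrow> orthonormal_basis v \<and> mono l \<and> (\<forall>i. A *v v i = of_real (l i) *s v i)"

text \<open>The rows of \<open>M\<close> express the constraints, and row \<open>i\<close> is left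
  zero. So \<open>M\<close> is singular whatever the vectors \<open>v j\<close> are, and a
  normalised kernel vector does the job.\<close>

lemma exists_orthogonal:
  fixes v :: "('n::{finite,linorder}) \<Rightarrow> complex ^ 'n::{finite,linorder}"
  shows "\<exists>w. norm w = 1 \<and> (\<forall>j<i. hip (v j) w = 0)"
proof -
  define M where "M = (\<chi> j k. if j < i then cnj (v j $ k) else 0)"
  have "row i M = 0"
    by (simp add: M_def row_def vec_eq_iff)
  then have "det M = 0"
    using det_zero_row by blast
  then have "\<not> invertible M"
    by (simp add: invertible_det_nz)
  then obtain w where w: "w \<noteq> 0" "M *v w = 0"
    using invertible_left_inverse matrix_left_invertible_ker by blast
  have orth: "hip (v j) w = 0" if "j < i" for j
    using arg_cong[OF w(2), of "\<lambda>x. x $ j"] that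
    by (simp add: M_def matrix_vector_mult_def hip_def)
  show ?thesis
    by (rule exI[of _ "(1 / norm w) *\<^sub>R w"]) (use w orth in \<open>simp add: hip_scaleR_right\<close>)
qed

lemma continuous_on_hip [continuous_intros]:
  assumes "continuous_on S f" "continuous_on S g"
  shows "continuous_on S (\<lambda>x. hip (f x) (g x))"
  unfolding hip_def by (intro continuous_intros assms)

lemma continuous_on_matrix_vector [continuous_intros]:
  fixes f :: "'a::topological_space \<Rightarrow> complex ^ 'n ^ 'm"
  assumes "continuous_on S f" "continuous_on S g"
  shows "continuous_on S (\<lambda>x. f x *v g x)"
  unfolding matrix_vector_mult_def by (intro continuous_intros assms)

text \<open>The quadratic form attains its minimum on the unit sphere of the orthogonal complement
  \<open>W\<close> of the earlier eigenvectors. If the minimiser were not an eigenvector, a move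
  along its residual would lower the quotient to first order. The minimality inequality is part of
  the result because it later orders the eigenvalues.\<close>

lemma constrained_minimum_is_eigenvector:
  fixes A :: "complex ^ ('n::{finite,linorder}) ^ 'n::{finite,linorder}"
    and v :: "('n::{finite,linorder}) \<Rightarrow> complex ^ 'n::{finite,linorder}"
    and l :: "('n::{finite,linorder}) \<Rightarrow> real"
  assumes A: "A \<in> Herm" and v: "\<And>j. j < i \<Longrightarrow> A *v v j = of_real (l j) *s v j"
  obtains w \<mu> where "norm w = 1" "\<And>j. j < i \<Longrightarrow> hip (v j) w = 0" "A *v w = of_real \<mu> *s w"
    "\<And>u. (\<And>j. j < i \<Longrightarrow> hip (v j) u = 0) \<Longrightarrow> \<mu> * (norm u)\<^sup>2 \<le> u \<bullet> (A *v u)"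
proof -
  define W where "W = {w. \<forall>j<i. hip (v j) w = 0}"
  have "closed W"
    unfolding W_def by (intro closed_Collect_all closed_Collect_imp closed_Collect_eq)
      (auto intro!: continuous_intros)
  then have "compact (sphere 0 1 \<inter> W)"
    by (intro compact_Int_closed) auto
  moreover have "sphere 0 1 \<inter> W \<noteq> {}"
    using exists_orthogonal[where i = i and v = v] by (auto simp: W_def)
  ultimately obtain w where w: "w \<in> sphere 0 1 \<inter> W"
    and min: "\<And>u. u \<in> sphere 0 1 \<inter> W \<Longrightarrow> w \<bullet> (A *v w) \<le> u \<bullet> (A *v u)"
    using continuous_attains_inf[of "sphere 0 1 \<inter> W" "\<lambda>u. u \<bullet> (A *v u)",
        OF _ _ continuous_on_inner[OF continuous_on_id continuous_on_matrix_vector[OF continuous_on_const continuous_on_id]]]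
    by blast
  define \<mu> where "\<mu> = w \<bullet> (A *v w)"
  have nw: "norm w = 1" and wW: "w \<in> W" using w by auto
  have scaleW: "r *\<^sub>R u \<in> W" if "u \<in> W" for r u
    using that by (auto simp: W_def hip_scaleR_right)
  have addW: "u + u' \<in> W" if "u \<in> W" "u' \<in> W" for u u'
    using that by (auto simp: W_def hip_add_right)
  have A_scaleR: "A *v (r *\<^sub>R u) = r *\<^sub>R (A *v u)" for r u
    by (simp add: vec_eq_iff matrix_vector_mult_def scaleR_sum_right)
  have bound: "\<mu> * (norm u)\<^sup>2 \<le> u \<bullet> (A *v u)" if u: "u \<in> W" for u
  proof (cases "u = 0")
    case False
    have "\<mu> \<le> ((1 / norm u) *\<^sub>R u) \<bullet> (A *v ((1 / norm u) *\<^sub>R u))"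
      unfolding \<mu>_def by (rule min) (use False scaleW[OF u] in auto)
    also have "\<dots> = (u \<bullet> (A *v u)) / (norm u)\<^sup>2"
      by (simp add: A_scaleR power2_eq_square)
    finally show ?thesis
      using False by (simp add: field_simps)
  qed auto
  \<comment> \<open>The residual is itself an admissible direction: \<open>W\<close> is invariant
    under \<open>A\<close>, since \<open>A\<close> is Hermitian and the \<open>v j\<close> are
    eigenvectors.\<close>
  define z where "z = A *v w - of_real \<mu> *s w"
  have z: "z = A *v w - \<mu> *\<^sub>R w"
    unfolding z_def by (simp add: vec_eq_iff scaleR_conv_of_real[symmetric])
  have zW: "z \<in> W"
    using wW by (auto simp: W_def z_def hip_diff_right hip_matrix_vector[OF A] v hip_scale_left
        hip_scale_right)
  have nonneg: "0 \<le> 2 * t * (norm z)\<^sup>2 + t\<^sup>2 * (z \<bullet> (A *v z) - \<mu> * (norm z)\<^sup>2)" for t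
  proof -
    have "\<mu> * (norm (w + t *\<^sub>R z))\<^sup>2 \<le> (w + t *\<^sub>R z) \<bullet> (A *v (w + t *\<^sub>R z))"
      by (intro bound addW scaleW wW zW)
    moreover have "w \<bullet> (A *v z) = z \<bullet> (A *v w)"
      by (metis inner_matrix_vector[OF A] inner_commute)
    moreover have zAw: "z \<bullet> (A *v w) = (norm z)\<^sup>2 + \<mu> * (z \<bullet> w)"
    proof -
      have "(norm z)\<^sup>2 = z \<bullet> (A *v w - \<mu> *\<^sub>R w)"
        unfolding power2_norm_eq_inner by (subst (2) z) (rule refl)
      then show ?thesis by (simp add: inner_diff_right)
    qed
    moreover have "(w + t *\<^sub>R z) \<bullet> (A *v (w + t *\<^sub>R z)) =
        \<mu> + t * (w \<bullet> (A *v z)) + t * (z \<bullet> (A *v w)) + t\<^sup>2 * (z \<bullet> (A *v z))"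
      unfolding matrix_vector_right_distrib A_scaleR \<mu>_def
      by (simp only: inner_add_left inner_add_right inner_scaleR_left inner_scaleR_right power2_eq_square
          distrib_left add.assoc mult.assoc)
    moreover have "(norm (w + t *\<^sub>R z))\<^sup>2 = 1 + 2 * t * (z \<bullet> w) + t\<^sup>2 * (norm z)\<^sup>2"
    proof -
      have "w \<bullet> w = 1" using nw by (simp add: norm_eq_1)
      then show ?thesis
        unfolding power2_norm_eq_inner
        by (simp add: inner_add_left inner_add_right inner_commute[of w z] power2_eq_square algebra_simps)
    qed
    ultimately show ?thesis
      by (simp add: algebra_simps)
  qed
  have "z = 0"
  proof (rule ccontr)
    assume "z \<noteq> 0"
    define a where "a = (norm z)\<^sup>2"
    define b where "b = z \<bullet> (A *v z) - \<mu> * (norm z)\<^sup>2"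
    have "a > 0" using \<open>z \<noteq> 0\<close> by (simp add: a_def)
    \<comment> \<open>Negative, and so small that the quadratic term cannot outweigh the linear one:
      \<open>\<bar>t * b\<bar> \<le> a\<close>. The summand \<open>a\<close> in the denominator
      covers \<open>b = 0\<close>.\<close>
    define t where "t = - a / (\<bar>b\<bar> + a)"
    have "t < 0" using \<open>a > 0\<close> by (auto simp: t_def field_simps)
    have "0 \<le> t * (2 * a + t * b)"
      using nonneg[of t] by (simp add: a_def b_def algebra_simps power2_eq_square)
    then have "2 * a + t * b \<le> 0"
      using \<open>t < 0\<close> by (simp add: zero_le_mult_iff)
    moreover have "\<bar>t * b\<bar> \<le> a"
      using \<open>a > 0\<close> by (simp add: t_def abs_mult field_simps)
    ultimately show False using \<open>a > 0\<close> by linarith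
  qed
  then have "A *v w = of_real \<mu> *s w" by (simp add: z_def)
  with that nw wW bound show thesis by (auto simp: W_def)
qed

text \<open>Recursion along the linear order of the finite index type, as dependent choice of pairs
  (eigenvector, eigenvalue). The predicate \<open>P f i\<close> looks at \<open>f\<close> only below
  \<open>i\<close>. The order is well-founded because initial segments grow strictly in
  cardinality.\<close>

lemma exists_eigenbasis:
  fixes A :: "complex ^ ('n::{finite,linorder}) ^ 'n::{finite,linorder}"
  assumes A: "A \<in> Herm"
  obtains v l where "eigenbasis A v l"
proof -
  define P where "P = (\<lambda>(f :: 'n::{finite,linorder} \<Rightarrow> (complex ^ ('n::{finite,linorder})) \<times> real) i r.
    norm (fst r) = 1 \<and> (\<forall>j<i. hip (fst (f j)) (fst r) = 0) \<and> A *v fst r = of_real (snd r) *s fst r \<and>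
    (\<forall>u. (\<forall>j<i. hip (fst (f j)) u = 0) \<longrightarrow> snd r * (norm u)\<^sup>2 \<le> u \<bullet> (A *v u)))"
  have "wf {(x, y :: 'n::{finite,linorder}). x < y}"
  proof (rule wf_subset[OF Wellfounded.wf_measure])
    have "card {..<x} < card {..<y}" if "x < y" for x y :: "'n::{finite,linorder}"
      using that by (intro psubset_card_mono) auto
    then show "{(x, y :: 'n::{finite,linorder}). x < y} \<subseteq> Wellfounded.measure (\<lambda>x. card {..<x})"
      by auto
  qed
  then have "\<exists>f. \<forall>x. P f x (f x)"
  proof (rule dependent_wf_choice)
    fix f g :: "'n::{finite,linorder} \<Rightarrow> (complex ^ ('n::{finite,linorder})) \<times> real"
      and x :: "'n::{finite,linorder}" and r :: "(complex ^ ('n::{finite,linorder})) \<times> real"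
    assume "\<And>z. (z, x) \<in> {(x, y :: 'n::{finite,linorder}). x < y} \<Longrightarrow> f z = g z"
    then show "P f x r = P g x r" by (auto simp: P_def)
  next
    fix x :: "'n::{finite,linorder}" and f :: "'n::{finite,linorder} \<Rightarrow> (complex ^ ('n::{finite,linorder})) \<times> real"
    assume "\<And>y. (y, x) \<in> {(x, y :: 'n::{finite,linorder}). x < y} \<Longrightarrow> P f y (f y)"
    then have *: "A *v fst (f j) = of_real (snd (f j)) *s fst (f j)" if "j < x" for j
      using that by (auto simp: P_def)
    show "\<exists>r. P f x r"
      by (rule constrained_minimum_is_eigenvector[OF A *]) (auto simp: P_def)
  qed
  then obtain f where f: "\<And>i. P f i (f i)" by blast
  have orth: "hip (fst (f j)) (fst (f i)) = 0" if "j < i" for i j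
    using f[of i] that by (auto simp: P_def)
  have orth': "hip (fst (f i)) (fst (f j)) = 0" if "j < i" for i j
    using arg_cong[OF orth[OF that], of cnj] by (simp add: cnj_hip)
  have "orthonormal_basis (fst \<circ> f)"
    unfolding orthonormal_basis_def
  proof (intro allI)
    fix i j :: "'n::{finite,linorder}"
    show "hip ((fst \<circ> f) i) ((fst \<circ> f) j) = (if i = j then 1 else 0)"
      using f[of i] by (cases i j rule: linorder_cases) (auto simp: orth orth' hip_self P_def)
  qed
  moreover have "mono (snd \<circ> f)"
  proof
    fix i j :: "'n::{finite,linorder}" assume "i \<le> j"
    \<comment> \<open>The later vector \<open>fst (f j)\<close> satisfies the weaker constraints of
      stage \<open>i\<close>, so it competes in the minimisation there.\<close>
    have "snd (f i) * (norm (fst (f j)))\<^sup>2 \<le> fst (f j) \<bullet> (A *v fst (f j))"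
      using f[of i] orth \<open>i \<le> j\<close> unfolding P_def by (meson order.strict_trans1 order.strict_trans2)
    also have "\<dots> = Re (hip (fst (f j)) (A *v fst (f j)))"
      by (simp add: Re_hip)
    also have "\<dots> = snd (f j)"
      using f[of j] by (simp add: P_def hip_scale_right hip_self)
    finally show "(snd \<circ> f) i \<le> (snd \<circ> f) j"
      using f[of j] by (simp add: P_def)
  qed
  ultimately have "eigenbasis A (fst \<circ> f) (snd \<circ> f)"
    using f by (auto simp: eigenbasis_def P_def)
  then show thesis by (rule that)
qed

section \<open>From the characteristic polynomial to eigenbases\<close>

lemma matrix_diff_ldistrib: "A ** (B - C) = A ** B - A ** C"
  for A :: "'a::ring_1 ^ 'n ^ 'm"
  by (simp add: matrix_matrix_mult_def vec_eq_iff right_diff_distrib sum_subtractf)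

lemma matrix_diff_rdistrib: "(B - C) ** A = B ** A - C ** A"
  for A :: "'a::ring_1 ^ 'n ^ 'm"
  by (simp add: matrix_matrix_mult_def vec_eq_iff left_diff_distrib sum_subtractf)

text \<open>Unitary diagonalisation carried out over the polynomial ring. The map \<open>C\<close>
  to constant polynomials respects products, and the scalar matrix \<open>X\<close> commutes with
  every matrix, so \<open>X - C A\<close> is conjugate to a diagonal matrix.\<close>

lemma charpoly_eigenbasis:
  fixes A :: "complex ^ ('n::{finite,linorder}) ^ 'n::{finite,linorder}"
  assumes "eigenbasis A v l"
  shows "charpoly A = (\<Prod>i\<in>UNIV. [:- of_real (l i), 1:])"
proof -
  define V where "V = (\<chi> i j. v j $ i)"
  define V' where "V' = (\<chi> i j. cnj (v i $ j))"
  define C where "C = (\<lambda>M :: complex ^ ('n::{finite,linorder}) ^ ('n::{finite,linorder}). \<chi> i j. [:M $ i $ j:])"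
  define D :: "complex ^ ('n::{finite,linorder}) ^ ('n::{finite,linorder})" where "D = (\<chi> i j. if i = j then of_real (l i) else 0)"
  define X :: "complex poly ^ ('n::{finite,linorder}) ^ ('n::{finite,linorder})" where "X = (\<chi> i j. if i = j then [:0, 1:] else 0)"
  have V'V: "V' ** V = mat 1"
    using assms by (auto simp: V_def V'_def matrix_matrix_mult_def mat_def vec_eq_iff eigenbasis_def
        orthonormal_basis_def hip_def)
  then have VV': "V ** V' = mat 1"
    by (simp add: matrix_left_right_inverse)
  have C_mult: "C (M ** N) = C M ** C N" for M N
  proof -
    have "[:\<Sum>k\<in>S. f k:] = (\<Sum>k\<in>S. [:f k:])" for f :: "'n::{finite,linorder} \<Rightarrow> complex" and S
      by (induction S rule: infinite_finite_induct) (auto, metis add_0 add_pCons)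
    then show ?thesis
      by (simp add: C_def matrix_matrix_mult_def vec_eq_iff mult.commute)
  qed
  have C1: "C (mat 1) = mat 1"
    by (simp add: C_def mat_def vec_eq_iff one_pCons)
  have AV: "A ** V = V ** D"
  proof -
    have "A *v v i = of_real (l i) *s v i" for i
      using assms by (simp add: eigenbasis_def)
    then have "(\<Sum>k\<in>UNIV. A $ j $ k * v i $ k) = of_real (l i) * v i $ j" for i j
      by (simp add: vec_eq_iff matrix_vector_mult_def)
    then show ?thesis
      by (simp add: vec_eq_iff V_def D_def matrix_matrix_mult_def if_distrib[of "\<lambda>x. _ * x"] mult.commute cong: if_cong)
  qed
  have "A = A ** (V ** V')" by (simp add: VV')
  also have "\<dots> = V ** D ** V'" by (simp add: matrix_mul_assoc AV)
  finally have A: "A = V ** D ** V'" .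
  have "X ** M = M ** X" for M
    by (simp add: X_def vec_eq_iff matrix_matrix_mult_def if_distrib[of "\<lambda>x. _ * x"]
        if_distrib[of "\<lambda>x. x * _"] mult.commute cong: if_cong)
  then have "C V ** X ** C V' = X"
    by (metis C1 C_mult VV' matrix_mul_assoc matrix_mul_rid)
  then have "X - C A = C V ** (X - C D) ** C V'"
    by (simp add: A C_mult matrix_diff_ldistrib matrix_diff_rdistrib)
  then have "charpoly A = det (C V ** (X - C D) ** C V')"
    unfolding charpoly_def by (metis (no_types, lifting) C_def X_def vec_eq_iff vec_lambda_beta vector_minus_component)
  also have "\<dots> = det (X - C D) * det (C V ** C V')"
    by (simp add: det_mul mult_ac)
  also have "C V ** C V' = mat 1"
    by (metis C1 C_mult VV')
  also have "det (X - C D) = (\<Prod>i\<in>UNIV. [:- of_real (l i), 1:])"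
    by (subst det_diagonal) (auto simp: X_def C_def D_def)
  finally show ?thesis by simp
qed

text \<open>Decodes the index \<open>card {..<i}\<close> in the definition of
  \<open>ordered_eigenvalues\<close>: counting from 0, the position of an element is the number of
  smaller ones.\<close>

lemma nth_sorted_list_of_set_card:
  fixes S :: "'a::linorder set"
  assumes "finite S" "i \<in> S"
  shows "sorted_list_of_set S ! card {x\<in>S. x < i} = i"
proof -
  define xs where "xs = sorted_list_of_set S"
  have xs: "sorted_wrt (<) xs" "set xs = S" "distinct xs"
    using assms by (auto simp: xs_def)
  then obtain k where k: "k < length xs" "xs ! k = i"
    using assms by (metis in_set_conv_nth)
  have "{x\<in>S. x < i} = (!) xs ` {..<k}"
  proof (intro set_eqI iffI)
    fix x assume "x \<in> {x\<in>S. x < i}"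
    then obtain m where "m < length xs" "x = xs ! m" "xs ! m < xs ! k"
      using xs k by (auto simp: in_set_conv_nth)
    moreover from this have "m < k"
      using xs(1) by (metis linorder_neqE_nat order_less_asym sorted_wrt_nth_less)
    ultimately show "x \<in> (!) xs ` {..<k}" by blast
  next
    fix x assume "x \<in> (!) xs ` {..<k}"
    then obtain m where m: "m < k" "x = xs ! m" by auto
    then have "x < i"
      using xs(1) k by (metis sorted_wrt_nth_less)
    moreover have "x \<in> S"
      using m k xs(2) by (metis nth_mem order_less_trans)
    ultimately show "x \<in> {x\<in>S. x < i}" by simp
  qed
  moreover have "inj_on ((!) xs) {..<k}"
    using k xs by (intro inj_on_nth) auto
  ultimately have "card {x\<in>S. x < i} = k"
    by (simp add: card_image)
  then show ?thesis using k by (simp add: xs_def)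
qed

text \<open>Replaces roots of polynomials by eigenbases for the rest of the proof. In particular all
  eigenbases of \<open>A\<close> share the same \<open>l\<close>.\<close>

lemma ordered_eigenvalues_eigenbasis:
  fixes A :: "complex ^ ('n::{finite,linorder}) ^ 'n::{finite,linorder}"
  assumes "eigenbasis A v l"
  shows "ordered_eigenvalues A $ i = l i"
proof -
  have "proots (charpoly A) = (\<Sum>i\<in>UNIV. {#of_real (l i)#})"
    unfolding charpoly_eigenbasis[OF assms] by (subst proots_prod) auto
  also have "\<dots> = image_mset (\<lambda>i. of_real (l i)) (mset_set UNIV)"
    by (simp add: sum_unfold_sum_mset)
  finally have "image_mset Re (proots (charpoly A)) = image_mset l (mset_set UNIV)"
    by (simp add: image_mset.compositionality o_def)
  also have "\<dots> = mset (map l (sorted_list_of_set UNIV))"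
    by (simp flip: sorted_list_of_mset_set)
  finally have "sorted_list_of_multiset (image_mset Re (proots (charpoly A))) =
      sort (map l (sorted_list_of_set UNIV))"
    by (metis sorted_list_of_multiset_mset)
  also have "\<dots> = map l (sorted_list_of_set UNIV)"
  proof (rule sorted_sort_id)
    show "sorted (map l (sorted_list_of_set UNIV))"
      using assms unfolding eigenbasis_def
      by (intro sorted_map_mono) (auto intro: mono_imp_mono_on)
  qed
  finally have "ordered_eigenvalues A $ i = map l (sorted_list_of_set UNIV) ! card {..<i}"
    by (simp add: ordered_eigenvalues_def)
  also have "\<dots> = l (sorted_list_of_set UNIV ! card {..<i})"
    proof (rule nth_map)
    have "card {..<i} < card (UNIV :: 'n::{finite,linorder} set)"
      by (rule psubset_card_mono) auto
    then show "card {..<i} < length (sorted_list_of_set (UNIV :: 'n::{finite,linorder} set))"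
      by simp
  qed
  also have "\<dots> = l i"
    using nth_sorted_list_of_set_card[of "UNIV :: ('n::{finite,linorder}) set" i] by (simp add: lessThan_def)
  finally show ?thesis .
qed

section \<open>Ky Fan's inequality and Lipschitz continuity of the eigenvalues\<close>

text \<open>The numbers \<open>c k i\<close> form a doubly stochastic matrix, so the right-hand side
  is a sum of the \<open>l k\<close> with weights \<open>p k\<close> between 0 and 1 of total
  \<open>card I\<close>. Among such weights the sum is least when they are concentrated on the
  lowest indices, which are those of the initial segment \<open>I\<close>.\<close>

lemma ky_fan:
  fixes A :: "complex ^ ('n::{finite,linorder}) ^ 'n::{finite,linorder}"
  assumes v: "eigenbasis A v l" and w: "orthonormal_basis w"
    and I: "\<And>i j. i \<in> I \<Longrightarrow> j \<le> i \<Longrightarrow> j \<in> I"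
  shows "(\<Sum>i\<in>I. l i) \<le> (\<Sum>i\<in>I. w i \<bullet> (A *v w i))"
proof (cases "I = {}")
  case False
  define c where "c = (\<lambda>k i. (cmod (hip (v k) (w i)))\<^sup>2)"
  have vb: "orthonormal_basis v" and "mono l" and Av: "\<And>i. A *v v i = of_real (l i) *s v i"
    using v by (auto simp: eigenbasis_def)
  have form: "w i \<bullet> (A *v w i) = (\<Sum>k\<in>UNIV. l k * c k i)" for i
  proof -
    have "A *v w i = A *v (\<Sum>k\<in>UNIV. hip (v k) (w i) *s v k)"
      using orthonormal_basis_expansion[OF vb, of "w i"] by simp
    also have "\<dots> = (\<Sum>k\<in>UNIV. (hip (v k) (w i) * of_real (l k)) *s v k)"
      by (simp add: linear_sum[OF matrix_vector_mul_linear] vector_scalar_commute Av)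
    finally have "hip (w i) (A *v w i) = (\<Sum>k\<in>UNIV. l k * (hip (v k) (w i) * hip (w i) (v k)))"
      by (simp add: hip_sum_right hip_scale_right mult_ac)
    also have "\<dots> = (\<Sum>k\<in>UNIV. of_real (l k * c k i))"
      by (rule sum.cong) (auto simp: complex_norm_square cnj_hip c_def simp del: of_real_power)
    finally show ?thesis
      by (simp flip: Re_hip)
  qed
  have c_sum1: "(\<Sum>k\<in>UNIV. c k i) = 1" for i
    using orthonormal_basis_parseval[OF vb, of "w i"]
    by (simp add: c_def orthonormal_basis_norm[OF w])
  have c_sum2: "(\<Sum>i\<in>UNIV. c k i) = 1" for k
  proof -
    have "c k i = (cmod (hip (w i) (v k)))\<^sup>2" for i
      unfolding c_def by (metis cnj_hip complex_mod_cnj)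
    then show ?thesis
      using orthonormal_basis_parseval[OF w, of "v k"]
      by (simp add: orthonormal_basis_norm[OF vb])
  qed
  define p where "p = (\<lambda>k. \<Sum>i\<in>I. c k i)"
  have p0: "p k \<ge> 0" for k by (auto simp: p_def c_def sum_nonneg)
  have p1: "p k \<le> 1" for k
    unfolding p_def c_sum2[of k, symmetric] by (rule sum_mono2) (auto simp: c_def)
  have ps: "(\<Sum>k\<in>UNIV. p k) = card I"
    unfolding p_def by (subst sum.swap) (simp add: c_sum1)
  \<comment> \<open>Subtracting the largest eigenvalue indexed by \<open>I\<close> fixes the signs:
    terms are nonpositive on \<open>I\<close> and nonnegative off \<open>I\<close>. Both sides
    change by \<open>M * card I\<close>, which cancels.\<close>
  define M where "M = l (Max I)"
  have MI: "Max I \<in> I" using False by (simp add: Max_in)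
  have "(\<Sum>k\<in>I. l k - M) \<le> (\<Sum>k\<in>I. (l k - M) * p k)"
  proof (rule sum_mono)
    fix k assume "k \<in> I"
    then have "l k \<le> M"
      unfolding M_def by (intro monoD[OF \<open>mono l\<close>]) simp
    then show "l k - M \<le> (l k - M) * p k"
      using p1[of k] by (simp add: mult_le_cancel_left1)
  qed
  also have "\<dots> \<le> (\<Sum>k\<in>UNIV. (l k - M) * p k)"
  proof (rule sum_mono2)
    fix k assume "k \<in> UNIV - I"
    then have "Max I \<le> k"
      using I[OF MI, of k] by (meson DiffD2 linear)
    then have "M \<le> l k"
      unfolding M_def by (rule monoD[OF \<open>mono l\<close>])
    then show "0 \<le> (l k - M) * p k" using p0[of k] by simp
  qed auto
  finally have "(\<Sum>k\<in>I. l k) \<le> (\<Sum>k\<in>UNIV. l k * p k)"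
    using ps by (simp add: algebra_simps sum_subtractf flip: sum_distrib_left)
  also have "\<dots> = (\<Sum>i\<in>I. w i \<bullet> (A *v w i))"
    unfolding form p_def sum_distrib_left by (rule sum.swap)
  finally show ?thesis .
qed auto

lemma norm_matrix_vector_le: "norm (M *v w) \<le> norm M * norm w" for M :: "complex ^ 'n ^ 'm"
proof -
  have "norm ((M *v w) $ i) \<le> norm (M $ i) * norm w" for i
  proof -
    have "norm ((M *v w) $ i) \<le> (\<Sum>k\<in>UNIV. \<bar>norm (M $ i $ k)\<bar> * \<bar>norm (w $ k)\<bar>)"
      unfolding matrix_vector_mult_def by (auto intro!: norm_sum sum_norm_le simp: norm_mult)
    also have "\<dots> \<le> norm (M $ i) * norm w"
      unfolding norm_vec_def by (rule L2_set_mult_ineq)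
    finally show ?thesis .
  qed
  then have "norm (M *v w) \<le> L2_set (\<lambda>i. norm (M $ i) * norm w) UNIV"
    unfolding norm_vec_def[of "M *v w"] by (intro L2_set_mono) auto
  also have "\<dots> = norm M * norm w"
    by (simp add: norm_vec_def[of M] L2_set_left_distrib)
  finally show ?thesis .
qed

lemma scaleR_matrix_vector: "(r *\<^sub>R M) *v w = r *\<^sub>R (M *v w)" for M :: "complex ^ 'n ^ 'm"
  by (simp add: vec_eq_iff matrix_vector_mult_def scaleR_sum_right)

lemma exists_eigenbasis_ordered:
  fixes A :: "complex ^ ('n::{finite,linorder}) ^ 'n::{finite,linorder}"
  assumes "A \<in> Herm"
  obtains v where "eigenbasis A v (($) (ordered_eigenvalues A))"
proof -
  obtain v l where "eigenbasis A v l"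
    using exists_eigenbasis[OF assms] .
  moreover from this have "l = ($) (ordered_eigenvalues A)"
    using ordered_eigenvalues_eigenbasis by fastforce
  ultimately show thesis using that by blast
qed

lemma eigenbasis_rayleigh:
  assumes "eigenbasis A v l"
  shows "v i \<bullet> (A *v v i) = l i"
proof -
  have "hip (v i) (A *v v i) = of_real (l i)"
    using assms by (simp add: eigenbasis_def orthonormal_basis_def hip_scale_right)
  then show ?thesis by (simp flip: Re_hip)
qed

lemma abs_rayleigh_le: "norm w = 1 \<Longrightarrow> \<bar>w \<bullet> (M *v w)\<bar> \<le> norm M" for M :: "complex ^ 'n ^ 'n"
  using Cauchy_Schwarz_ineq2[of w "M *v w"] norm_matrix_vector_le[of M w] by simp

text \<open>The eigenbasis of \<open>B\<close> serves as trial basis for \<open>A\<close> in Ky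
  Fan's inequality. What remains are Rayleigh quotients of \<open>A - B\<close>, at most
  \<open>CARD('n)\<close> of them.\<close>

lemma sum_ordered_eigenvalues_le:
  fixes A B :: "complex ^ ('n::{finite,linorder}) ^ 'n::{finite,linorder}"
  assumes A: "A \<in> Herm" and B: "B \<in> Herm"
    and I: "\<And>i j. i \<in> I \<Longrightarrow> j \<le> i \<Longrightarrow> j \<in> I"
  shows "(\<Sum>i\<in>I. ordered_eigenvalues A $ i) \<le>
    (\<Sum>i\<in>I. ordered_eigenvalues B $ i) + CARD('n) * norm (A - B)"
proof -
  obtain v where v: "eigenbasis A v (($) (ordered_eigenvalues A))"
    using exists_eigenbasis_ordered[OF A] .
  obtain w where w: "eigenbasis B w (($) (ordered_eigenvalues B))"
    using exists_eigenbasis_ordered[OF B] .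
  have wb: "orthonormal_basis w" using w by (simp add: eigenbasis_def)
  have "(\<Sum>i\<in>I. ordered_eigenvalues A $ i) \<le> (\<Sum>i\<in>I. w i \<bullet> (A *v w i))"
    using v wb I by (rule ky_fan)
  also have "\<dots> = (\<Sum>i\<in>I. ordered_eigenvalues B $ i) + (\<Sum>i\<in>I. w i \<bullet> ((A - B) *v w i))"
    by (simp add: eigenbasis_rayleigh[OF w] matrix_vector_mult_diff_rdistrib inner_diff_right
        sum_subtractf)
  also have "(\<Sum>i\<in>I. w i \<bullet> ((A - B) *v w i)) \<le> (\<Sum>i\<in>I. norm (A - B))"
    using abs_rayleigh_le[OF orthonormal_basis_norm[OF wb], of _ "A - B"]
    by (intro sum_mono) (metis abs_le_D1)
  also have "\<dots> \<le> CARD('n) * norm (A - B)"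
    by (simp add: card_mono mult_right_mono)
  finally show ?thesis by simp
qed

text \<open>One eigenvalue is the difference of the sums over \<open>{..i}\<close> and
  \<open>{..<i}\<close>, which doubles the constant. Passing through the 1-norm costs another factor
  \<open>CARD('n)\<close>. The constant is far from sharp, but only its being independent of the
  matrices matters.\<close>

lemma ordered_eigenvalues_lipschitz:
  fixes A B :: "complex ^ ('n::{finite,linorder}) ^ 'n::{finite,linorder}"
  assumes A: "A \<in> Herm" and B: "B \<in> Herm"
  shows "norm (ordered_eigenvalues A - ordered_eigenvalues B) \<le> 2 * (real CARD('n))\<^sup>2 * norm (A - B)"
proof -
  have *: "\<bar>(\<Sum>i\<in>I. ordered_eigenvalues A $ i) - (\<Sum>i\<in>I. ordered_eigenvalues B $ i)\<bar>
      \<le> CARD('n) * norm (A - B)" if "\<And>i j. i \<in> I \<Longrightarrow> j \<le> i \<Longrightarrow> j \<in> I" for I :: "'n::{finite,linorder} set"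
  proof -
    have "(\<Sum>i\<in>I. ordered_eigenvalues A $ i) \<le> (\<Sum>i\<in>I. ordered_eigenvalues B $ i) + CARD('n) * norm (A - B)"
      by (rule sum_ordered_eigenvalues_le[OF A B]) (use that in blast)
    moreover have "(\<Sum>i\<in>I. ordered_eigenvalues B $ i) \<le> (\<Sum>i\<in>I. ordered_eigenvalues A $ i) + CARD('n) * norm (B - A)"
      by (rule sum_ordered_eigenvalues_le[OF B A]) (use that in blast)
    ultimately show ?thesis
      by (simp add: norm_minus_commute abs_le_iff)
  qed
  have "\<bar>(ordered_eigenvalues A - ordered_eigenvalues B) $ i\<bar> \<le> 2 * (CARD('n) * norm (A - B))" for i
  proof -
    have "{..i} = insert i {..<i}" by auto
    then have "(\<Sum>k\<le>i. x $ k) = x $ i + (\<Sum>k<i. x $ k)" for x :: "real ^ 'n::{finite,linorder}"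
      by simp
    then show ?thesis
      using *[of "{..i}"] *[of "{..<i}"] by fastforce
  qed
  then have "(\<Sum>i\<in>UNIV. \<bar>(ordered_eigenvalues A - ordered_eigenvalues B) $ i\<bar>)
      \<le> (\<Sum>i\<in>(UNIV :: 'n::{finite,linorder} set). 2 * (CARD('n) * norm (A - B)))"
    by (intro sum_mono)
  then show ?thesis
    using norm_le_l1_cart[of "ordered_eigenvalues A - ordered_eigenvalues B"]
    by (simp add: power2_eq_square mult_ac)
qed

text \<open>
  The partial sums of eigenvalues are touched from above at \<open>0\<close> by the linear functionals
  given by the eigenbasis of \<open>a 0\<close>, so that both have the same derivative there.
\<close>

lemma derivative_ordered_eigenvalues:
  fixes a :: "real \<Rightarrow> complex ^ ('n::{finite,linorder}) ^ 'n::{finite,linorder}"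
  assumes herm: "\<forall>\<^sub>F t in nhds 0. a t \<in> Herm"
    and a: "(a has_vector_derivative B) (at 0)"
    and D: "((\<lambda>t. ordered_eigenvalues (a t)) has_vector_derivative D) (at 0)"
    and v: "eigenbasis (a 0) v l"
  shows "D $ j = v j \<bullet> (B *v v j)"
proof -
  have vb: "orthonormal_basis v" using v by (simp add: eigenbasis_def)
  have l: "l i = ordered_eigenvalues (a 0) $ i" for i
    using ordered_eigenvalues_eigenbasis[OF v] by simp
  have sums: "(\<Sum>i\<in>I. D $ i) = (\<Sum>i\<in>I. v i \<bullet> (B *v v i))"
    if I: "\<And>i j. i \<in> I \<Longrightarrow> j \<le> i \<Longrightarrow> j \<in> I" for I
  proof -
    define \<phi> where "\<phi> = (\<lambda>t. (\<Sum>i\<in>I. v i \<bullet> (a t *v v i)) - (\<Sum>i\<in>I. ordered_eigenvalues (a t) $ i))"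
    have 1: "((\<lambda>t. v i \<bullet> (a t *v v i)) has_vector_derivative v i \<bullet> (B *v v i)) (at 0)" for i
    proof -
      have "linear (\<lambda>M :: complex ^ ('n::{finite,linorder}) ^ 'n::{finite,linorder}. v i \<bullet> (M *v v i))"
        by (rule linearI) (auto simp: matrix_vector_mult_add_rdistrib inner_add_right
            scaleR_matrix_vector)
      then have "bounded_linear (\<lambda>M :: complex ^ ('n::{finite,linorder}) ^ 'n::{finite,linorder}. v i \<bullet> (M *v v i))"
        by (rule linear_conv_bounded_linear[THEN iffD1])
      then show ?thesis
        by (rule bounded_linear.has_vector_derivative[OF _ a])
    qed
    have 2: "((\<lambda>t. ordered_eigenvalues (a t) $ i) has_vector_derivative D $ i) (at 0)" for i
      by (rule bounded_linear.has_vector_derivative[OF bounded_linear_vec_nth D])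
    have "(\<phi> has_real_derivative (\<Sum>i\<in>I. v i \<bullet> (B *v v i)) - (\<Sum>i\<in>I. D $ i)) (at 0)"
      unfolding \<phi>_def has_real_derivative_iff_has_vector_derivative
      by (intro has_vector_derivative_diff has_vector_derivative_sum 1 2)
    moreover obtain d where d: "d > 0" "\<And>t. \<bar>t\<bar> < d \<Longrightarrow> a t \<in> Herm"
      using herm by (auto simp: eventually_nhds_metric dist_real_def)
    moreover have "\<phi> 0 \<le> \<phi> t" if t: "\<bar>0 - t\<bar> < d" for t
    proof -
      have "a t \<in> Herm" using t d by simp
      then obtain w where w: "eigenbasis (a t) w (($) (ordered_eigenvalues (a t)))"
        by (rule exists_eigenbasis_ordered)
      show ?thesis
        using ky_fan[OF w vb I] by (simp add: \<phi>_def eigenbasis_rayleigh[OF v] l)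
    qed
    ultimately have "(\<Sum>i\<in>I. v i \<bullet> (B *v v i)) - (\<Sum>i\<in>I. D $ i) = 0"
      using DERIV_local_min[of \<phi> _ 0 d] by blast
    then show ?thesis by simp
  qed
  have "{..j} = insert j {..<j}" by auto
  then show ?thesis
    using sums[of "{..j}"] sums[of "{..<j}"] by fastforce
qed

section \<open>Limits of eigenbases and of eigenvalue derivatives\<close>

text \<open>Bases of unit vectors, packed as the rows of a matrix, form a bounded sequence, so one
  subsequence serves all vectors. Orthonormality passes to the limit, and so do the eigenvector
  equations, since the ordered eigenvalues are continuous.\<close>

lemma convergent_eigenbases:
  fixes A :: "nat \<Rightarrow> complex ^ ('n::{finite,linorder}) ^ 'n::{finite,linorder}"
  assumes A: "\<And>n. A n \<in> Herm" and lim: "A \<longlonglongrightarrow> A'" and A': "A' \<in> Herm"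
  obtains r v v' l where "strict_mono (r :: nat \<Rightarrow> nat)"
    "\<And>n. eigenbasis (A (r n)) (v n) (($) (ordered_eigenvalues (A (r n))))"
    "eigenbasis A' v' l" "\<And>j. (\<lambda>n. v n j) \<longlonglongrightarrow> v' j"
proof -
  have "\<exists>v. eigenbasis (A n) v (($) (ordered_eigenvalues (A n)))" for n
    using exists_eigenbasis_ordered[OF A] by metis
  then obtain v where v: "\<And>n. eigenbasis (A n) (v n) (($) (ordered_eigenvalues (A n)))"
    by metis
  have nv: "norm (v n j) = 1" for n j
    using v by (auto simp: eigenbasis_def intro: orthonormal_basis_norm)
  have "bounded (range (\<lambda>n. \<chi> j. v n j))"
  proof -
    have "norm (\<chi> j. v n j) \<le> CARD('n)" for n
      using L2_set_le_sum[of UNIV "\<lambda>j. norm (v n j)"] by (simp add: norm_vec_def[of "\<chi> j. v n j"] nv)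
    then show ?thesis by (auto simp: bounded_iff)
  qed
  then obtain V r where r: "strict_mono (r :: nat \<Rightarrow> nat)" and V: "((\<lambda>n. \<chi> j. v n j) \<circ> r) \<longlonglongrightarrow> V"
    using bounded_imp_convergent_subsequence by blast
  have vlim: "(\<lambda>n. v (r n) j) \<longlonglongrightarrow> V $ j" for j
    using tendsto_vec_nth[OF V, of j] by (simp add: o_def)
  have Alim: "(\<lambda>n. A (r n)) \<longlonglongrightarrow> A'"
    using LIMSEQ_subseq_LIMSEQ[OF lim r] by (simp add: o_def)
  have "orthonormal_basis (($) V)"
    unfolding orthonormal_basis_def
  proof (intro allI)
    fix i j :: "'n::{finite,linorder}"
    have "(\<lambda>n. hip (v (r n) i) (v (r n) j)) \<longlonglongrightarrow> hip (V $ i) (V $ j)"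
      unfolding hip_def by (intro tendsto_intros vlim)
    moreover have "hip (v (r n) i) (v (r n) j) = (if i = j then 1 else 0)" for n
      using v by (simp add: eigenbasis_def orthonormal_basis_def)
    ultimately show "hip (V $ i) (V $ j) = (if i = j then 1 else 0)"
      by (simp add: LIMSEQ_const_iff)
  qed
  moreover have "mono (($) (ordered_eigenvalues A'))"
    using exists_eigenbasis_ordered[OF A'] by (metis eigenbasis_def)
  moreover have "A' *v V $ j = of_real (ordered_eigenvalues A' $ j) *s V $ j" for j
  proof (rule LIMSEQ_unique)
    show "(\<lambda>n. A (r n) *v v (r n) j) \<longlonglongrightarrow> A' *v V $ j"
      unfolding matrix_vector_mult_def by (intro tendsto_intros Alim vlim)
    have "(\<lambda>n. norm (A (r n) - A')) \<longlonglongrightarrow> 0"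
      using Alim by (simp add: tendsto_norm_zero_iff LIM_zero_iff)
    then have "(\<lambda>n. 2 * (real CARD('n))\<^sup>2 * norm (A (r n) - A')) \<longlonglongrightarrow> 0"
      by (rule tendsto_mult_right_zero)
    then have "(\<lambda>n. ordered_eigenvalues (A (r n)) - ordered_eigenvalues A') \<longlonglongrightarrow> 0"
      by (rule Lim_null_comparison[rotated]) (auto intro!: always_eventually ordered_eigenvalues_lipschitz A A')
    then have "(\<lambda>n. ordered_eigenvalues (A (r n))) \<longlonglongrightarrow> ordered_eigenvalues A'"
      by (simp add: LIM_zero_iff)
    moreover have "A (r n) *v v (r n) j = of_real (ordered_eigenvalues (A (r n)) $ j) *s v (r n) j" for n
      using v by (simp add: eigenbasis_def)
    ultimately show "(\<lambda>n. A (r n) *v v (r n) j) \<longlonglongrightarrow> of_real (ordered_eigenvalues A' $ j) *s V $ j"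
      using vlim by (auto simp: vector_scalar_mult_def intro!: tendsto_intros)
  qed
  ultimately have "eigenbasis A' (($) V) (($) (ordered_eigenvalues A'))"
    by (simp add: eigenbasis_def)
  with r v vlim show thesis by (intro that[of r "\<lambda>n. v (r n)"]) auto
qed

text \<open>If \<open>D\<close> stayed away from \<open>D'\<close> along a subsequence, eigenbases
  would converge along a further one, to an eigenbasis of \<open>A'\<close> over which there is no
  control. This is harmless because the formula for \<open>D'\<close> holds for every eigenbasis of
  \<open>A'\<close>.\<close>

lemma tendsto_eigenvalue_derivatives:
  fixes A :: "nat \<Rightarrow> complex ^ ('n::{finite,linorder}) ^ 'n::{finite,linorder}"
  assumes A: "\<And>n. A n \<in> Herm" and lim: "A \<longlonglongrightarrow> A'" and A': "A' \<in> Herm" and B: "B \<longlonglongrightarrow> B'"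
    and D: "\<And>n v l j. eigenbasis (A n) v l \<Longrightarrow> D n $ j = v j \<bullet> (B n *v v j)"
    and D': "\<And>v l j. eigenbasis A' v l \<Longrightarrow> D' $ j = v j \<bullet> (B' *v v j)"
  shows "D \<longlonglongrightarrow> D'"
proof (rule ccontr)
  assume "\<not> D \<longlonglongrightarrow> D'"
  then obtain e where e: "e > 0" "\<exists>\<^sub>F n in sequentially. \<not> dist (D n) D' < e"
    by (auto simp: tendsto_iff frequently_def)
  then have "infinite {n. \<not> dist (D n) D' < e}"
    unfolding cofinite_eq_sequentially[symmetric] frequently_cofinite by simp
  then obtain r :: "nat \<Rightarrow> nat" where r: "strict_mono r" "\<And>n. r n \<in> {n. \<not> dist (D n) D' < e}"
    using infinite_enumerate by blast
  have "(\<lambda>n. A (r n)) \<longlonglongrightarrow> A'"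
    using LIMSEQ_subseq_LIMSEQ[OF lim r(1)] by (simp add: o_def)
  then obtain s v v' l where s: "strict_mono (s :: nat \<Rightarrow> nat)"
    and v: "\<And>n. eigenbasis (A (r (s n))) (v n) (($) (ordered_eigenvalues (A (r (s n)))))"
    and v': "eigenbasis A' v' l" and vlim: "\<And>j. (\<lambda>n. v n j) \<longlonglongrightarrow> v' j"
    using convergent_eigenbases[of "\<lambda>n. A (r n)" A'] A A' by blast
  have Blim: "(\<lambda>n. B (r (s n))) \<longlonglongrightarrow> B'"
    using LIMSEQ_subseq_LIMSEQ[OF B strict_mono_o[OF r(1) s]] by (simp add: o_def)
  have "(\<lambda>n. D (r (s n)) $ j) \<longlonglongrightarrow> D' $ j" for j
    unfolding D[OF v] D'[OF v'] matrix_vector_mult_def by (intro tendsto_intros Blim vlim)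
  then have "(\<lambda>n. D (r (s n))) \<longlonglongrightarrow> D'"
    by (rule vec_tendstoI)
  then obtain n where "dist (D (r (s n))) D' < e"
    using e(1) by (auto simp: tendsto_iff eventually_sequentially)
  then show False using r(2)[of "s n"] by simp
qed

section \<open>Lipschitz functions and their directional derivatives\<close>

lemma increasing_lipschitz_density:
  fixes F :: "real \<Rightarrow> real"
  assumes L: "L-lipschitz_on UNIV F" and expand: "\<And>x y. x \<le> y \<Longrightarrow> y - x \<le> F y - F x"
  obtains g where "\<And>a b. a \<le> b \<Longrightarrow> (g has_integral F b - F a) {a..b}"
proof -
  have cont: "continuous_on UNIV F"
    using L by (rule lipschitz_on_continuous_on)
  have smono: "strict_mono F"
    using expand by (intro strict_monoI) (smt (verit) less_imp_le)
  then have "inj F" by (rule strict_mono_imp_inj_on)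
  have "\<exists>x. F x = y" for y
  proof -
    \<comment> \<open>Since \<open>F\<close> grows at least as fast as the identity, moving by
      \<open>c\<close> from 0 to either side takes its values past \<open>y\<close>.\<close>
    define c where "c = \<bar>y\<bar> + \<bar>F 0\<bar>"
    have "c \<ge> 0" by (simp add: c_def)
    then have "F (- c) \<le> y" "y \<le> F c"
      using expand[of "- c" 0] expand[of 0 c] c_def by linarith+
    moreover have "continuous_on {-c..c} F"
      using cont by (rule continuous_on_subset) simp
    ultimately show ?thesis
      using IVT'[of F "- c" y c] \<open>c \<ge> 0\<close> by auto
  qed
  then have "surj F" by (metis surjI)
  define H where "H = inv F"
  have FH: "F (H y) = y" for y using \<open>surj F\<close> by (simp add: H_def surj_f_inv_f)
  have HF: "H (F x) = x" for x using \<open>inj F\<close> by (simp add: H_def)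
  have "mono H"
    by (rule monoI) (metis FH linorder_not_less smono strict_monoD)
  then have [measurable]: "H \<in> borel_measurable borel"
    by (rule borel_measurable_mono)
  define M where "M = distr lborel borel H"
  have vimage: "H -` A = F ` A" for A
    using FH by (auto simp: HF image_iff) (metis FH)
  have "absolutely_continuous lborel M"
    unfolding absolutely_continuous_def
  proof
    fix N :: "real set" assume N: "N \<in> null_sets lborel"
    then have [measurable]: "N \<in> sets borel" by auto
    have "negligible N"
      using N by (simp add: negligible_iff_null_sets null_sets_completionI)
    then have "negligible (F ` N)"
    proof (rule negligible_locally_Lipschitz_image[rotated])
      fix x assume "x \<in> N"
      show "\<exists>T B. open T \<and> x \<in> T \<and> (\<forall>y\<in>N \<inter> T. norm (F y - F x) \<le> B * norm (y - x))"
        using L by (intro exI[of _ UNIV] exI[of _ L]) (auto simp: lipschitz_on_def dist_norm)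
    qed simp
    moreover have "F ` N \<in> sets borel"
      using measurable_sets_borel[of H borel N] by (simp flip: vimage)
    ultimately have "emeasure lborel (F ` N) = 0"
      by (simp add: negligible_iff_null_sets null_sets_completion_iff null_setsD1)
    then show "N \<in> null_sets M"
      by (auto simp: M_def null_sets_def emeasure_distr vimage)
  qed
  moreover have "sets M = sets lborel"
    by (simp add: M_def)
  ultimately obtain p where p [measurable]: "p \<in> borel_measurable lborel" and dens: "density lborel p = M"
    using sigma_finite_measure.Radon_Nikodym[OF sigma_finite_lborel] by blast
  have p_int: "(\<integral>\<^sup>+x. p x * indicator {a..b} x \<partial>lborel) = ennreal (F b - F a)" if "a \<le> b" for a b
  proof -
    have "(\<integral>\<^sup>+x. p x * indicator {a..b} x \<partial>lborel) = emeasure M {a..b}"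
      by (simp add: dens[symmetric] emeasure_density)
    also have "\<dots> = emeasure lborel (H -` {a..b})"
      by (simp add: M_def emeasure_distr)
    also have "H -` {a..b} = {F a..F b}"
      using \<open>mono H\<close> HF FH smono by (auto simp: monoD) (metis FH strict_mono_less_eq smono)+
    also have "emeasure lborel {F a..F b} = ennreal (F b - F a)"
      using that smono by (simp add: strict_mono_less_eq)
    finally show ?thesis .
  qed
  define g where "g = (\<lambda>x. enn2real (p x))"
  \<comment> \<open>The density takes values in \<open>ennreal\<close>. It is finite almost
    everywhere because its integral over each interval from \<open>-n\<close> to \<open>n\<close> is
    finite, so a real-valued version exists.\<close>
  have fin: "AE x in lborel. p x \<noteq> \<infinity>"
  proof -
    have "AE x in lborel. p x * indicator {- real n..real n} x \<noteq> \<infinity>" for n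
      by (rule nn_integral_PInf_AE) (auto simp: p_int)
    then have "AE x in lborel. \<forall>n. p x * indicator {- real n..real n} x \<noteq> \<infinity>"
      by (simp add: AE_all_countable)
    then show ?thesis
    proof (rule AE_mp, intro AE_I2 impI)
      fix x assume *: "\<forall>n. p x * indicator {- real n..real n} x \<noteq> \<infinity>"
      obtain n where "\<bar>x\<bar> \<le> real n" using real_arch_simple by blast
      then show "p x \<noteq> \<infinity>"
        using *[rule_format, of n] by (auto simp: abs_le_iff indicator_def split: if_splits)
    qed
  qed
  show thesis
  proof (rule that)
    fix a b :: real assume "a \<le> b"
    have "(\<integral>\<^sup>+x. ennreal (g x * indicator {a..b} x) \<partial>lborel) = (\<integral>\<^sup>+x. p x * indicator {a..b} x \<partial>lborel)"
      using fin by (intro nn_integral_cong_AE) (auto simp: g_def indicator_def less_top ennreal_mult)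
    also have "\<dots> = ennreal (F b - F a)"
      by (rule p_int) fact
    finally have "((\<lambda>x. g x * indicator {a..b} x) has_integral F b - F a) UNIV"
      using \<open>a \<le> b\<close> smono
      by (intro nn_integral_has_integral) (auto simp: g_def strict_mono_less_eq)
    moreover have "(\<lambda>x. g x * indicator {a..b} x) = (\<lambda>x. if x \<in> {a..b} then g x else 0)"
      by (auto simp: indicator_def fun_eq_iff)
    ultimately show "(g has_integral F b - F a) {a..b}"
      by (simp only: has_integral_restrict_UNIV)
  qed
qed

text \<open>Lebesgue's differentiation theorem, in the form with boxes that have \<open>x\<close> as
  their lower corner. Such averages see only what lies to the right of \<open>x\<close>, hence the
  one-sided conclusion.\<close>

lemma has_integral_right_derivative:
  fixes F :: "real \<Rightarrow> real"
  assumes int: "\<And>a b. a \<le> b \<Longrightarrow> (g has_integral F b - F a) {a..b}"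
  obtains N where "negligible N"
    "\<And>x. x \<notin> N \<Longrightarrow> (F has_real_derivative g x) (at_right x)"
proof -
  have int': "g integrable_on cbox a b" for a b
    using int[of a b] by (cases "a \<le> b") auto
  obtain N where N: "negligible N" and
    lim: "\<And>x e. \<lbrakk>x \<notin> N; 0 < e\<rbrakk> \<Longrightarrow> \<exists>d>0. \<forall>h. 0 < h \<and> h < d \<longrightarrow>
      norm (integral (cbox x (x + h *\<^sub>R One)) g /\<^sub>R h ^ DIM(real) - g x) < e"
    using integrable_ccontinuous_explicit[OF int'] by blast
  show thesis
  proof (rule that[OF N])
    fix x assume x: "x \<notin> N"
    have "((\<lambda>y. (F y - F x) / (y - x)) \<longlongrightarrow> g x) (at_right x)"
    proof (rule tendstoI)
      fix e :: real assume "e > 0"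
      obtain d where d: "d > 0" "\<And>h. 0 < h \<Longrightarrow> h < d \<Longrightarrow>
          norm (integral (cbox x (x + h *\<^sub>R One)) g /\<^sub>R h ^ DIM(real) - g x) < e"
        using lim[OF x \<open>e > 0\<close>] by blast
      have "dist ((F y - F x) / (y - x)) (g x) < e" if "x < y" "y < x + d" for y
        using d(2)[of "y - x"] that integral_unique[OF int[of x y]]
        by (simp add: dist_real_def divide_inverse mult.commute)
      then show "\<forall>\<^sub>F y in at_right x. dist ((F y - F x) / (y - x)) (g x) < e"
        unfolding eventually_at_right_field using d(1) by (intro exI[of _ "x + d"]) auto
    qed
    then show "(F has_real_derivative g x) (at_right x)"
      by (simp add: has_field_derivative_iff)
  qed
qed

text \<open>A linear term makes the function increasing, so that it is the integral of a density.
  Right derivatives come from the density, left derivatives from the reflected function.\<close>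

proposition lipschitz_real_AE_differentiable:
  fixes f :: "real \<Rightarrow> real"
  assumes L: "L-lipschitz_on UNIV f"
  obtains N where "negligible N" "\<And>x. x \<notin> N \<Longrightarrow> f differentiable (at x)"
proof -
  \<comment> \<open>Slopes of \<open>f\<close> are at least \<open>- L\<close>, so those of
    \<open>F\<close> are at least 1.\<close>
  define F where "F = (\<lambda>x. f x + (L + 1) * x)"
  have fL: "\<bar>f x - f y\<bar> \<le> L * \<bar>x - y\<bar>" for x y
    using L by (auto simp: lipschitz_on_def dist_real_def)
  have "L \<ge> 0" using L by (rule lipschitz_on_nonneg)
  have expand: "y - x \<le> F y - F x" if "x \<le> y" for x y
    using fL[of y x] that by (simp add: F_def algebra_simps)
  have "(L + (L + 1))-lipschitz_on UNIV F"
    unfolding F_def using L \<open>L \<ge> 0\<close>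
    by (intro lipschitz_on_add) (auto simp: lipschitz_on_def dist_real_def abs_mult simp flip: right_diff_distrib)
  then obtain g where g: "\<And>a b. a \<le> b \<Longrightarrow> (g has_integral F b - F a) {a..b}"
    using increasing_lipschitz_density[OF _ expand] by blast
  obtain N where N: "negligible N" and right: "\<And>x. x \<notin> N \<Longrightarrow> (F has_real_derivative g x) (at_right x)"
    using has_integral_right_derivative[OF g] by blast
  \<comment> \<open>The reflection of \<open>F\<close> through the origin has the reflected density.
    Hence the left derivative of \<open>F\<close> at \<open>x\<close> is again \<open>g x\<close>,
    the same value as the right one.\<close>
  have "((\<lambda>x. g (- x)) has_integral - F (- b) - (- F (- a))) {a..b}" if "a \<le> b" for a b
    using has_integral_reflect_real[of "\<lambda>x. g (- x)" "F (- a) - F (- b)" b a] g[of "- b" "- a"] that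
    by (simp del: has_integral_reflect_real)
  then obtain N' where N': "negligible N'"
    and left: "\<And>x. x \<notin> N' \<Longrightarrow> ((\<lambda>x. - F (- x)) has_real_derivative g (- x)) (at_right x)"
    using has_integral_right_derivative[of "\<lambda>x. g (- x)" "\<lambda>x. - F (- x)"] by blast
  show thesis
  proof (rule that)
    show "negligible (N \<union> uminus ` N')"
    proof (intro negligible_Un N negligible_locally_Lipschitz_image N')
      show "\<exists>T B. open T \<and> x \<in> T \<and> (\<forall>y\<in>N' \<inter> T. norm (- y - - x) \<le> B * norm (y - x))" for x
        by (intro exI[of _ UNIV] exI[of _ 1]) auto
    qed simp
    fix x assume x: "x \<notin> N \<union> uminus ` N'"
    then have "- x \<notin> N'" by (metis UnCI image_eqI minus_minus)
    from left[OF this] have "((\<lambda>y. (- F (- y) + F x) / (y + x)) \<longlongrightarrow> g x) (at_right (- x))"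
      by (simp add: has_field_derivative_iff)
    then have "((\<lambda>y. (- F y + F x) / (- y + x)) \<longlongrightarrow> g x) (at_left x)"
      by (subst (asm) at_right_minus) (simp add: filterlim_filtermap)
    moreover have "(- F y + F x) / (- y + x) = (F y - F x) / (y - x)" for y
      by (metis minus_diff_eq minus_divide_divide uminus_add_conv_diff)
    ultimately have "(F has_real_derivative g x) (at_left x)"
      by (simp add: has_field_derivative_iff)
    then have "(F has_real_derivative g x) (at x)"
      using right[of x] x by (auto simp: has_field_derivative_iff filterlim_at_split)
    then have "((\<lambda>x. F x - (L + 1) * x) has_real_derivative g x - (L + 1)) (at x)"
      by (auto intro!: derivative_eq_intros)
    then show "f differentiable (at x)"
      by (auto simp: F_def real_differentiable_def)
  qed
qed

section \<open>Extension of Lipschitz functions to the whole space\<close>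

text \<open>McShane's formula: the infimum of the cones of slope \<open>L\<close> with apex on the
  graph of \<open>f\<close>. All cones lie above the downward cone at one fixed point
  \<open>s\<close>, so the infimum exists.\<close>

lemma lipschitz_extension_real:
  fixes f :: "'a::metric_space \<Rightarrow> real"
  assumes L: "L-lipschitz_on S f"
  obtains g where "L-lipschitz_on UNIV g" "\<And>x. x \<in> S \<Longrightarrow> g x = f x"
proof (cases "S = {}")
  case True
  have "L-lipschitz_on UNIV (\<lambda>_ :: 'a. 0 :: real)"
    using lipschitz_on_nonneg[OF L] by (auto simp: lipschitz_on_def)
  with True show ?thesis by (intro that) auto
next
  case False
  then obtain s where s: "s \<in> S" by blast
  have "L \<ge> 0" using L by (rule lipschitz_on_nonneg)
  have fL: "\<bar>f x - f y\<bar> \<le> L * dist x y" if "x \<in> S" "y \<in> S" for x y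
    using L that by (auto simp: lipschitz_on_def dist_real_def)
  define g where "g = (\<lambda>x. INF y\<in>S. f y + L * dist x y)"
  have bdd: "bdd_below ((\<lambda>y. f y + L * dist x y) ` S)" for x
  proof (rule bdd_belowI2)
    fix y assume "y \<in> S"
    have "L * dist s y \<le> L * dist s x + L * dist x y"
      using \<open>L \<ge> 0\<close> by (metis dist_triangle distrib_left mult_left_mono)
    then show "f s - L * dist s x \<le> f y + L * dist x y"
      using fL[OF s \<open>y \<in> S\<close>] by linarith
  qed
  show ?thesis
  proof (rule that)
    have le: "g x - g z \<le> L * dist x z" for x z
    proof -
      have "g x - L * dist x z \<le> f y + L * dist z y" if "y \<in> S" for y
      proof -
        have "g x \<le> f y + L * dist x y"
          unfolding g_def by (rule cINF_lower[OF bdd that])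
        moreover have "L * dist x y \<le> L * dist x z + L * dist z y"
          using \<open>L \<ge> 0\<close> by (metis dist_triangle distrib_left mult_left_mono)
        ultimately show ?thesis by linarith
      qed
      then have "g x - L * dist x z \<le> g z"
        unfolding g_def by (intro cINF_greatest False) (auto simp: g_def)
      then show ?thesis by linarith
    qed
    show "L-lipschitz_on UNIV g"
    proof (rule lipschitz_onI)
      show "dist (g x) (g z) \<le> L * dist x z" for x z
        using le[of x z] le[of z x] by (simp add: dist_real_def dist_commute abs_le_iff)
    qed fact
    fix x assume x: "x \<in> S"
    show "g x = f x"
    proof (rule antisym)
      show "g x \<le> f x"
        using cINF_lower[OF bdd x, of x] by (simp add: g_def)
      show "f x \<le> g x"
        unfolding g_def using fL[OF x] False by (intro cINF_greatest) (auto simp: abs_le_iff algebra_simps)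
    qed
  qed
qed

text \<open>Extension coordinate by coordinate, which enlarges the constant. Where the constant of
  \<open>f\<close> on its own domain matters, it is recovered by
  \<open>lipschitz_derivative_bound\<close>.\<close>

lemma lipschitz_extension:
  fixes f :: "'a::metric_space \<Rightarrow> 'v::euclidean_space"
  assumes L: "L-lipschitz_on S f"
  obtains C g where "C-lipschitz_on UNIV g" "\<And>x. x \<in> S \<Longrightarrow> g x = f x"
proof -
  have "\<exists>g. L-lipschitz_on UNIV g \<and> (\<forall>x\<in>S. g x = f x \<bullet> b)" if "b \<in> Basis" for b
  proof -
    have "L-lipschitz_on S (\<lambda>x. f x \<bullet> b)"
      using L that unfolding lipschitz_on_def dist_norm
      by (metis inner_diff_left norm_nth_le order_trans real_norm_def Basis_le_norm)
    then show ?thesis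
      by (rule lipschitz_extension_real) blast
  qed
  then obtain g where g: "\<And>b. b \<in> Basis \<Longrightarrow> L-lipschitz_on UNIV (g b)"
      "\<And>b x. b \<in> Basis \<Longrightarrow> x \<in> S \<Longrightarrow> g b x = f x \<bullet> b"
    by metis
  show thesis
  proof (rule that)
    show "(DIM('v) * L)-lipschitz_on UNIV (\<lambda>x. \<Sum>b\<in>Basis. g b x *\<^sub>R b)"
    proof (rule lipschitz_onI)
      fix x y
      have "dist (\<Sum>b\<in>Basis. g b x *\<^sub>R b) (\<Sum>b\<in>Basis. g b y *\<^sub>R b) =
          norm (\<Sum>b\<in>Basis. (g b x - g b y) *\<^sub>R b)"
        by (simp add: dist_norm sum_subtractf scaleR_diff_left)
      also have "\<dots> \<le> (\<Sum>b\<in>(Basis :: 'v set). L * dist x y)"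
        using g(1) by (intro sum_norm_le) (auto simp: lipschitz_on_def dist_real_def)
      finally show "dist (\<Sum>b\<in>Basis. g b x *\<^sub>R b) (\<Sum>b\<in>Basis. g b y *\<^sub>R b) \<le> DIM('v) * L * dist x y"
        by simp
    qed (use lipschitz_on_nonneg[OF L] in simp)
    fix x assume "x \<in> S"
    then show "(\<Sum>b\<in>Basis. g b x *\<^sub>R b) = f x"
      by (simp add: g(2) euclidean_representation)
  qed
qed

section \<open>Directional derivatives in several variables\<close>

text \<open>Differentiability expressed by countably many inequalities, which makes the set of bad
  points a Borel set. Continuity of \<open>\<phi>\<close> permits the restriction to rational
  increments.\<close>

lemma has_real_derivative_Rats:
  fixes \<phi> :: "real \<Rightarrow> real"
  assumes cont: "continuous_on UNIV \<phi>"
  shows "(\<phi> has_real_derivative D) (at 0) \<longleftrightarrow>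
    (\<forall>n::nat. \<exists>k::nat. \<forall>t\<in>\<rat>. \<bar>t\<bar> < 1 / (real k + 1) \<longrightarrow> \<bar>\<phi> t - \<phi> 0 - t * D\<bar> \<le> \<bar>t\<bar> / (real n + 1))"
    (is "?lhs \<longleftrightarrow> ?rhs")
proof
  assume ?lhs
  then have lim: "(\<lambda>t. (\<phi> t - \<phi> 0) / t) \<midarrow>0\<rightarrow> D"
    by (simp add: has_field_derivative_iff)
  show ?rhs
  proof
    fix n :: nat
    obtain d where d: "d > 0" "\<And>t. t \<noteq> 0 \<Longrightarrow> \<bar>t\<bar> < d \<Longrightarrow> \<bar>(\<phi> t - \<phi> 0) / t - D\<bar> < 1 / (real n + 1)"
      using LIM_D[OF lim, of "1 / (real n + 1)"] by auto
    obtain k :: nat where k: "1 / (real k + 1) < d"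
      using d(1) by (metis nat_approx_posE of_nat_Suc add.commute)
    have "\<bar>\<phi> t - \<phi> 0 - t * D\<bar> \<le> \<bar>t\<bar> / (real n + 1)" if "\<bar>t\<bar> < 1 / (real k + 1)" for t
    proof (cases "t = 0")
      case False
      have "\<phi> t - \<phi> 0 - t * D = t * ((\<phi> t - \<phi> 0) / t - D)"
        using False by (simp add: field_simps)
      then have "\<bar>\<phi> t - \<phi> 0 - t * D\<bar> = \<bar>t\<bar> * \<bar>(\<phi> t - \<phi> 0) / t - D\<bar>"
        by (simp add: abs_mult)
      also have "\<dots> \<le> \<bar>t\<bar> * (1 / (real n + 1))"
        using d(2)[OF False] that k by (intro mult_left_mono) auto
      finally show ?thesis by simp
    qed auto
    then show "\<exists>k::nat. \<forall>t\<in>\<rat>. \<bar>t\<bar> < 1 / (real k + 1) \<longrightarrow> \<bar>\<phi> t - \<phi> 0 - t * D\<bar> \<le> \<bar>t\<bar> / (real n + 1)"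
      by blast
  qed
next
  assume R: ?rhs
  have "(\<lambda>t. (\<phi> t - \<phi> 0) / t) \<midarrow>0\<rightarrow> D"
  proof (rule LIM_I)
    fix e :: real assume "e > 0"
    then obtain n :: nat where n: "1 / (real n + 1) < e"
      by (metis nat_approx_posE of_nat_Suc add.commute)
    obtain k :: nat where k: "\<And>t. t \<in> \<rat> \<Longrightarrow> \<bar>t\<bar> < 1 / (real k + 1) \<Longrightarrow>
        \<bar>\<phi> t - \<phi> 0 - t * D\<bar> \<le> \<bar>t\<bar> / (real n + 1)"
      using R by blast
    \<comment> \<open>A real \<open>t\<close> is approximated by rationals \<open>q j\<close>. They
      eventually meet the strict bound on the increment, and the non-strict estimate survives the
      limit.\<close>
    have all: "\<bar>\<phi> t - \<phi> 0 - t * D\<bar> \<le> \<bar>t\<bar> / (real n + 1)" if t: "\<bar>t\<bar> < 1 / (real k + 1)" for t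
    proof -
      have "\<exists>q\<in>\<rat>. \<bar>q - t\<bar> < 1 / (real j + 1)" for j :: nat
        using Rats_dense_in_real[of "t - 1 / (real j + 1)" "t + 1 / (real j + 1)"]
        by (force simp: abs_less_iff)
      then obtain q where q: "\<And>j. q j \<in> \<rat>" "\<And>j :: nat. \<bar>q j - t\<bar> < 1 / (real j + 1)"
        by metis
      have "(\<lambda>j. q j - t) \<longlonglongrightarrow> 0"
        by (rule Lim_null_comparison[OF _ LIMSEQ_inverse_real_of_nat])
          (use q(2) in \<open>auto intro!: always_eventually less_imp_le simp: inverse_eq_divide add.commute\<close>)
      then have qt: "q \<longlonglongrightarrow> t" by (simp add: LIM_zero_iff)
      have "(\<lambda>j. \<phi> (q j)) \<longlonglongrightarrow> \<phi> t"
        using continuous_on_tendsto_compose[OF cont qt] by simp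
      then have "(\<lambda>j. \<bar>\<phi> (q j) - \<phi> 0 - q j * D\<bar>) \<longlonglongrightarrow> \<bar>\<phi> t - \<phi> 0 - t * D\<bar>"
        by (intro tendsto_intros qt)
      moreover have "(\<lambda>j. \<bar>q j\<bar> / (real n + 1)) \<longlonglongrightarrow> \<bar>t\<bar> / (real n + 1)"
        by (intro tendsto_intros qt) auto
      moreover have "\<forall>\<^sub>F j in sequentially. \<bar>q j\<bar> < 1 / (real k + 1)"
        using tendsto_rabs[OF qt] t by (rule order_tendstoD)
      then have "\<forall>\<^sub>F j in sequentially. \<bar>\<phi> (q j) - \<phi> 0 - q j * D\<bar> \<le> \<bar>q j\<bar> / (real n + 1)"
        by eventually_elim (use k q in blast)
      ultimately show ?thesis
        by (intro tendsto_le[OF trivial_limit_sequentially])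
    qed
    show "\<exists>s>0. \<forall>t. t \<noteq> 0 \<and> norm (t - 0) < s \<longrightarrow> norm ((\<phi> t - \<phi> 0) / t - D) < e"
    proof (intro exI[of _ "1 / (real k + 1)"] conjI allI impI)
      fix t :: real assume t: "t \<noteq> 0 \<and> norm (t - 0) < 1 / (real k + 1)"
      have "(\<phi> t - \<phi> 0) / t - D = (\<phi> t - \<phi> 0 - t * D) / t"
        using t by (simp add: field_simps)
      then have "\<bar>(\<phi> t - \<phi> 0) / t - D\<bar> = \<bar>\<phi> t - \<phi> 0 - t * D\<bar> / \<bar>t\<bar>"
        by simp
      also have "\<dots> \<le> 1 / (real n + 1)"
        using all[of t] t by (simp add: field_simps)
      finally show "norm ((\<phi> t - \<phi> 0) / t - D) < e" using n by simp
    qed simp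
  qed
  then show ?lhs by (simp add: has_field_derivative_iff)
qed

text \<open>Translating by \<open>t *\<^sub>R e\<close> does not change the measure of
  \<open>N\<close>, so the measure may be averaged over \<open>t\<close> in the unit interval. After
  exchanging the integrals, the inner one runs along a line and vanishes. No coordinate has to be
  split off, and \<open>e\<close> may be any vector.\<close>

lemma AE_lborel_lines:
  fixes e :: "'a::euclidean_space"
  assumes [measurable]: "N \<in> sets borel"
    and lines: "\<And>x. negligible {t. x + t *\<^sub>R e \<in> N}"
  shows "AE x in lborel. x \<notin> N"
proof -
  have "emeasure lborel N = (\<integral>\<^sup>+t\<in>{0..1::real}. emeasure lborel N \<partial>lborel)"
    by (subst nn_integral_cmult_indicator) auto
  also have "\<dots> = (\<integral>\<^sup>+t\<in>{0..1::real}. (\<integral>\<^sup>+x. indicator N (x + t *\<^sub>R e) \<partial>lborel) \<partial>lborel)"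
  proof (intro nn_integral_cong)
    fix t :: real
    have "emeasure lborel N = (\<integral>\<^sup>+x. indicator N x \<partial>distr lborel borel ((+) (t *\<^sub>R e)))"
      unfolding lborel_distr_plus by simp
    also have "\<dots> = (\<integral>\<^sup>+x. indicator N (x + t *\<^sub>R e) \<partial>lborel)"
      by (subst nn_integral_distr) (auto simp: add.commute)
    finally show "emeasure lborel N * indicator {0..1} t =
        (\<integral>\<^sup>+x. indicator N (x + t *\<^sub>R e) \<partial>lborel) * indicator {0..1} t"
      by simp
  qed
  also have "\<dots> = (\<integral>\<^sup>+t. (\<integral>\<^sup>+x. indicator N (x + t *\<^sub>R e) * indicator {0..1::real} t \<partial>lborel) \<partial>lborel)"
    by (simp add: nn_integral_multc)
  also have "\<dots> = (\<integral>\<^sup>+x. (\<integral>\<^sup>+t. indicator N (x + t *\<^sub>R e) * indicator {0..1::real} t \<partial>lborel) \<partial>lborel)"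
    by (rule lborel_pair.Fubini') simp
  also have "\<dots> = 0"
  proof -
    have "(\<integral>\<^sup>+t. indicator N (x + t *\<^sub>R e) * indicator {0..1::real} t \<partial>lborel) = 0" for x
    proof -
      have "{t. x + t *\<^sub>R e \<in> N} \<in> sets borel" by measurable
      then have "{t. x + t *\<^sub>R e \<in> N} \<in> null_sets lborel"
        using lines[of x] by (simp add: negligible_iff_null_sets null_sets_completion_iff)
      then have "AE t in lborel. t \<notin> {t. x + t *\<^sub>R e \<in> N}"
        by (rule AE_not_in)
      then show ?thesis
        by (subst nn_integral_0_iff_AE) (auto simp: indicator_def)
    qed
    then show ?thesis by simp
  qed
  finally show ?thesis
    by (intro AE_not_in) (auto simp: null_sets_def)
qed

lemma lipschitz_directional_derivative_real:
  fixes f :: "'a::euclidean_space \<Rightarrow> real"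
  assumes L: "L-lipschitz_on UNIV f"
  obtains G where "G \<in> borel_measurable borel"
    "AE x in lborel. ((\<lambda>t. f (x + t *\<^sub>R e)) has_real_derivative G x) (at 0)"
proof -
  have cont: "continuous_on UNIV f"
    using L by (rule lipschitz_on_continuous_on)
  then have [measurable]: "f \<in> borel_measurable borel"
    by (rule borel_measurable_continuous_onI)
  have contl: "continuous_on UNIV (\<lambda>t. f (x + t *\<^sub>R e))" for x
    by (intro continuous_on_compose2[OF cont] continuous_intros) auto
  \<comment> \<open>A sequence of increments is enough to name the derivative, and a limit of
    measurable functions is measurable. Where the limit does not exist the value is unspecified, but
    still a Borel function of \<open>x\<close>.\<close>
  define G where "G = (\<lambda>x. lim (\<lambda>n. (f (x + (1 / (real n + 1)) *\<^sub>R e) - f x) * (real n + 1)))"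
  have [measurable]: "G \<in> borel_measurable borel"
    unfolding G_def by measurable
  have G: "G x = D" if D: "((\<lambda>t. f (x + t *\<^sub>R e)) has_real_derivative D) (at 0)" for x D
  proof -
    have "(\<lambda>t. (f (x + t *\<^sub>R e) - f x) / t) \<midarrow>0\<rightarrow> D"
      using D by (simp add: has_field_derivative_iff)
    moreover have "filterlim (\<lambda>n. 1 / (real n + 1)) (at 0) sequentially"
      using LIMSEQ_inverse_real_of_nat
      by (auto simp: filterlim_at inverse_eq_divide add.commute)
    ultimately have "(\<lambda>n. (f (x + (1 / (real n + 1)) *\<^sub>R e) - f x) / (1 / (real n + 1))) \<longlonglongrightarrow> D"
      by (rule filterlim_compose)
    then show ?thesis
      unfolding G_def by (intro limI) simp
  qed
  \<comment> \<open>The points where \<open>G\<close> fails to be the directional derivative, in the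
    countable form that shows the set to be Borel. On each line it is null by the one-dimensional
    result.\<close>
  define N where "N = {x. \<not> (\<forall>n::nat. \<exists>k::nat. \<forall>t\<in>\<rat>. \<bar>t\<bar> < 1 / (real k + 1) \<longrightarrow>
      \<bar>f (x + t *\<^sub>R e) - f (x + 0 *\<^sub>R e) - t * G x\<bar> \<le> \<bar>t\<bar> / (real n + 1))}"
  have N: "x \<in> N \<longleftrightarrow> \<not> ((\<lambda>t. f (x + t *\<^sub>R e)) has_real_derivative G x) (at 0)" for x
    unfolding N_def has_real_derivative_Rats[OF contl] by simp
  have "countable (\<rat> :: real set)" by (rule countable_rat)
  then have [measurable]: "N \<in> sets borel"
    unfolding N_def by measurable
  have "AE x in lborel. x \<notin> N"
  proof (rule AE_lborel_lines)
    fix x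
    have "(L * norm e)-lipschitz_on UNIV (\<lambda>t. f (x + t *\<^sub>R e))"
    proof (rule lipschitz_onI)
      fix s t :: real
      have "dist (f (x + s *\<^sub>R e)) (f (x + t *\<^sub>R e)) \<le> L * dist (x + s *\<^sub>R e) (x + t *\<^sub>R e)"
        by (rule lipschitz_onD[OF L]) auto
      also have "\<dots> = L * norm e * dist s t"
        by (simp add: dist_norm mult_ac flip: scaleR_diff_left)
      finally show "dist (f (x + s *\<^sub>R e)) (f (x + t *\<^sub>R e)) \<le> L * norm e * dist s t" .
    qed (use lipschitz_on_nonneg[OF L] in simp)
    then obtain M where M: "negligible M" "\<And>t. t \<notin> M \<Longrightarrow> (\<lambda>t. f (x + t *\<^sub>R e)) differentiable (at t)"
      using lipschitz_real_AE_differentiable by blast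
    have "t \<in> M" if t: "x + t *\<^sub>R e \<in> N" for t
    proof (rule ccontr)
      assume "t \<notin> M"
      then obtain D where "((\<lambda>t. f (x + t *\<^sub>R e)) has_real_derivative D) (at (0 + t))"
        using M(2) by (auto simp: real_differentiable_def)
      then have "((\<lambda>s. f (x + (s + t) *\<^sub>R e)) has_real_derivative D) (at 0)"
        by (subst (asm) DERIV_shift)
      then have *: "((\<lambda>s. f ((x + t *\<^sub>R e) + s *\<^sub>R e)) has_real_derivative D) (at 0)"
        by (simp add: algebra_simps)
      then show False
        using t G[OF *] by (simp add: N)
    qed
    then show "negligible {t. x + t *\<^sub>R e \<in> N}"
      using M(1) by (auto intro: negligible_subset)
  qed simp
  then show thesis
    by (intro that[of G]) (auto simp: N)
qed

lemma lipschitz_directional_derivative: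
  fixes f :: "'a::euclidean_space \<Rightarrow> 'v::euclidean_space"
  assumes L: "L-lipschitz_on UNIV f"
  obtains G where "G \<in> borel_measurable borel"
    "AE x in lborel. ((\<lambda>t. f (x + t *\<^sub>R e)) has_vector_derivative G x) (at 0)"
proof -
  have "\<forall>b\<in>Basis. \<exists>G. G \<in> borel_measurable borel \<and>
    (AE x in lborel. ((\<lambda>t. f (x + t *\<^sub>R e) \<bullet> b) has_real_derivative G x) (at 0))"
  proof
    fix b :: 'v assume that: "b \<in> Basis"
    have "L-lipschitz_on UNIV (\<lambda>x. f x \<bullet> b)"
      using L that unfolding lipschitz_on_def dist_norm
      by (metis inner_diff_left order_trans real_norm_def Basis_le_norm)
    then obtain G where "G \<in> borel_measurable borel"
        "AE x in lborel. ((\<lambda>t. f (x + t *\<^sub>R e) \<bullet> b) has_real_derivative G x) (at 0)"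
      by (rule lipschitz_directional_derivative_real)
    then show "\<exists>G. G \<in> borel_measurable borel \<and>
        (AE x in lborel. ((\<lambda>t. f (x + t *\<^sub>R e) \<bullet> b) has_real_derivative G x) (at 0))"
      by blast
  qed
  from bchoice[OF this] obtain G where [measurable]: "\<And>b. b \<in> Basis \<Longrightarrow> G b \<in> borel_measurable borel" and
    G: "\<And>b. b \<in> Basis \<Longrightarrow> AE x in lborel. ((\<lambda>t. f (x + t *\<^sub>R e) \<bullet> b) has_real_derivative G b x) (at 0)"
    by blast
  have "AE x in lborel. \<forall>b\<in>Basis. ((\<lambda>t. f (x + t *\<^sub>R e) \<bullet> b) has_real_derivative G b x) (at 0)"
    using G by (intro AE_finite_allI) auto
  then have "AE x in lborel. ((\<lambda>t. f (x + t *\<^sub>R e)) has_vector_derivative (\<Sum>b\<in>Basis. G b x *\<^sub>R b)) (at 0)"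
  proof (rule AE_mp, intro AE_I2 impI)
    fix x assume "\<forall>b\<in>Basis. ((\<lambda>t. f (x + t *\<^sub>R e) \<bullet> b) has_real_derivative G b x) (at 0)"
    then have "((\<lambda>t. \<Sum>b\<in>Basis. (f (x + t *\<^sub>R e) \<bullet> b) *\<^sub>R b) has_vector_derivative (\<Sum>b\<in>Basis. G b x *\<^sub>R b)) (at 0)"
      by (intro has_vector_derivative_sum) (auto intro!: derivative_eq_intros)
    then show "((\<lambda>t. f (x + t *\<^sub>R e)) has_vector_derivative (\<Sum>b\<in>Basis. G b x *\<^sub>R b)) (at 0)"
      by (simp add: euclidean_representation)
  qed
  then show thesis
    by (intro that[of "\<lambda>x. \<Sum>b\<in>Basis. G b x *\<^sub>R b"]) auto
qed

section \<open>Test functions\<close>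

text \<open>Lets an explicit derivative \<open>D\<close> stand for the one selected by
  \<open>frechet_derivative\<close>.\<close>

lemma Ck_SucI:
  assumes "\<And>x. (\<phi> has_derivative D x) (at x)" "\<And>i. Ck k (\<lambda>x. D x (axis i 1))"
  shows "Ck (Suc k) \<phi>"
proof -
  have "partial_deriv i \<phi> = (\<lambda>x. D x (axis i 1))" for i
    using frechet_derivative_at[OF assms(1)] by (simp add: partial_deriv_def fun_eq_iff)
  then show ?thesis
    using assms by (auto simp: differentiable_on_def differentiable_def)
qed

lemma Ck_has_derivative:
  assumes "Ck (Suc k) \<phi>"
  shows "(\<phi> has_derivative frechet_derivative \<phi> (at x)) (at x)"
  using assms by (auto simp: differentiable_on_def frechet_derivative_works[symmetric])

lemma Ck_SucD: "Ck (Suc k) \<phi> \<Longrightarrow> Ck k \<phi>"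
proof (induction k arbitrary: \<phi>)
  case 0
  then show ?case by (auto intro: differentiable_imp_continuous_on)
qed auto

lemma Ck_const: "Ck k (\<lambda>_. c)"
proof (induction k arbitrary: c)
  case (Suc k)
  show ?case by (rule Ck_SucI[where D = "\<lambda>_ _. 0"]) (auto intro: Suc)
qed auto

lemma Ck_component: "Ck k (\<lambda>x. x $ j)"
proof (cases k)
  case (Suc n)
  show ?thesis
    unfolding Suc by (rule Ck_SucI[where D = "\<lambda>_ v. v $ j"])
      (auto intro: bounded_linear_imp_has_derivative bounded_linear_vec_nth Ck_const)
qed (auto intro: continuous_intros)

lemma Ck_add: "Ck k f \<Longrightarrow> Ck k g \<Longrightarrow> Ck k (\<lambda>x. f x + g x)"
proof (induction k arbitrary: f g)
  case (Suc k)
  show ?case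
  proof (rule Ck_SucI)
    show "((\<lambda>x. f x + g x) has_derivative
        (\<lambda>v. frechet_derivative f (at x) v + frechet_derivative g (at x) v)) (at x)" for x
      using Suc.prems by (intro has_derivative_add Ck_has_derivative)
    have "Ck k (\<lambda>x. partial_deriv i f x + partial_deriv i g x)" for i
      using Suc.prems by (intro Suc.IH) auto
    then show "Ck k (\<lambda>x. frechet_derivative f (at x) (axis i 1) + frechet_derivative g (at x) (axis i 1))" for i
      by (simp add: partial_deriv_def)
  qed
qed (auto intro: continuous_intros)

lemma Ck_mult: "Ck k f \<Longrightarrow> Ck k g \<Longrightarrow> Ck k (\<lambda>x. f x * g x)"
proof (induction k arbitrary: f g)
  case (Suc k)
  show ?case
  proof (rule Ck_SucI)
    show "((\<lambda>x. f x * g x) has_derivative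
        (\<lambda>v. f x * frechet_derivative g (at x) v + frechet_derivative f (at x) v * g x)) (at x)" for x
      using Suc.prems by (intro has_derivative_mult Ck_has_derivative)
    have "Ck k (\<lambda>x. f x * partial_deriv i g x + partial_deriv i f x * g x)" for i
      using Suc.prems by (intro Ck_add Suc.IH) (auto intro: Ck_SucD)
    then show "Ck k (\<lambda>x. f x * frechet_derivative g (at x) (axis i 1) +
        frechet_derivative f (at x) (axis i 1) * g x)" for i
      by (simp add: partial_deriv_def)
  qed
qed (auto intro: continuous_intros)

lemma Ck_prod:
  assumes "\<And>j. j \<in> S \<Longrightarrow> Ck k (f j)"
  shows "Ck k (\<lambda>x. \<Prod>j\<in>S. f j x)"
  using assms by (induction S rule: infinite_finite_induct) (auto intro: Ck_const Ck_mult)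

text \<open>The outer function comes with all its successive derivatives \<open>H j\<close>, because
  the induction applies the chain rule to \<open>H j\<close> and then needs the claim for
  \<open>H (Suc j)\<close>.\<close>

lemma Ck_compose:
  assumes H: "\<And>j t. (H j has_real_derivative H (Suc j) t) (at t)"
  shows "Ck k f \<Longrightarrow> Ck k (\<lambda>x. H j (f x))"
proof (induction k arbitrary: j)
  case 0
  have "continuous_on UNIV (H j)"
    using H by (meson DERIV_isCont continuous_at_imp_continuous_on)
  then show ?case
    using 0 by (auto intro: continuous_on_compose2)
next
  case (Suc k)
  show ?case
  proof (rule Ck_SucI)
    show "((\<lambda>x. H j (f x)) has_derivative (\<lambda>v. frechet_derivative f (at x) v * H (Suc j) (f x))) (at x)" for x
      by (rule has_derivative_eq_rhs[OF has_derivative_compose[OF Ck_has_derivative[OF Suc.prems]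
            H[unfolded has_field_derivative_def]]]) (simp add: mult.commute)
    have "Ck k (\<lambda>x. partial_deriv i f x * H (Suc j) (f x))" for i
      using Suc.prems by (intro Ck_mult Suc.IH) (auto intro: Ck_SucD)
    then show "Ck k (\<lambda>x. frechet_derivative f (at x) (axis i 1) * H (Suc j) (f x))" for i
      by (simp add: partial_deriv_def)
  qed
qed

text \<open>The derivatives of \<open>exp (- 1 / t)\<close> are polynomials in \<open>1 / t\<close> times \<open>exp (- 1 / t)\<close>.\<close>

primrec flat_poly :: "nat \<Rightarrow> real poly" where
  "flat_poly 0 = 1"
| "flat_poly (Suc j) = [:0, 0, 1:] * (flat_poly j - pderiv (flat_poly j))"

definition flat :: "nat \<Rightarrow> real \<Rightarrow> real" where
  "flat j t = (if t \<le> 0 then 0 else poly (flat_poly j) (1 / t) * exp (- (1 / t)))"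

text \<open>With \<open>s = 1 / t\<close> this is the flatness at 0 from the right. The factor
  \<open>s ^ n\<close> drives the induction over the coefficients, and for \<open>n = 1\<close> it
  is the \<open>1 / t\<close> of the difference quotient.\<close>

lemma tendsto_poly_exp_minus: "((\<lambda>s :: real. s ^ n * poly p s * exp (- s)) \<longlongrightarrow> 0) at_top"
proof (induction p arbitrary: n)
  case (pCons a p)
  have "((\<lambda>s. a * (s ^ n / exp s) + s ^ Suc n * poly p s * exp (- s)) \<longlongrightarrow> a * 0 + 0) at_top"
    by (intro tendsto_intros tendsto_power_div_exp_0 pCons.IH)
  then show ?case
    by (simp add: algebra_simps exp_minus divide_inverse)
qed simp

lemma DERIV_flat: "(flat j has_real_derivative flat (Suc j) t) (at t)"
proof (cases t "0 :: real" rule: linorder_cases)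
  case less
  have "((\<lambda>_. 0) has_real_derivative 0) (at t)" by simp
  then have "(flat j has_real_derivative 0) (at t)"
    by (rule has_field_derivative_transform_within_open[where S = "{..<0}"])
      (use less in \<open>auto simp: flat_def\<close>)
  then show ?thesis using less by (simp add: flat_def)
next
  case equal
  have "((\<lambda>s. flat j s / s) \<longlongrightarrow> 0) (at_right 0)"
  proof -
    have "((\<lambda>t. (1 / t) ^ 1 * poly (flat_poly j) (1 / t) * exp (- (1 / t))) \<longlongrightarrow> 0) (at_right 0)"
      using filterlim_compose[OF tendsto_poly_exp_minus[of 1 "flat_poly j"] filterlim_inverse_at_top_right]
      by (simp add: inverse_eq_divide)
    then show ?thesis
      by (rule Lim_transform_eventually)
        (auto simp: eventually_at_right_field flat_def intro!: exI[of _ 1])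
  qed
  moreover have "((\<lambda>s. flat j s / s) \<longlongrightarrow> 0) (at_left 0)"
    by (rule Lim_transform_eventually[OF tendsto_const])
      (auto simp: eventually_at_left_field flat_def intro!: exI[of _ "-1"])
  ultimately have "(\<lambda>s. flat j s / s) \<midarrow>0\<rightarrow> 0"
    by (simp add: filterlim_at_split)
  then show ?thesis
    using equal by (simp add: has_field_derivative_iff flat_def)
next
  case greater
  have "((\<lambda>t. poly (flat_poly j) (1 / t) * exp (- (1 / t))) has_real_derivative
      poly (flat_poly (Suc j)) (1 / t) * exp (- (1 / t))) (at t)"
  proof -
    have inv: "((\<lambda>t. 1 / t) has_real_derivative - (1 / t * (1 / t))) (at t)"
      using greater by (auto intro!: derivative_eq_intros)
    have exp: "((\<lambda>t. exp (- (1 / t))) has_real_derivative exp (- (1 / t)) * (1 / t * (1 / t))) (at t)"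
      using DERIV_chain2[OF DERIV_exp DERIV_minus[OF inv]] by simp
    show ?thesis
      by (rule DERIV_cong[OF DERIV_mult[OF DERIV_chain2[OF poly_DERIV inv] exp]])
        (simp add: algebra_simps)
  qed
  then have "(flat j has_real_derivative poly (flat_poly (Suc j)) (1 / t) * exp (- (1 / t))) (at t)"
    by (rule has_field_derivative_transform_within_open[where S = "{0<..}"])
      (use greater in \<open>auto simp: flat_def\<close>)
  then show ?thesis using greater by (simp add: flat_def)
qed

section \<open>Bump functions of boxes and properties of test functions\<close>

text \<open>A smooth function positive exactly on the open box. It is not normalised, since only the
  set where it is positive will count.\<close>

definition box_bump :: "real ^ 'm \<Rightarrow> real ^ 'm \<Rightarrow> real ^ 'm \<Rightarrow> real" where
  "box_bump a b x = (\<Prod>j\<in>UNIV. flat 0 (x $ j - a $ j) * flat 0 (b $ j - x $ j))"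

lemma Ck_box_bump: "Ck k (box_bump a b)"
proof -
  have *: "Ck k (\<lambda>x. flat 0 (x $ j + c))" for c j
    by (rule Ck_compose[where H = flat, OF DERIV_flat]) (intro Ck_add Ck_component Ck_const)
  have **: "Ck k (\<lambda>x. flat 0 (c + (- 1) * x $ j))" for c j
    by (rule Ck_compose[where H = flat, OF DERIV_flat]) (intro Ck_add Ck_mult Ck_component Ck_const)
  show ?thesis
    unfolding box_bump_def using *[of _ "- a $ _"] **[of "b $ _"]
    by (intro Ck_prod Ck_mult) simp_all
qed

lemma box_bump_pos_iff: "box_bump a b x > 0 \<longleftrightarrow> x \<in> box a b"
  and box_bump_nonneg: "box_bump a b x \<ge> 0"
  and box_bump_eq_0_iff: "box_bump a b x = 0 \<longleftrightarrow> x \<notin> box a b"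
proof -
  have flat: "flat 0 t \<ge> 0" "flat 0 t = 0 \<longleftrightarrow> t \<le> 0" for t
    by (auto simp: flat_def)
  show 1: "box_bump a b x \<ge> 0"
    unfolding box_bump_def by (intro prod_nonneg) (simp add: flat)
  show 2: "box_bump a b x = 0 \<longleftrightarrow> x \<notin> box a b"
    by (auto simp: box_bump_def flat mem_box_cart not_less)
  show "box_bump a b x > 0 \<longleftrightarrow> x \<in> box a b"
    using 1 2 by (auto simp: less_le)
qed

lemma box_bump_test_function:
  assumes "cbox a b \<subseteq> U"
  shows "(\<lambda>x. 1 - exp (- (real n * box_bump a b x))) \<in> test_functions U" (is "?\<phi> \<in> _")
proof -
  \<comment> \<open>The successive derivatives of \<open>1 - exp (- n * t)\<close>. The case
    \<open>j = 0\<close> is separate because only there the constant 1 survives.\<close>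
  define H where "H = (\<lambda>j t. if j = 0 then 1 - exp (- (real n * t)) else - ((- real n) ^ j * exp (- (real n * t))))"
  have "(H j has_real_derivative H (Suc j) t) (at t)" for j t
    by (cases j) (auto simp: H_def intro!: derivative_eq_intros)
  then have "Ck k (\<lambda>x. H 0 (box_bump a b x))" for k
    by (rule Ck_compose) (rule Ck_box_bump)
  then have "Ck k ?\<phi>" for k
    by (simp add: H_def)
  moreover have sub: "{x. ?\<phi> x \<noteq> 0} \<subseteq> cbox a b"
    using box_subset_cbox by (auto simp: box_bump_eq_0_iff)
  then have "closure {x. ?\<phi> x \<noteq> 0} \<subseteq> cbox a b"
    by (rule closure_minimal) (rule closed_cbox)
  moreover have "compact (closure {x. ?\<phi> x \<noteq> 0})"
    using bounded_subset[OF bounded_cbox sub] by (simp add: compact_closure)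
  ultimately show ?thesis
    using assms by (auto simp: test_functions_def)
qed

lemma test_function_support:
  assumes "\<phi> \<in> test_functions U"
  obtains K where "compact K" "K \<subseteq> U" "\<And>x. x \<notin> K \<Longrightarrow> \<phi> x = 0" "\<And>x i. x \<notin> K \<Longrightarrow> partial_deriv i \<phi> x = 0"
proof -
  let ?K = "closure {x. \<phi> x \<noteq> 0}"
  have zero: "\<phi> x = 0" if "x \<notin> ?K" for x
    using that closure_subset[of "{x. \<phi> x \<noteq> 0}"] by auto
  have zero': "partial_deriv i \<phi> x = 0" if "x \<notin> ?K" for x i
  proof -
    have "((\<lambda>_. 0) has_derivative (\<lambda>_. 0)) (at x)" by simp
    then have "(\<phi> has_derivative (\<lambda>_. 0)) (at x)"
    proof (rule has_derivative_transform_within_open[where s = "- ?K"])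
      show "0 = \<phi> y" if "y \<in> - ?K" for y
        using zero[of y] that by simp
    qed (use that in auto)
    from frechet_derivative_at[OF this, symmetric] show ?thesis
      by (simp add: partial_deriv_def)
  qed
  show thesis
    by (rule that[of ?K, OF _ _ zero zero']) (use assms in \<open>simp_all add: test_functions_def\<close>)
qed

lemma test_function_continuous:
  assumes "\<phi> \<in> test_functions U"
  shows "continuous_on UNIV \<phi>" "continuous_on UNIV (partial_deriv i \<phi>)"
proof -
  have "Ck 0 \<phi>" "Ck (Suc 0) \<phi>"
    using assms unfolding test_functions_def by blast+
  then show "continuous_on UNIV \<phi>" "continuous_on UNIV (partial_deriv i \<phi>)"
    by auto
qed

lemma test_function_line_derivative:
  assumes "\<phi> \<in> test_functions U"
  shows "((\<lambda>t. \<phi> (x + t *\<^sub>R axis i 1)) has_real_derivative partial_deriv i \<phi> (x + t *\<^sub>R axis i 1)) (at t)"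
proof -
  have "Ck (Suc 0) \<phi>"
    using assms unfolding test_functions_def by blast
  from Ck_has_derivative[OF this]
  have D: "(\<phi> has_derivative frechet_derivative \<phi> (at (x + t *\<^sub>R axis i 1))) (at (x + t *\<^sub>R axis i 1))" .
  have "((\<lambda>t. x + t *\<^sub>R axis i 1) has_derivative (\<lambda>h. h *\<^sub>R axis i 1)) (at t)"
    by (auto intro!: derivative_eq_intros)
  from has_derivative_compose[OF this D] show ?thesis
    unfolding has_field_derivative_def partial_deriv_def
    by (rule has_derivative_eq_rhs)
      (simp add: fun_eq_iff linear_scale[OF has_derivative_linear[OF D]])
qed

lemma bounded_compact_support:
  fixes u :: "'a::topological_space \<Rightarrow> 'v::real_normed_vector"
  assumes "continuous_on UNIV u" "compact K" "\<And>x. x \<notin> K \<Longrightarrow> u x = 0"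
  obtains B where "B \<ge> 0" "\<And>x. norm (u x) \<le> B"
proof -
  have "bounded (u ` K)"
    using assms by (intro compact_imp_bounded compact_continuous_image) (auto intro: continuous_on_subset)
  then obtain B where "\<And>x. x \<in> K \<Longrightarrow> norm (u x) \<le> B"
    by (auto simp: bounded_iff)
  then have "norm (u x) \<le> max 0 B" for x
    using assms(3)[of x] by (cases "x \<in> K") (auto simp: le_max_iff_disj)
  then show thesis by (intro that[of "max 0 B"]) auto
qed

section \<open>Weak derivatives of Lipschitz functions\<close>

lemma has_vector_derivative_imp_tendsto:
  assumes "(f has_vector_derivative D) (at (0 :: real))"
  shows "(\<lambda>t. (1 / t) *\<^sub>R (f t - f 0)) \<midarrow>0\<rightarrow> D"
proof (subst tendsto_dist_iff)
  have "(\<lambda>t. norm (f t - f 0 - t *\<^sub>R D) / \<bar>t\<bar>) \<midarrow>0\<rightarrow> 0"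
    using assms by (simp add: has_vector_derivative_def has_derivative_at)
  then show "(\<lambda>t. dist ((1 / t) *\<^sub>R (f t - f 0)) D) \<midarrow>0\<rightarrow> 0"
  proof (rule Lim_transform_eventually)
    have "norm (f t - f 0 - t *\<^sub>R D) / \<bar>t\<bar> = dist ((1 / t) *\<^sub>R (f t - f 0)) D" if "t \<noteq> 0" for t
    proof -
      have "(1 / t) *\<^sub>R (f t - f 0) - D = (1 / t) *\<^sub>R (f t - f 0 - t *\<^sub>R D)"
        using that by (simp add: scaleR_diff_right)
      then show ?thesis by (simp add: dist_norm)
    qed
    then show "\<forall>\<^sub>F t in at 0. norm (f t - f 0 - t *\<^sub>R D) / \<bar>t\<bar> = dist ((1 / t) *\<^sub>R (f t - f 0)) D"
      by (simp add: eventually_at_filter)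
  qed
qed

lemma integrable_compact_support:
  fixes u :: "'a::euclidean_space \<Rightarrow> 'v::euclidean_space"
  assumes "u \<in> borel_measurable borel" "compact K" "\<And>x. x \<notin> K \<Longrightarrow> u x = 0" "\<And>x. norm (u x) \<le> B"
  shows "integrable lborel u"
proof (rule integrableI_bounded_set[of K])
  show "emeasure lborel K < \<infinity>"
    using emeasure_compact_finite[OF assms(2)] by (simp add: top.not_eq_extremum)
qed (use assms in \<open>auto intro: borel_compact\<close>)

lemma lborel_integral_translate:
  fixes u :: "'a::euclidean_space \<Rightarrow> 'v::euclidean_space"
  assumes "u \<in> borel_measurable borel"
  shows "(\<integral>x. u (x + c) \<partial>lborel) = (\<integral>x. u x \<partial>lborel)"
proof -
  have "(\<integral>x. u x \<partial>lborel) = (\<integral>x. u x \<partial>distr lborel borel ((+) c))"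
    unfolding lborel_distr_plus ..
  also have "\<dots> = (\<integral>x. u (c + x) \<partial>lborel)"
    by (rule integral_distr) (use assms in auto)
  finally show ?thesis by (simp add: add.commute)
qed

text \<open>Integration by parts for difference quotients is translation invariance of the integral.
  Letting the increment tend to 0, both sides converge by domination: the quotients of
  \<open>\<phi>\<close> are bounded by the mean value theorem, those of \<open>f\<close> by its
  Lipschitz constant.\<close>

lemma lipschitz_integration_by_parts:
  fixes f :: "real ^ 'm \<Rightarrow> 'v::euclidean_space"
  assumes \<phi>: "\<phi> \<in> test_functions U" and L: "L-lipschitz_on UNIV f"
    and [measurable]: "G \<in> borel_measurable borel"
    and G: "AE x in lborel. ((\<lambda>t. f (x + t *\<^sub>R axis i 1)) has_vector_derivative G x) (at 0)"
  shows "(\<integral>x. partial_deriv i \<phi> x *\<^sub>R f x \<partial>lborel) = - (\<integral>x. \<phi> x *\<^sub>R G x \<partial>lborel)"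
proof -
  define e :: "real ^ 'm" where "e = axis i 1"
  have ne: "norm e = 1" by (simp add: e_def norm_axis_1)
  obtain K where K: "compact K" "\<And>x. x \<notin> K \<Longrightarrow> \<phi> x = 0" "\<And>x. x \<notin> K \<Longrightarrow> partial_deriv i \<phi> x = 0"
    using test_function_support[OF \<phi>] by metis
  obtain R where R: "K \<subseteq> cball 0 R"
    using compact_imp_bounded[OF K(1)] by (auto simp: bounded_iff subset_iff)
  \<comment> \<open>The support is enlarged by 1, so that shifts by \<open>h n \<le> 1\<close> stay
    inside. As \<open>f\<close> may be unbounded on the whole space, its bound \<open>B\<close> is
    taken on this ball.\<close>
  let ?K = "cball (0 :: real ^ 'm) (R + 1)"
  note c\<phi> = test_function_continuous(1)[OF \<phi>] and cd\<phi> = test_function_continuous(2)[OF \<phi>, of i]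
  have cf: "continuous_on UNIV f"
    using L by (rule lipschitz_on_continuous_on)
  have [measurable]: "\<phi> \<in> borel_measurable borel" "partial_deriv i \<phi> \<in> borel_measurable borel" "f \<in> borel_measurable borel"
    using c\<phi> cd\<phi> cf by (auto intro: borel_measurable_continuous_onI)
  obtain P where P: "P \<ge> 0" "\<And>x. norm (\<phi> x) \<le> P"
    using bounded_compact_support[OF c\<phi> K(1,2)] by blast
  obtain M where M: "M \<ge> 0" "\<And>x. norm (partial_deriv i \<phi> x) \<le> M"
    using bounded_compact_support[OF cd\<phi> K(1,3)] by blast
  have "bounded (f ` ?K)"
    by (intro compact_imp_bounded compact_continuous_image) (auto intro: continuous_on_subset[OF cf])
  then obtain B where B: "B \<ge> 0" "\<And>x. x \<in> ?K \<Longrightarrow> norm (f x) \<le> B"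
    unfolding bounded_pos by (meson image_eqI less_imp_le)
  define h where "h = (\<lambda>n. 1 / (real n + 1))"
  have h: "h n > 0" "h n \<le> 1" for n by (auto simp: h_def)
  have h0: "h \<longlonglongrightarrow> 0"
    unfolding h_def using LIMSEQ_inverse_real_of_nat by (simp add: inverse_eq_divide add.commute)
  have hat: "filterlim h (at 0) sequentially" "filterlim (\<lambda>n. - h n) (at 0) sequentially"
    using h0 tendsto_minus[OF h0] h(1) by (auto simp: filterlim_at less_imp_neq[symmetric])
  have outside: "x + t *\<^sub>R e \<notin> K" if "x \<notin> ?K" "0 \<le> t" "t \<le> 1" for x t
  proof
    assume "x + t *\<^sub>R e \<in> K"
    then have "norm (x + t *\<^sub>R e) \<le> R" using R by auto
    moreover have "norm x \<le> norm (x + t *\<^sub>R e) + norm (t *\<^sub>R e)"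
      using norm_triangle_ineq4[of "x + t *\<^sub>R e" "t *\<^sub>R e"] by simp
    ultimately show False using that ne by simp
  qed
  have K_sub: "K \<subseteq> ?K" using R by (auto simp: subset_iff)
  have mvt: "\<bar>\<phi> (x + h n *\<^sub>R e) - \<phi> x\<bar> \<le> h n * M" for x n
  proof -
    have "\<exists>z. 0 < z \<and> z < h n \<and> \<phi> (x + h n *\<^sub>R e) - \<phi> (x + 0 *\<^sub>R e) = (h n - 0) * partial_deriv i \<phi> (x + z *\<^sub>R e)"
      unfolding e_def by (rule MVT2) (auto intro: test_function_line_derivative[OF \<phi>] h)
    then obtain z where "\<phi> (x + h n *\<^sub>R e) - \<phi> x = h n * partial_deriv i \<phi> (x + z *\<^sub>R e)"
      by auto
    then show ?thesis
      using M(2)[of "x + z *\<^sub>R e"] h(1)[of n] by (simp add: abs_mult)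
  qed
  \<comment> \<open>A forward quotient on \<open>\<phi>\<close> turns into a backward quotient on
    \<open>f\<close>. The latter lacks the sign of its increment, so it tends to minus the
    derivative.\<close>
  let ?a = "\<lambda>n x. ((\<phi> (x + h n *\<^sub>R e) - \<phi> x) / h n) *\<^sub>R f x"
  let ?b = "\<lambda>n x. (\<phi> x / h n) *\<^sub>R (f (x - h n *\<^sub>R e) - f x)"
  have int_compact: "integrable lborel (indicator ?K :: _ \<Rightarrow> real)"
    by (rule integrable_compact_support[where K = ?K and B = 1])
      (auto intro: borel_measurable_indicator)
  have int1: "integrable lborel (\<lambda>x. \<phi> (x + c *\<^sub>R e) *\<^sub>R f x)" if c: "0 \<le> c" "c \<le> 1" for c
  proof (rule integrable_compact_support[where K = ?K and B = "P * B"])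
    show zero: "\<phi> (x + c *\<^sub>R e) *\<^sub>R f x = 0" if "x \<notin> ?K" for x
      using outside[OF that c] K(2) by simp
    show "norm (\<phi> (x + c *\<^sub>R e) *\<^sub>R f x) \<le> P * B" for x
    proof (cases "x \<in> ?K")
      case True
      then show ?thesis using P(2)[of "x + c *\<^sub>R e"] B(2)[OF True] P(1) by (auto intro!: mult_mono)
    next
      case False
      show ?thesis unfolding zero[OF False] using P(1) B(1) by simp
    qed
  qed auto
  have int2: "integrable lborel (\<lambda>x. \<phi> x *\<^sub>R f (x - c *\<^sub>R e))" for c
  proof -
    have "continuous_on UNIV (\<lambda>x. \<phi> x *\<^sub>R f (x - c *\<^sub>R e))"
      by (intro continuous_intros c\<phi> continuous_on_compose2[OF cf]) auto
    moreover from this obtain B'' where "\<And>x. norm (\<phi> x *\<^sub>R f (x - c *\<^sub>R e)) \<le> B''"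
      by (rule bounded_compact_support[OF _ K(1)]) (use K(2) in auto)
    ultimately show ?thesis
      using K by (intro integrable_compact_support[where K = K and B = B'']) auto
  qed
  have eq: "(\<integral>x. ?a n x \<partial>lborel) = (\<integral>x. ?b n x \<partial>lborel)" for n
  proof -
    have "(\<integral>x. ?a n x \<partial>lborel) = (\<integral>x. (1 / h n) *\<^sub>R (\<phi> (x + h n *\<^sub>R e) *\<^sub>R f x - \<phi> (x + 0 *\<^sub>R e) *\<^sub>R f x) \<partial>lborel)"
      by (simp add: divide_inverse mult.commute flip: scaleR_diff_left)
    also have "\<dots> = (1 / h n) *\<^sub>R ((\<integral>x. \<phi> (x + h n *\<^sub>R e) *\<^sub>R f x \<partial>lborel) - (\<integral>x. \<phi> (x + 0 *\<^sub>R e) *\<^sub>R f x \<partial>lborel))"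
      using int1[of "h n"] int1[of 0] h[of n] by (simp only: integral_scaleR_right Bochner_Integration.integral_diff less_imp_le order_refl zero_le_one)
    also have "(\<integral>x. \<phi> (x + h n *\<^sub>R e) *\<^sub>R f x \<partial>lborel) = (\<integral>x. \<phi> x *\<^sub>R f (x - h n *\<^sub>R e) \<partial>lborel)"
      using lborel_integral_translate[of "\<lambda>x. \<phi> x *\<^sub>R f (x - h n *\<^sub>R e)" "h n *\<^sub>R e"] by simp
    also have "(1 / h n) *\<^sub>R ((\<integral>x. \<phi> x *\<^sub>R f (x - h n *\<^sub>R e) \<partial>lborel) - (\<integral>x. \<phi> (x + 0 *\<^sub>R e) *\<^sub>R f x \<partial>lborel)) =
        (\<integral>x. (1 / h n) *\<^sub>R (\<phi> x *\<^sub>R f (x - h n *\<^sub>R e) - \<phi> (x + 0 *\<^sub>R e) *\<^sub>R f x) \<partial>lborel)"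
      using int2[of "h n"] int1[of 0] by (simp only: integral_scaleR_right Bochner_Integration.integral_diff order_refl zero_le_one)
    also have "\<dots> = (\<integral>x. ?b n x \<partial>lborel)"
      by (simp add: divide_inverse mult.commute flip: scaleR_diff_right)
    finally show ?thesis .
  qed
  have "(\<lambda>n. \<integral>x. ?a n x \<partial>lborel) \<longlonglongrightarrow> (\<integral>x. partial_deriv i \<phi> x *\<^sub>R f x \<partial>lborel)"
  proof (rule integral_dominated_convergence[where w = "\<lambda>x. M * B * indicator ?K x"])
    show "integrable lborel (\<lambda>x. M * B * indicator ?K x :: real)"
      using int_compact by simp
    show "AE x in lborel. (\<lambda>n. ?a n x) \<longlonglongrightarrow> partial_deriv i \<phi> x *\<^sub>R f x"
    proof (intro AE_I2)
      fix x
      have "((\<lambda>t. \<phi> (x + t *\<^sub>R e)) has_real_derivative partial_deriv i \<phi> x) (at 0)"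
        using test_function_line_derivative[OF \<phi>, of x i 0] by (simp add: e_def)
      then have "(\<lambda>t. (\<phi> (x + t *\<^sub>R e) - \<phi> x) / t) \<midarrow>0\<rightarrow> partial_deriv i \<phi> x"
        by (simp add: has_field_derivative_iff)
      from filterlim_compose[OF this hat(1)] show "(\<lambda>n. ?a n x) \<longlonglongrightarrow> partial_deriv i \<phi> x *\<^sub>R f x"
        by (intro tendsto_intros)
    qed
    show "AE x in lborel. norm (?a n x) \<le> M * B * indicator ?K x" for n
    proof (intro AE_I2)
      fix x
      show "norm (?a n x) \<le> M * B * indicator ?K x"
      proof (cases "x \<in> ?K")
        case True
        have "\<bar>(\<phi> (x + h n *\<^sub>R e) - \<phi> x) / h n\<bar> \<le> M"
          using mvt[of x n] h(1)[of n] by (simp add: field_simps)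
        then have "\<bar>(\<phi> (x + h n *\<^sub>R e) - \<phi> x) / h n\<bar> * norm (f x) \<le> M * B"
          using B(2)[OF True] M(1) by (intro mult_mono) auto
        then show ?thesis
          using True by simp
      next
        case False
        then have "\<phi> x = 0" using K(2) K_sub by blast
        moreover have "\<phi> (x + h n *\<^sub>R e) = 0"
          using outside[OF False, of "h n"] h[of n] K(2) by simp
        ultimately show ?thesis using M(1) B(1) by simp
      qed
    qed
  qed auto
  moreover have "(\<lambda>n. \<integral>x. ?b n x \<partial>lborel) \<longlonglongrightarrow> (\<integral>x. - (\<phi> x *\<^sub>R G x) \<partial>lborel)"
  proof (rule integral_dominated_convergence[where w = "\<lambda>x. P * L * indicator ?K x"])
    show "integrable lborel (\<lambda>x. P * L * indicator ?K x :: real)"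
      using int_compact by simp
    show "AE x in lborel. (\<lambda>n. ?b n x) \<longlonglongrightarrow> - (\<phi> x *\<^sub>R G x)"
      using G
    proof (rule AE_mp, intro AE_I2 impI)
      fix x assume "((\<lambda>t. f (x + t *\<^sub>R axis i 1)) has_vector_derivative G x) (at 0)"
      then have "(\<lambda>t. (1 / t) *\<^sub>R (f (x + t *\<^sub>R e) - f x)) \<midarrow>0\<rightarrow> G x"
        by (auto simp: e_def dest: has_vector_derivative_imp_tendsto)
      from filterlim_compose[OF this hat(2)]
      have "(\<lambda>n. - \<phi> x *\<^sub>R (1 / - h n) *\<^sub>R (f (x + - h n *\<^sub>R e) - f x)) \<longlonglongrightarrow> - \<phi> x *\<^sub>R G x"
        by (intro tendsto_intros)
      then show "(\<lambda>n. ?b n x) \<longlonglongrightarrow> - (\<phi> x *\<^sub>R G x)"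
        by simp
    qed
    show "AE x in lborel. norm (?b n x) \<le> P * L * indicator ?K x" for n
    proof (intro AE_I2)
      fix x
      show "norm (?b n x) \<le> P * L * indicator ?K x"
      proof (cases "x \<in> ?K")
        case True
        have "norm (f (x - h n *\<^sub>R e) - f x) \<le> L * h n"
          using lipschitz_onD[OF L, of "x - h n *\<^sub>R e" x] h(1)[of n] ne by (simp add: dist_norm)
        then have "norm (?b n x) \<le> \<bar>\<phi> x / h n\<bar> * (L * h n)"
          unfolding norm_scaleR by (rule mult_left_mono) simp
        also have "\<dots> = \<bar>\<phi> x\<bar> * L"
          using h(1)[of n] by simp
        also have "\<dots> \<le> P * L"
          using P(2)[of x] lipschitz_on_nonneg[OF L] by (intro mult_right_mono) auto
        finally show ?thesis using True by simp
      next
        case False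
        then have "\<phi> x = 0" using K(2) K_sub by blast
        then show ?thesis using P(1) lipschitz_on_nonneg[OF L] by simp
      qed
    qed
  qed auto
  ultimately have "(\<integral>x. partial_deriv i \<phi> x *\<^sub>R f x \<partial>lborel) = (\<integral>x. - (\<phi> x *\<^sub>R G x) \<partial>lborel)"
    unfolding eq by (rule LIMSEQ_unique)
  then show ?thesis by simp
qed

lemma LINT_lebesgue_on_eq_lborel:
  fixes u :: "'a::euclidean_space \<Rightarrow> 'v::euclidean_space"
  assumes "open U" "u \<in> borel_measurable borel" "\<And>x. x \<notin> U \<Longrightarrow> u x = 0"
  shows "(LINT x|lebesgue_on U. u x) = (\<integral>x. u x \<partial>lborel)"
proof -
  have "(LINT x|lebesgue_on U. u x) = (\<integral>x. indicator U x *\<^sub>R u x \<partial>lebesgue)"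
    by (rule integral_restrict_space) (use assms(1) in \<open>simp add: borel_open lborelD\<close>)
  also have "(\<lambda>x. indicator U x *\<^sub>R u x) = u"
    using assms(3) by (auto simp: fun_eq_iff indicator_def)
  also have "(\<integral>x. u x \<partial>lebesgue) = (\<integral>x. u x \<partial>lborel)"
    by (rule integral_completion) (use assms(2) in simp)
  finally show ?thesis .
qed

lemma AE_lebesgue_on_open:
  assumes "open U" "AE x in lborel. x \<in> U \<longrightarrow> P x"
  shows "AE x in lebesgue_on U. P x"
proof -
  have "U \<inter> space lebesgue \<in> sets lebesgue"
    using assms(1) by (simp add: borel_open lborelD)
  from AE_restrict_space_iff[OF this] show ?thesis
    using AE_completion[OF assms(2)] by simp
qed

text \<open>A Borel function \<open>g\<close> stands in for \<open>f\<close>, about which nothing is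
  known outside \<open>U\<close>.\<close>

lemma locally_integrable_bounded:
  fixes g :: "'a::euclidean_space \<Rightarrow> 'v::euclidean_space"
  assumes "g \<in> borel_measurable borel" "\<And>x. norm (g x) \<le> B" "\<And>x. x \<in> U \<Longrightarrow> f x = g x"
  shows "locally_integrable U f"
  unfolding locally_integrable_def
proof (intro allI impI)
  fix K assume K: "compact K \<and> K \<subseteq> U"
  have "B \<ge> 0" using assms(2) norm_ge_zero order_trans by blast
  have int: "integrable lborel (\<lambda>x. indicator K x *\<^sub>R g x)"
  proof (rule integrable_compact_support[where K = K and B = B])
    have [measurable]: "K \<in> sets borel" using K by (simp add: borel_compact)
    note assms(1)[measurable]
    show "(\<lambda>x. indicator K x *\<^sub>R g x) \<in> borel_measurable borel" by measurable
  qed (use K assms(2) \<open>B \<ge> 0\<close> in \<open>auto simp: indicator_def\<close>)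
  then have "integrable lebesgue (\<lambda>x. indicator K x *\<^sub>R g x)"
    by (simp only: integrable_completion borel_measurable_integrable)
  moreover have "(\<lambda>x. indicator K x *\<^sub>R g x) = (\<lambda>x. indicator K x *\<^sub>R f x)"
    using K assms(3) by (auto simp: fun_eq_iff indicator_def)
  ultimately show "f absolutely_integrable_on K"
    by (simp add: set_integrable_def)
qed

text \<open>Small increments keep the point inside \<open>U\<close>, so the constant on
  \<open>U\<close> bounds the quotients. Any larger constant of an extension of \<open>f\<close> is
  irrelevant. This is what makes derivatives of small differences small.\<close>

lemma lipschitz_derivative_bound:
  fixes f :: "'a::real_normed_vector \<Rightarrow> 'v::real_normed_vector"
  assumes L: "L-lipschitz_on U f" and "open U" "x \<in> U"
    and D: "((\<lambda>t. f (x + t *\<^sub>R e)) has_vector_derivative D) (at 0)"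
  shows "norm D \<le> L * norm e"
proof -
  have lim: "(\<lambda>t. norm ((1 / t) *\<^sub>R (f (x + t *\<^sub>R e) - f x))) \<midarrow>0\<rightarrow> norm D"
    using has_vector_derivative_imp_tendsto[OF D] by (intro tendsto_norm) simp
  have "((\<lambda>t. x + t *\<^sub>R e) \<longlongrightarrow> x + 0 *\<^sub>R e) (at 0)"
    by (intro tendsto_intros)
  then have "\<forall>\<^sub>F t in at 0. x + t *\<^sub>R e \<in> U"
    using assms(2,3) by (auto elim!: topological_tendstoD)
  then have "\<forall>\<^sub>F t in at 0. norm ((1 / t) *\<^sub>R (f (x + t *\<^sub>R e) - f x)) \<le> L * norm e"
  proof (rule eventually_mp[rotated], unfold eventually_at_filter, intro always_eventually allI impI)
    fix t :: real assume "t \<noteq> 0" and t: "x + t *\<^sub>R e \<in> U"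
    have "norm (f (x + t *\<^sub>R e) - f x) \<le> L * (\<bar>t\<bar> * norm e)"
      using lipschitz_onD[OF L t \<open>x \<in> U\<close>] by (simp add: dist_norm)
    then show "norm ((1 / t) *\<^sub>R (f (x + t *\<^sub>R e) - f x)) \<le> L * norm e"
      using \<open>t \<noteq> 0\<close> unfolding norm_scaleR by (simp add: field_simps)
  qed
  then show ?thesis
    by (rule tendsto_upperbound[OF lim]) simp
qed

text \<open>The extension \<open>F\<close> to the whole space makes translated difference quotients
  meaningful. Test functions vanish off \<open>U\<close>, so the extension does not affect the
  resulting identity.\<close>

proposition lipschitz_has_weak_partial:
  fixes f :: "real ^ 'm \<Rightarrow> 'v::euclidean_space"
  assumes "open U" and L: "L-lipschitz_on U f" and bdd: "bounded (f ` U)"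
  obtains g where "g \<in> borel_measurable borel" "\<And>x. norm (g x) \<le> L"
    "AE x in lebesgue_on U. ((\<lambda>t. f (x + t *\<^sub>R axis i 1)) has_vector_derivative g x) (at 0)"
    "has_weak_partial U i f g"
proof -
  let ?e = "axis i 1 :: real ^ 'm"
  obtain C F where F: "C-lipschitz_on UNIV F" and Ff: "\<And>x. x \<in> U \<Longrightarrow> F x = f x"
    using lipschitz_extension[OF L] by blast
  obtain G where [measurable]: "G \<in> borel_measurable borel"
    and G: "AE x in lborel. ((\<lambda>t. F (x + t *\<^sub>R ?e)) has_vector_derivative G x) (at 0)"
    using lipschitz_directional_derivative[OF F] by blast
  \<comment> \<open>Truncation gives the bound \<open>L\<close> at every point. Within
    \<open>U\<close> it alters \<open>G\<close> only on a null set, because true derivatives there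
    obey the bound already.\<close>
  define g where "g = (\<lambda>x. if norm (G x) \<le> L then G x else 0)"
  have [measurable]: "g \<in> borel_measurable borel"
    unfolding g_def by measurable
  have gL: "norm (g x) \<le> L" for x
    using lipschitz_on_nonneg[OF L] by (simp add: g_def)
  have deriv_f: "((\<lambda>t. f (x + t *\<^sub>R ?e)) has_vector_derivative D) (at 0)"
    if D: "((\<lambda>t. F (x + t *\<^sub>R ?e)) has_vector_derivative D) (at 0)" and "x \<in> U" for x D
  proof -
    have "open ((\<lambda>t. x + t *\<^sub>R ?e) -` U)"
      by (intro open_vimage assms(1) continuous_intros)
    then show ?thesis
      by (rule has_vector_derivative_transform_within_open[OF D]) (use \<open>x \<in> U\<close> Ff in auto)
  qed
  have ae: "AE x in lborel. x \<in> U \<longrightarrow>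
      G x = g x \<and> ((\<lambda>t. f (x + t *\<^sub>R ?e)) has_vector_derivative g x) (at 0)"
    using G
  proof (rule AE_mp, intro AE_I2 impI)
    fix x assume x: "((\<lambda>t. F (x + t *\<^sub>R ?e)) has_vector_derivative G x) (at 0)" "x \<in> U"
    have "norm (G x) \<le> L * norm ?e"
      by (rule lipschitz_derivative_bound[OF L \<open>open U\<close> x(2) deriv_f[OF x]])
    then have "G x = g x"
      by (simp add: g_def norm_axis_1)
    then show "G x = g x \<and> ((\<lambda>t. f (x + t *\<^sub>R ?e)) has_vector_derivative g x) (at 0)"
      using deriv_f[OF x] by simp
  qed
  have cF: "continuous_on UNIV F"
    using F by (rule lipschitz_on_continuous_on)
  then have [measurable]: "F \<in> borel_measurable borel"
    by (rule borel_measurable_continuous_onI)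
  have "has_weak_partial U i f g"
    unfolding has_weak_partial_def
  proof (intro conjI ballI)
    obtain B where B: "B > 0" "\<And>x. x \<in> U \<Longrightarrow> norm (f x) \<le> B"
      using bdd unfolding bounded_pos by auto
    have [measurable]: "U \<in> sets borel" using assms(1) by simp
    show "locally_integrable U f"
      by (rule locally_integrable_bounded[where g = "\<lambda>x. if x \<in> U then F x else 0" and B = B])
        (use B Ff in \<open>auto intro: measurable_If\<close>)
    show "locally_integrable U g"
      by (rule locally_integrable_bounded[where g = g and B = L]) (use gL in auto)
    fix \<phi> assume \<phi>: "\<phi> \<in> test_functions U"
    obtain K where K: "K \<subseteq> U" "\<And>x. x \<notin> K \<Longrightarrow> \<phi> x = 0" "\<And>x. x \<notin> K \<Longrightarrow> partial_deriv i \<phi> x = 0"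
      using test_function_support[OF \<phi>] by metis
    have [measurable]: "\<phi> \<in> borel_measurable borel" "partial_deriv i \<phi> \<in> borel_measurable borel"
      using test_function_continuous[OF \<phi>] by (auto intro: borel_measurable_continuous_onI)
    have "(LINT x|lebesgue_on U. partial_deriv i \<phi> x *\<^sub>R f x) = (LINT x|lebesgue_on U. partial_deriv i \<phi> x *\<^sub>R F x)"
      by (rule Bochner_Integration.integral_cong) (auto simp: Ff)
    also have "\<dots> = (\<integral>x. partial_deriv i \<phi> x *\<^sub>R F x \<partial>lborel)"
      by (rule LINT_lebesgue_on_eq_lborel) (use assms(1) K in auto)
    also have "\<dots> = - (\<integral>x. \<phi> x *\<^sub>R G x \<partial>lborel)"
      by (rule lipschitz_integration_by_parts[OF \<phi> F _ G]) simp
    \<comment> \<open>Outside \<open>U\<close> the truncation may change \<open>G\<close>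
      substantially, but there \<open>\<phi>\<close> is zero.\<close>
    also have "(\<integral>x. \<phi> x *\<^sub>R G x \<partial>lborel) = (\<integral>x. \<phi> x *\<^sub>R g x \<partial>lborel)"
    proof (rule integral_cong_AE)
      show "AE x in lborel. \<phi> x *\<^sub>R G x = \<phi> x *\<^sub>R g x"
        using ae by eventually_elim (use K in auto)
    qed auto
    also have "\<dots> = (LINT x|lebesgue_on U. \<phi> x *\<^sub>R g x)"
      by (rule LINT_lebesgue_on_eq_lborel[symmetric]) (use assms(1) K in auto)
    finally show "(LINT x|lebesgue_on U. partial_deriv i \<phi> x *\<^sub>R f x) = - (LINT x|lebesgue_on U. \<phi> x *\<^sub>R g x)" .
  qed
  moreover have "AE x in lebesgue_on U. ((\<lambda>t. f (x + t *\<^sub>R ?e)) has_vector_derivative g x) (at 0)"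
    by (rule AE_lebesgue_on_open[OF assms(1)]) (use ae in eventually_elim, auto)
  ultimately show thesis
    by (intro that[of g] gL) auto
qed

section \<open>Uniqueness of weak derivatives\<close>

lemma integrable_scaleR_test_function:
  fixes g :: "real ^ 'm \<Rightarrow> 'v::euclidean_space"
  assumes "open U" and g: "locally_integrable U g" and \<phi>: "\<phi> \<in> test_functions U"
  shows "integrable (lebesgue_on U) (\<lambda>x. \<phi> x *\<^sub>R g x)"
proof -
  obtain K where K: "compact K" "K \<subseteq> U" "\<And>x. x \<notin> K \<Longrightarrow> \<phi> x = 0"
    using test_function_support[OF \<phi>] by metis
  obtain P where P: "\<And>x. norm (\<phi> x) \<le> P"
    using bounded_compact_support[OF test_function_continuous(1)[OF \<phi>] K(1,3)] by blast
  have [measurable]: "\<phi> \<in> borel_measurable lebesgue"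
    by (intro measurable_completion) (simp add: borel_measurable_continuous_onI test_function_continuous(1)[OF \<phi>])
  have int: "integrable lebesgue (\<lambda>x. indicator K x *\<^sub>R g x)"
    using g K by (auto simp: locally_integrable_def set_integrable_def)
  then have "integrable lebesgue (\<lambda>x. \<phi> x *\<^sub>R (indicator K x *\<^sub>R g x))"
  proof (rule Bochner_Integration.integrable_bound[OF integrable_scaleR_right[of P]])
    show "(\<lambda>x. \<phi> x *\<^sub>R (indicator K x *\<^sub>R g x)) \<in> borel_measurable lebesgue"
      by (rule borel_measurable_scaleR[OF _ borel_measurable_integrable[OF int]]) measurable
    show "AE x in lebesgue. norm (\<phi> x *\<^sub>R (indicator K x *\<^sub>R g x)) \<le> norm (P *\<^sub>R (indicator K x *\<^sub>R g x))"
      unfolding norm_scaleR[of "\<phi> _"] norm_scaleR[of P] using order_trans[OF P abs_ge_self]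
      by (intro AE_I2 mult_right_mono) auto
  qed
  also have "(\<lambda>x. \<phi> x *\<^sub>R (indicator K x *\<^sub>R g x)) = (\<lambda>x. indicator U x *\<^sub>R (\<phi> x *\<^sub>R g x))"
    using K by (auto simp: fun_eq_iff indicator_def)
  finally show ?thesis
    by (subst integrable_restrict_space) (use assms(1) in \<open>auto simp: borel_open lborelD\<close>)
qed

text \<open>
  The functions \<open>1 - exp (- n * box_bump a b)\<close> increase to the indicator of the box, so that the
  integral of \<open>w\<close> over every small box vanishes.
\<close>

lemma integral_box_eq_0:
  fixes w :: "real ^ 'm \<Rightarrow> 'v::euclidean_space"
  assumes "open U" and w: "locally_integrable U w"
    and zero: "\<And>\<phi>. \<phi> \<in> test_functions U \<Longrightarrow> (LINT x|lebesgue_on U. \<phi> x *\<^sub>R w x) = 0"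
    and sub: "cbox a b \<subseteq> U"
  shows "integral (cbox a b) w = 0"
proof -
  let ?\<phi> = "\<lambda>n x. 1 - exp (- (real n * box_bump a b x))"
  have int: "integrable lebesgue (\<lambda>x. indicator (cbox a b) x *\<^sub>R w x)"
    using w sub by (auto simp: locally_integrable_def set_integrable_def)
  have U: "U \<inter> space lebesgue \<in> sets lebesgue"
    using assms(1) by (simp add: borel_open lborelD)
  have int_box: "integrable lebesgue (\<lambda>x. indicator (box a b) x *\<^sub>R w x)"
  proof -
    have "w absolutely_integrable_on cbox a b"
      using int by (simp add: set_integrable_def)
    then have "w absolutely_integrable_on box a b"
      by (rule set_integrable_subset) (auto simp: box_subset_cbox)
    then show ?thesis by (simp add: set_integrable_def)
  qed
  have eq0: "(\<integral>x. indicator U x *\<^sub>R (?\<phi> n x *\<^sub>R w x) \<partial>lebesgue) = 0" for n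
    using zero[OF box_bump_test_function[OF sub, of n]] by (simp add: integral_restrict_space[OF U])
  have "(\<lambda>n. \<integral>x. indicator U x *\<^sub>R (?\<phi> n x *\<^sub>R w x) \<partial>lebesgue) \<longlonglongrightarrow>
      (\<integral>x. indicator (box a b) x *\<^sub>R w x \<partial>lebesgue)"
  proof (rule integral_dominated_convergence[where w = "\<lambda>x. norm (indicator (cbox a b) x *\<^sub>R w x)"])
    show "integrable lebesgue (\<lambda>x. norm (indicator (cbox a b) x *\<^sub>R w x))"
      by (rule integrable_norm[OF int])
    show "(\<lambda>x. indicator U x *\<^sub>R (?\<phi> n x *\<^sub>R w x)) \<in> borel_measurable lebesgue" for n
      using integrable_scaleR_test_function[OF assms(1) w box_bump_test_function[OF sub, of n]]
      by (subst (asm) integrable_restrict_space[OF U]) (rule borel_measurable_integrable)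
    show "AE x in lebesgue. (\<lambda>n. indicator U x *\<^sub>R (?\<phi> n x *\<^sub>R w x)) \<longlonglongrightarrow> indicator (box a b) x *\<^sub>R w x"
    proof (intro AE_I2)
      fix x
      show "(\<lambda>n. indicator U x *\<^sub>R (?\<phi> n x *\<^sub>R w x)) \<longlonglongrightarrow> indicator (box a b) x *\<^sub>R w x"
      proof (cases "x \<in> box a b")
        case True
        then have "x \<in> U" using sub box_subset_cbox by blast
        have "filterlim (\<lambda>n. real n * box_bump a b x) at_top sequentially"
          using filterlim_tendsto_pos_mult_at_top[OF tendsto_const _ filterlim_real_sequentially, of "box_bump a b x"] True
          by (simp add: box_bump_pos_iff mult.commute)
        then have "(\<lambda>n. exp (- (real n * box_bump a b x))) \<longlonglongrightarrow> 0"
          by (intro filterlim_compose[OF exp_at_bot] filterlim_compose[OF filterlim_uminus_at_bot_at_top])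
        then have "(\<lambda>n. indicator U x *\<^sub>R (?\<phi> n x *\<^sub>R w x)) \<longlonglongrightarrow> indicator U x *\<^sub>R ((1 - 0) *\<^sub>R w x)"
          by (intro tendsto_intros)
        then show ?thesis using True \<open>x \<in> U\<close> by simp
      next
        case False
        then have "box_bump a b x = 0" by (simp add: box_bump_eq_0_iff)
        then show ?thesis using False by simp
      qed
    qed
    show "AE x in lebesgue. norm (indicator U x *\<^sub>R (?\<phi> n x *\<^sub>R w x)) \<le> norm (indicator (cbox a b) x *\<^sub>R w x)" for n
    proof (intro AE_I2)
      fix x
      have \<phi>1: "\<bar>?\<phi> n x\<bar> \<le> 1"
        using box_bump_nonneg[of a b x] by simp
      show "norm (indicator U x *\<^sub>R (?\<phi> n x *\<^sub>R w x)) \<le> norm (indicator (cbox a b) x *\<^sub>R w x)"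
      proof (cases "x \<in> box a b")
        case True
        then have "x \<in> cbox a b" using box_subset_cbox by blast
        then show ?thesis
          using sub mult_right_mono[OF \<phi>1 norm_ge_zero[of "w x"]] by auto
      next
        case False
        then have "box_bump a b x = 0" by (simp add: box_bump_eq_0_iff)
        then show ?thesis by simp
      qed
    qed
  qed (rule borel_measurable_integrable[OF int_box])
  then have "(\<integral>x. indicator (box a b) x *\<^sub>R w x \<partial>lebesgue) = 0"
    unfolding eq0 by (simp add: LIMSEQ_const_iff)
  moreover have "w absolutely_integrable_on box a b"
    using int_box by (simp add: set_integrable_def)
  ultimately have "integral (box a b) w = 0"
    by (simp add: set_lebesgue_integral_eq_integral(2)[symmetric] set_lebesgue_integral_def)
  then show ?thesis
    by (simp add: integral_open_interval)
qed

text \<open>The difference \<open>w\<close> integrates to 0 over every closed box in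
  \<open>U\<close>, and by Lebesgue's differentiation theorem its values are almost everywhere
  limits of such box averages. Countably many boxes cover \<open>U\<close>, so the exceptional set
  stays null.\<close>

lemma weak_partial_unique:
  fixes f :: "real ^ 'm \<Rightarrow> 'v::euclidean_space"
  assumes "open U" and g: "has_weak_partial U i f g" and g': "has_weak_partial U i f g'"
  shows "AE x in lebesgue_on U. g x = g' x"
proof -
  define w where "w = (\<lambda>x. g x - g' x)"
  have lg: "locally_integrable U g" and lg': "locally_integrable U g'"
    using g g' by (auto simp: has_weak_partial_def)
  have lw: "locally_integrable U w"
    using lg lg' by (auto simp: locally_integrable_def w_def intro: set_integral_diff(1))
  have zero: "(LINT x|lebesgue_on U. \<phi> x *\<^sub>R w x) = 0" if \<phi>: "\<phi> \<in> test_functions U" for \<phi>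
  proof -
    have "(LINT x|lebesgue_on U. \<phi> x *\<^sub>R w x) =
        (LINT x|lebesgue_on U. \<phi> x *\<^sub>R g x) - (LINT x|lebesgue_on U. \<phi> x *\<^sub>R g' x)"
      unfolding w_def scaleR_diff_right
      by (intro Bochner_Integration.integral_diff integrable_scaleR_test_function lg lg' assms \<phi>)
    also have "\<dots> = 0"
      using g g' \<phi> by (simp add: has_weak_partial_def)
    finally show ?thesis .
  qed
  have neg: "negligible {x \<in> cbox a b. w x \<noteq> 0}" if sub: "cbox a b \<subseteq> U" for a b
  proof -
    \<comment> \<open>Cutting \<open>w\<close> off outside the box makes it integrable on every box,
      as the differentiation theorem demands. For small \<open>h\<close> the boxes at interior
      points do not feel the cut.\<close>
    define W where "W = (\<lambda>x. if x \<in> cbox a b then w x else 0)"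
    have "w absolutely_integrable_on cbox a b"
      using lw sub by (auto simp: locally_integrable_def)
    then have "W absolutely_integrable_on UNIV"
      unfolding W_def by (simp add: absolutely_integrable_restrict_UNIV)
    then have "W integrable_on cbox c d" for c d
      using integrable_on_subcbox set_lebesgue_integral_eq_integral(1) by blast
    then obtain N where N: "negligible N" and lim: "\<And>x e. \<lbrakk>x \<notin> N; 0 < e\<rbrakk> \<Longrightarrow> \<exists>d>0. \<forall>h. 0 < h \<and> h < d \<longrightarrow>
        norm (integral (cbox x (x + h *\<^sub>R One)) W /\<^sub>R h ^ DIM(real ^ 'm) - W x) < e"
      using integrable_ccontinuous_explicit by blast
    have "w x = 0" if xb: "x \<in> box a b" and xN: "x \<notin> N" for x
    proof (rule ccontr)
      assume "w x \<noteq> 0"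
      have xc: "x \<in> cbox a b" using xb box_subset_cbox by blast
      obtain d where d: "d > 0" "\<And>h. 0 < h \<Longrightarrow> h < d \<Longrightarrow>
          norm (integral (cbox x (x + h *\<^sub>R One)) W /\<^sub>R h ^ DIM(real ^ 'm) - W x) < norm (w x)"
        using lim[OF xN, of "norm (w x)"] \<open>w x \<noteq> 0\<close> by auto
      have "((\<lambda>h. x + h *\<^sub>R One) \<longlongrightarrow> x + 0 *\<^sub>R One) (at_right 0)"
        by (intro tendsto_intros)
      then have "\<forall>\<^sub>F h in at_right 0. x + h *\<^sub>R One \<in> box a b"
        using xb open_box by (auto elim!: topological_tendstoD)
      moreover have "\<forall>\<^sub>F h in at_right 0. h < d"
        using d(1) by (auto simp: eventually_at_right_field)
      moreover have "\<forall>\<^sub>F h in at_right (0 :: real). h > 0"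
        by (simp add: eventually_at_right_less)
      ultimately have "\<forall>\<^sub>F h in at_right 0. x + h *\<^sub>R One \<in> box a b \<and> h < d \<and> h > 0"
        by eventually_elim auto
      then obtain h where h: "x + h *\<^sub>R One \<in> box a b" "h < d" "h > 0"
        using eventually_happens'[OF trivial_limit_at_right_real] by blast
      have subc: "cbox x (x + h *\<^sub>R One) \<subseteq> cbox a b"
        using xc h(1) box_subset_cbox by (auto simp: mem_box subset_iff) (meson order_trans less_imp_le)+
      have "integral (cbox x (x + h *\<^sub>R One)) W = integral (cbox x (x + h *\<^sub>R One)) w"
        using subc by (intro integral_cong) (auto simp: W_def)
      also have "\<dots> = 0"
        using subc sub by (intro integral_box_eq_0[OF assms(1) lw zero]) auto
      finally show False
        using d(2)[OF h(3,2)] xc by (simp add: W_def)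
    qed
    then have "{x \<in> cbox a b. w x \<noteq> 0} \<subseteq> N \<union> (cbox a b - box a b)"
      by auto
    then show ?thesis
      using N negligible_frontier_interval negligible_Un negligible_subset by blast
  qed
  obtain \<D> where D: "countable \<D>" "\<D> \<subseteq> Pow U" "\<And>X. X \<in> \<D> \<Longrightarrow> \<exists>a b. X = cbox a b" "\<Union>\<D> = U"
    using open_countable_Union_open_cbox[OF assms(1)] by metis
  have "negligible (\<Union>X\<in>\<D>. {x \<in> X. w x \<noteq> 0})"
  proof (rule negligible_countable_Union)
    fix Y assume "Y \<in> (\<lambda>X. {x \<in> X. w x \<noteq> 0}) ` \<D>"
    then show "negligible Y"
      using D(2,3) neg by blast
  qed (use D(1) in simp)
  moreover have "{x \<in> U. w x \<noteq> 0} \<subseteq> (\<Union>X\<in>\<D>. {x \<in> X. w x \<noteq> 0})"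
    using D(4) by blast
  ultimately have "negligible {x \<in> U. w x \<noteq> 0}"
    by (rule negligible_subset)
  then have "AE x in lebesgue. x \<notin> {x \<in> U. w x \<noteq> 0}"
    by (intro AE_not_in) (simp add: negligible_iff_null_sets)
  then show ?thesis
    using assms(1) by (subst AE_restrict_space_iff) (auto simp: borel_open lborelD w_def)
qed

section \<open>Continuity of the characteristic map\<close>

text \<open>Since \<open>U\<close> has finite measure, the constant \<open>B powr q\<close> is an
  integrable majorant, and dominated convergence applies.\<close>

lemma Lq_norm_tendsto_0:
  fixes h :: "nat \<Rightarrow> 'a::euclidean_space \<Rightarrow> 'v::euclidean_space"
  assumes U: "open U" "bounded U" and q: "1 \<le> q"
    and [measurable]: "\<And>n. h n \<in> borel_measurable (lebesgue_on U)"
    and bound: "\<And>n. AE x in lebesgue_on U. norm (h n x) \<le> B"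
    and lim: "AE x in lebesgue_on U. (\<lambda>n. h n x) \<longlonglongrightarrow> 0"
  shows "(\<lambda>n. Lq_norm q U (h n)) \<longlonglongrightarrow> 0"
proof -
  interpret finite_measure "lebesgue_on U"
    using U by (intro finite_measure_lebesgue_on lmeasurable_open)
  have "(\<lambda>n. LINT x|lebesgue_on U. norm (h n x) powr q) \<longlonglongrightarrow> (LINT x|lebesgue_on U. 0)"
  proof (rule integral_dominated_convergence[where w = "\<lambda>_. B powr q"])
    show "AE x in lebesgue_on U. norm (norm (h n x) powr q) \<le> B powr q" for n
      using bound[of n] by eventually_elim (use q in \<open>auto intro!: powr_mono2\<close>)
    show "AE x in lebesgue_on U. (\<lambda>n. norm (h n x) powr q) \<longlonglongrightarrow> 0"
      using lim by eventually_elim (use q in \<open>auto intro!: tendsto_zero_powrI tendsto_norm_zero\<close>)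
  qed auto
  then have "(\<lambda>n. LINT x|lebesgue_on U. norm (h n x) powr q) \<longlonglongrightarrow> 0"
    by simp
  then show ?thesis
    unfolding Lq_norm_def
    by (rule tendsto_zero_powrI[OF _ tendsto_const]) (use q in \<open>auto intro!: always_eventually integral_nonneg_AE\<close>)
qed

lemma bounded_in_Lq:
  fixes f g :: "'a::euclidean_space \<Rightarrow> 'v::euclidean_space"
  assumes U: "open U" "bounded U" and q: "1 \<le> q"
    and g: "g \<in> borel_measurable borel" and fg: "\<And>x. x \<in> U \<Longrightarrow> f x = g x"
    and bound: "\<And>x. x \<in> U \<Longrightarrow> norm (f x) \<le> B"
  shows "f \<in> Lq q U"
proof -
  interpret finite_measure "lebesgue_on U"
    using U by (intro finite_measure_lebesgue_on lmeasurable_open)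
  have "g \<in> borel_measurable (lebesgue_on U)"
    using g by (intro measurable_restrict_space1 measurable_completion) simp
  then have [measurable]: "f \<in> borel_measurable (lebesgue_on U)"
    by (rule measurable_cong[THEN iffD1, rotated]) (simp add: fg)
  have "integrable (lebesgue_on U) (\<lambda>x. norm (f x) powr q)"
    by (rule integrable_const_bound[where B = "B powr q"])
      (use bound q in \<open>auto intro!: AE_I2 powr_mono2\<close>)
  then show ?thesis by (simp add: Lq_def)
qed

lemma has_weak_partial_weak_partial:
  "has_weak_partial U i f g \<Longrightarrow> has_weak_partial U i f (weak_partial U i f)"
  unfolding weak_partial_def by (rule someI[where P = "has_weak_partial U i f"])

text \<open>Completeness of Lebesgue measure. It makes \<open>weak_partial\<close> measurable, which
  as a chosen function is known only up to a null set.\<close>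

lemma borel_measurable_cong_AE_lebesgue_on:
  fixes f g :: "'a::euclidean_space \<Rightarrow> 'v::euclidean_space"
  assumes "open U" "AE x in lebesgue_on U. f x = g x" "g \<in> borel_measurable borel"
  shows "f \<in> borel_measurable (lebesgue_on U)"
proof -
  have U: "U \<in> sets lebesgue"
    using assms(1) by (simp add: borel_open lborelD)
  have "AE x in lebesgue. x \<in> U \<longrightarrow> f x = g x"
    using assms(2) U by (subst (asm) AE_restrict_space_iff) auto
  then have "AE x in lebesgue. indicator U x *\<^sub>R g x = indicator U x *\<^sub>R f x"
    by eventually_elim (auto simp: indicator_def)
  moreover have "(\<lambda>x. indicator U x *\<^sub>R g x) \<in> borel_measurable lebesgue"
    using assms(3) U by (intro borel_measurable_scaleR borel_measurable_indicator measurable_completion) auto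
  ultimately have "(\<lambda>x. indicator U x *\<^sub>R f x) \<in> borel_measurable lebesgue"
    by (rule borel_measurable_AE[rotated])
  then show ?thesis
    using U by (simp add: borel_measurable_restrict_space_iff)
qed

section \<open>The Lipschitz norm and its elementary consequences\<close>

lemma C01_imp_lipschitz:
  assumes "f \<in> C01 U V"
  obtains L where "L-lipschitz_on U f"
proof -
  let ?S = "{norm (f x - f y) / norm (x - y) | x y. x \<in> U \<and> y \<in> U \<and> x \<noteq> y}"
  have bdd: "bdd_above ?S"
    using assms by (simp add: C01_def)
  then obtain L where L: "\<And>s. s \<in> ?S \<Longrightarrow> s \<le> L"
    unfolding bdd_above_def by blast
  \<comment> \<open>If \<open>U\<close> has fewer than two points, there are no quotients and
    \<open>L\<close> could be negative.\<close>
  have "(max 0 L)-lipschitz_on U f"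
  proof (rule lipschitz_onI)
    fix x y assume xy: "x \<in> U" "y \<in> U"
    show "dist (f x) (f y) \<le> max 0 L * dist x y"
    proof (cases "x = y")
      case False
      then have "norm (f x - f y) / norm (x - y) \<le> max 0 L"
        using L[of "norm (f x - f y) / norm (x - y)"] xy by fastforce
      then show ?thesis using False by (simp add: dist_norm pos_divide_le_eq)
    qed simp
  qed simp
  then show thesis by (rule that)
qed

lemma C01_UNIV_I:
  fixes f :: "'a::euclidean_space \<Rightarrow> 'v::euclidean_space"
  assumes L: "L-lipschitz_on U f" and "bounded (f ` U)" "f \<in> extensional U"
  shows "f \<in> C01 U UNIV"
proof -
  obtain C g where g: "C-lipschitz_on UNIV g" "\<And>x. x \<in> U \<Longrightarrow> g x = f x"
    using lipschitz_extension[OF L] by blast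
  have "continuous_on (closure U) g"
    using lipschitz_on_continuous_on[OF g(1)] by (rule continuous_on_subset) simp
  moreover have "bdd_above {norm (f x) | x. x \<in> U}"
    using assms(2) by (auto simp: bounded_iff bdd_above_def)
  moreover have "norm (f x - f y) / norm (x - y) \<le> L" if "x \<in> U" "y \<in> U" "x \<noteq> y" for x y
    using lipschitz_onD[OF L that(1,2)] that(3) by (simp add: dist_norm pos_divide_le_eq)
  then have "bdd_above {norm (f x - f y) / norm (x - y) | x y. x \<in> U \<and> y \<in> U \<and> x \<noteq> y}"
    by (auto simp: bdd_above_def)
  ultimately show ?thesis
    using assms(3) g(2) by (auto simp: C01_def PiE_def)
qed

lemma C01_norm_bounds:
  fixes f :: "real ^ 'm \<Rightarrow> 'v::real_normed_vector"
  assumes "open U" "U \<noteq> {}" and L: "L-lipschitz_on U f" and bdd: "bounded (f ` U)"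
  shows "x \<in> U \<Longrightarrow> norm (f x) \<le> C01_norm U f" "(C01_norm U f)-lipschitz_on U f" "0 \<le> C01_norm U f"
proof -
  let ?S1 = "{norm (f x) | x. x \<in> U}"
  let ?S2 = "{norm (f x - f y) / norm (x - y) | x y. x \<in> U \<and> y \<in> U \<and> x \<noteq> y}"
  have b1: "bdd_above ?S1"
    using bdd by (auto simp: bounded_iff bdd_above_def)
  have "norm (f x - f y) / norm (x - y) \<le> L" if "x \<in> U" "y \<in> U" "x \<noteq> y" for x y
    using lipschitz_onD[OF L that(1,2)] that(3) by (simp add: dist_norm pos_divide_le_eq)
  then have b2: "bdd_above ?S2"
    by (auto simp: bdd_above_def)
  obtain a where a: "a \<in> U" using assms(2) by blast
  \<comment> \<open>A nonempty open set has a second point. Hence the supremum of the quotients is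
    over a nonempty set and its value is not an unspecified one.\<close>
  moreover have "\<not> U \<subseteq> {a}"
    using a assms(1) not_open_singleton[of a] by (metis insert_absorb insert_not_empty subset_singletonD)
  ultimately obtain b where b: "b \<in> U" "a \<noteq> b" by blast
  have u1: "norm (f x) \<le> Sup ?S1" if "x \<in> U" for x
    using that by (intro cSup_upper b1) auto
  have u2: "norm (f x - f y) / norm (x - y) \<le> Sup ?S2" if "x \<in> U" "y \<in> U" "x \<noteq> y" for x y
    using that by (intro cSup_upper b2) auto
  have p1: "Sup ?S1 \<ge> 0"
    using u1[OF a] norm_ge_zero order_trans by blast
  have p2: "Sup ?S2 \<ge> 0"
    using u2[OF a b] by (meson divide_nonneg_nonneg norm_ge_zero order_trans)
  show "norm (f x) \<le> C01_norm U f" if "x \<in> U" for x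
    using u1[OF that] p2 by (simp add: C01_norm_def)
  show pos: "0 \<le> C01_norm U f"
    using p1 p2 by (simp add: C01_norm_def)
  show "(C01_norm U f)-lipschitz_on U f"
  proof (rule lipschitz_onI)
    fix x y assume xy: "x \<in> U" "y \<in> U"
    show "dist (f x) (f y) \<le> C01_norm U f * dist x y"
    proof (cases "x = y")
      case False
      then have "norm (f x - f y) / norm (x - y) \<le> C01_norm U f"
        using u2[OF xy False] p1 by (simp add: C01_norm_def)
      then show ?thesis using False by (simp add: dist_norm pos_divide_le_eq)
    qed simp
  qed (rule pos)
qed

lemma lipschitz_in_W1q:
  fixes f :: "real ^ 'm \<Rightarrow> 'v::euclidean_space"
  assumes U: "open U" "bounded U" and q: "1 \<le> q"
    and L: "L-lipschitz_on U f" and bdd: "bounded (f ` U)"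
  shows "f \<in> W1q q U"
proof -
  obtain C F where F: "C-lipschitz_on UNIV F" "\<And>x. x \<in> U \<Longrightarrow> F x = f x"
    using lipschitz_extension[OF L] by blast
  obtain B where B: "\<And>x. x \<in> U \<Longrightarrow> norm (f x) \<le> B"
    using bdd by (auto simp: bounded_iff)
  have "F \<in> borel_measurable borel"
    using F(1) by (intro borel_measurable_continuous_onI lipschitz_on_continuous_on)
  then have "f \<in> Lq q U"
    by (rule bounded_in_Lq[OF U q _ _ B]) (simp_all add: F(2))
  moreover have "\<exists>g \<in> Lq q U. has_weak_partial U i f g" for i
  proof -
    obtain g where g: "g \<in> borel_measurable borel" "\<And>x. norm (g x) \<le> L" "has_weak_partial U i f g"
      using lipschitz_has_weak_partial[OF U(1) L bdd] by metis
    then show ?thesis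
      using bounded_in_Lq[OF U q g(1) refl g(2)] by blast
  qed
  ultimately show ?thesis by (simp add: W1q_def)
qed

context
  fixes U :: "(real ^ 'm::finite) set"
  assumes open_U: "open U" and bounded_U: "bounded U"
begin

lemma characteristic_map_lipschitz:
  fixes A :: "real ^ 'm \<Rightarrow> complex ^ ('d::{finite,linorder}) ^ ('d::{finite,linorder})"
  assumes "L-lipschitz_on U A" "\<And>x. x \<in> U \<Longrightarrow> A x \<in> Herm"
  shows "(2 * (real CARD('d))\<^sup>2 * L)-lipschitz_on U (characteristic_map U A)"
proof (rule lipschitz_onI)
  fix x y assume xy: "x \<in> U" "y \<in> U"
  have "dist (characteristic_map U A x) (characteristic_map U A y) \<le> 2 * (real CARD('d))\<^sup>2 * norm (A x - A y)"
    using ordered_eigenvalues_lipschitz[OF assms(2)[OF xy(1)] assms(2)[OF xy(2)]] xy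
    by (simp add: characteristic_map_def dist_norm)
  also have "\<dots> \<le> 2 * (real CARD('d))\<^sup>2 * (L * dist x y)"
    using lipschitz_onD[OF assms(1) xy] by (intro mult_left_mono) (auto simp: dist_norm)
  finally show "dist (characteristic_map U A x) (characteristic_map U A y) \<le> 2 * (real CARD('d))\<^sup>2 * L * dist x y"
    by (simp add: mult.assoc)
qed (use lipschitz_on_nonneg[OF assms(1)] in simp)

lemma bounded_lipschitz_image: "L-lipschitz_on U f \<Longrightarrow> bounded (f ` U)"
  for f :: "real ^ 'm \<Rightarrow> 'v::euclidean_space"
  by (rule bounded_uniformly_continuous_image[OF lipschitz_on_uniformly_continuous bounded_U])

lemma characteristic_map_C01:
  fixes A :: "real ^ 'm \<Rightarrow> complex ^ ('d::{finite,linorder}) ^ ('d::{finite,linorder})"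
  assumes A: "A \<in> C01 U Herm"
  obtains L where "L-lipschitz_on U (characteristic_map U A)"
proof -
  obtain L where L: "L-lipschitz_on U A"
    using C01_imp_lipschitz[OF A] .
  have "A x \<in> Herm" if "x \<in> U" for x
    using A that by (auto simp: C01_def)
  from characteristic_map_lipschitz[OF L this] that show thesis by blast
qed

text \<open>The number \<open>\<epsilon> n\<close> bounds \<open>An n - A\<close> uniformly and is
  also a Lipschitz constant for it, hence bounds its partial derivatives. This gives convergence of
  matrices and of their derivatives at the same points. The Lipschitz constants of the eigenvalue
  maps stay bounded, which supplies the majorant.\<close>

lemma characteristic_map_tendsto:
  fixes A :: "real ^ 'm \<Rightarrow> complex ^ ('d::{finite,linorder}) ^ ('d::{finite,linorder})"
  assumes q: "1 \<le> q" and "U \<noteq> {}" and A: "A \<in> C01 U Herm" and An: "\<And>n. An n \<in> C01 U Herm"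
    and lim: "(\<lambda>n. C01_norm U (\<lambda>x. An n x - A x)) \<longlonglongrightarrow> 0"
  shows "(\<lambda>n. W1q_norm q U (\<lambda>x. characteristic_map U (An n) x - characteristic_map U A x)) \<longlonglongrightarrow> 0"
proof -
  define \<epsilon> where "\<epsilon> = (\<lambda>n. C01_norm U (\<lambda>x. An n x - A x))"
  define c where "c = 2 * (real CARD('d))\<^sup>2"
  have "c \<ge> 0" by (simp add: c_def)
  define E where "E = characteristic_map U A"
  define h where "h = (\<lambda>n x. characteristic_map U (An n) x - E x)"
  have herm: "A x \<in> Herm" "An n x \<in> Herm" if "x \<in> U" for x n
    using A An that by (auto simp: C01_def)
  obtain L where L: "L-lipschitz_on U A"
    using C01_imp_lipschitz[OF A] .
  have diff_lip: "\<exists>K. K-lipschitz_on U (\<lambda>x. An n x - A x)" for n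
    using lipschitz_on_diff[OF _ L] C01_imp_lipschitz[OF An] by metis
  have \<epsilon>: "norm (An n x - A x) \<le> \<epsilon> n" "\<epsilon> n \<ge> 0" if "x \<in> U" for n x
    using diff_lip C01_norm_bounds(1,3)[OF open_U \<open>U \<noteq> {}\<close> _ bounded_lipschitz_image] that
    unfolding \<epsilon>_def by blast+
  have \<epsilon>_lip: "(\<epsilon> n)-lipschitz_on U (\<lambda>x. An n x - A x)" for n
    using diff_lip C01_norm_bounds(2)[OF open_U \<open>U \<noteq> {}\<close> _ bounded_lipschitz_image]
    unfolding \<epsilon>_def by blast
  have \<epsilon>0: "\<epsilon> \<longlonglongrightarrow> 0"
    using lim by (simp add: \<epsilon>_def)
  obtain M where M: "\<And>n. \<bar>\<epsilon> n\<bar> \<le> M"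
    using convergent_imp_bounded[OF \<epsilon>0] by (auto simp: bounded_iff)
  have An_lip: "(\<epsilon> n + L)-lipschitz_on U (An n)" for n
    using lipschitz_on_add[OF \<epsilon>_lip[of n] L] by simp
  have E_lip: "(c * L)-lipschitz_on U E"
    unfolding E_def c_def by (rule characteristic_map_lipschitz[OF L herm(1)])
  have h_lip: "(c * (\<epsilon> n + L) + c * L)-lipschitz_on U (h n)" for n
    unfolding h_def c_def
    by (rule lipschitz_on_diff[OF characteristic_map_lipschitz[OF An_lip herm(2)] E_lip[unfolded c_def]])
  have h_bd: "bounded (h n ` U)" for n
    by (rule bounded_lipschitz_image[OF h_lip])
  have h_small: "norm (h n x) \<le> c * \<epsilon> n" if "x \<in> U" for n x
  proof -
    have "norm (h n x) \<le> c * norm (An n x - A x)"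
      using ordered_eigenvalues_lipschitz[OF herm(2)[OF that] herm(1)[OF that]] that
      by (simp add: h_def E_def characteristic_map_def c_def)
    also have "\<dots> \<le> c * \<epsilon> n"
      using \<epsilon>(1)[OF that] \<open>c \<ge> 0\<close> by (rule mult_left_mono)
    finally show ?thesis .
  qed
  have "(\<lambda>n. Lq_norm q U (h n)) \<longlonglongrightarrow> 0"
  proof (rule Lq_norm_tendsto_0[OF open_U bounded_U q])
    show "h n \<in> borel_measurable (lebesgue_on U)" for n
      using lipschitz_in_W1q[OF open_U bounded_U q h_lip h_bd] by (simp add: W1q_def Lq_def)
    show "AE x in lebesgue_on U. norm (h n x) \<le> c * M" for n
    proof (intro AE_I2)
      fix x assume "x \<in> space (lebesgue_on U)"
      then have "norm (h n x) \<le> c * \<epsilon> n" by (intro h_small) simp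
      also have "\<dots> \<le> c * M"
        using M[of n] \<open>c \<ge> 0\<close> by (intro mult_left_mono) auto
      finally show "norm (h n x) \<le> c * M" .
    qed
    show "AE x in lebesgue_on U. (\<lambda>n. h n x) \<longlonglongrightarrow> 0"
    proof (intro AE_I2)
      fix x assume "x \<in> space (lebesgue_on U)"
      then have "norm (h n x) \<le> c * \<epsilon> n" for n by (intro h_small) simp
      then show "(\<lambda>n. h n x) \<longlonglongrightarrow> 0"
        using tendsto_mult_right_zero[OF \<epsilon>0, of c]
        by (intro Lim_null_comparison[of "\<lambda>n. h n x"]) (auto intro: always_eventually)
    qed
  qed
  moreover have "(\<lambda>n. Lq_norm q U (weak_partial U i (h n))) \<longlonglongrightarrow> 0" for i
  proof -
    let ?e = "axis i 1 :: real ^ 'm"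
    have "\<forall>n. \<exists>g. g \<in> borel_measurable borel \<and> (\<forall>x. norm (g x) \<le> c * (\<epsilon> n + L) + c * L) \<and>
        (AE x in lebesgue_on U. ((\<lambda>t. h n (x + t *\<^sub>R ?e)) has_vector_derivative g x) (at 0)) \<and>
        has_weak_partial U i (h n) g"
    proof
      fix n
      show "\<exists>g. g \<in> borel_measurable borel \<and> (\<forall>x. norm (g x) \<le> c * (\<epsilon> n + L) + c * L) \<and>
        (AE x in lebesgue_on U. ((\<lambda>t. h n (x + t *\<^sub>R ?e)) has_vector_derivative g x) (at 0)) \<and>
        has_weak_partial U i (h n) g"
        by (rule lipschitz_has_weak_partial[OF open_U h_lip[of n] h_bd, of i]) blast
    qed
    from choice[OF this] obtain g where g: "\<And>n. g n \<in> borel_measurable borel" "\<And>n x. norm (g n x) \<le> c * (\<epsilon> n + L) + c * L"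
      and g_deriv: "\<And>n. AE x in lebesgue_on U. ((\<lambda>t. h n (x + t *\<^sub>R ?e)) has_vector_derivative g n x) (at 0)"
      and g_weak: "\<And>n. has_weak_partial U i (h n) (g n)"
      by blast
    have eq: "AE x in lebesgue_on U. weak_partial U i (h n) x = g n x" for n
      using weak_partial_unique[OF open_U has_weak_partial_weak_partial[OF g_weak] g_weak] .
    obtain gA where gA: "AE x in lebesgue_on U. ((\<lambda>t. A (x + t *\<^sub>R ?e)) has_vector_derivative gA x) (at 0)"
      using lipschitz_has_weak_partial[OF open_U L bounded_lipschitz_image[OF L], of i] by blast
    obtain gE where gE: "AE x in lebesgue_on U. ((\<lambda>t. E (x + t *\<^sub>R ?e)) has_vector_derivative gE x) (at 0)"
      using lipschitz_has_weak_partial[OF open_U E_lip bounded_lipschitz_image[OF E_lip], of i] by blast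
    \<comment> \<open>The differences \<open>An n - A\<close> are differentiated, not the
      \<open>An n\<close>, because only for the differences is the bound \<open>\<epsilon> n\<close>
      available.\<close>
    have "\<forall>n. \<exists>b. (\<forall>x. norm (b x) \<le> \<epsilon> n) \<and>
        (AE x in lebesgue_on U. ((\<lambda>t. An n (x + t *\<^sub>R ?e) - A (x + t *\<^sub>R ?e)) has_vector_derivative b x) (at 0))"
    proof
      fix n
      show "\<exists>b. (\<forall>x. norm (b x) \<le> \<epsilon> n) \<and>
        (AE x in lebesgue_on U. ((\<lambda>t. An n (x + t *\<^sub>R ?e) - A (x + t *\<^sub>R ?e)) has_vector_derivative b x) (at 0))"
        by (rule lipschitz_has_weak_partial[OF open_U \<epsilon>_lip[of n] bounded_lipschitz_image[OF \<epsilon>_lip], of i]) blast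
    qed
    from choice[OF this] obtain b where b: "\<And>n x. norm (b n x) \<le> \<epsilon> n" and b_deriv: "\<And>n. AE x in lebesgue_on U.
        ((\<lambda>t. An n (x + t *\<^sub>R ?e) - A (x + t *\<^sub>R ?e)) has_vector_derivative b n x) (at 0)"
      by blast
    have "AE x in lebesgue_on U. (\<lambda>n. weak_partial U i (h n) x) \<longlonglongrightarrow> 0"
    proof -
      \<comment> \<open>Outside a single null set all these derivatives exist simultaneously, so the
        rest is an argument at one fixed point.\<close>
      have "AE x in lebesgue_on U. \<forall>n. weak_partial U i (h n) x = g n x \<and>
          ((\<lambda>t. h n (x + t *\<^sub>R ?e)) has_vector_derivative g n x) (at 0) \<and>
          ((\<lambda>t. An n (x + t *\<^sub>R ?e) - A (x + t *\<^sub>R ?e)) has_vector_derivative b n x) (at 0)"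
        unfolding AE_all_countable using eq g_deriv b_deriv by (auto intro: AE_conjI)
      then show ?thesis
        using gA gE AE_space[of "lebesgue_on U"]
      proof eventually_elim
        fix x assume x: "x \<in> space (lebesgue_on U)"
          and dA: "((\<lambda>t. A (x + t *\<^sub>R ?e)) has_vector_derivative gA x) (at 0)"
          and dE: "((\<lambda>t. E (x + t *\<^sub>R ?e)) has_vector_derivative gE x) (at 0)"
          and all: "\<forall>n. weak_partial U i (h n) x = g n x \<and>
            ((\<lambda>t. h n (x + t *\<^sub>R ?e)) has_vector_derivative g n x) (at 0) \<and>
            ((\<lambda>t. An n (x + t *\<^sub>R ?e) - A (x + t *\<^sub>R ?e)) has_vector_derivative b n x) (at 0)"
        have xU: "x \<in> U" using x by simp
        \<comment> \<open>For these \<open>t\<close> the point stays in \<open>U\<close>, where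
          \<open>characteristic_map\<close> is the eigenvalue map and not the default value of
          \<open>restrict\<close>.\<close>
        define T where "T = (\<lambda>t. x + t *\<^sub>R ?e) -` U"
        have T: "open T" "0 \<in> T"
          unfolding T_def using xU by (auto intro!: open_vimage open_U continuous_intros)
        have near: "\<forall>\<^sub>F t in nhds 0. x + t *\<^sub>R ?e \<in> U"
          using T unfolding T_def eventually_nhds by auto
        \<comment> \<open>Derivatives are at hand for differences and for the limits. Adding them
          yields those of \<open>An n\<close> and of its eigenvalues, the two curves to which the
          eigenbasis formula applies.\<close>
        have dAn: "((\<lambda>t. An n (x + t *\<^sub>R ?e)) has_vector_derivative b n x + gA x) (at 0)" for n
          using has_vector_derivative_add[OF conjunct2[OF conjunct2[OF all[rule_format, of n]]] dA] by simp
        have dEn: "((\<lambda>t. ordered_eigenvalues (An n (x + t *\<^sub>R ?e))) has_vector_derivative g n x + gE x) (at 0)" for n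
          by (rule has_vector_derivative_transform_within_open[OF
                has_vector_derivative_add[OF conjunct1[OF conjunct2[OF all[rule_format, of n]]] dE] T])
            (simp add: T_def h_def E_def characteristic_map_def)
        have dE': "((\<lambda>t. ordered_eigenvalues (A (x + t *\<^sub>R ?e))) has_vector_derivative gE x) (at 0)"
          by (rule has_vector_derivative_transform_within_open[OF dE T])
            (simp add: T_def E_def characteristic_map_def)
        have hermA: "\<forall>\<^sub>F t in nhds 0. A (x + t *\<^sub>R ?e) \<in> Herm"
          using near by eventually_elim (rule herm(1))
        have hermAn: "\<forall>\<^sub>F t in nhds 0. An n (x + t *\<^sub>R ?e) \<in> Herm" for n
          using near by eventually_elim (rule herm(2))
        have "(\<lambda>n. g n x + gE x) \<longlonglongrightarrow> gE x"
        proof (rule tendsto_eigenvalue_derivatives)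
          show "An n x \<in> Herm" "A x \<in> Herm" for n by (rule herm[OF xU])+
          have "(\<lambda>n. An n x - A x) \<longlonglongrightarrow> 0"
            by (rule Lim_null_comparison[OF _ \<epsilon>0]) (auto intro!: always_eventually \<epsilon>(1) xU)
          then show "(\<lambda>n. An n x) \<longlonglongrightarrow> A x" by (simp add: LIM_zero_iff)
          have "(\<lambda>n. b n x) \<longlonglongrightarrow> 0"
            by (rule Lim_null_comparison[OF _ \<epsilon>0]) (auto intro!: always_eventually b)
          then show "(\<lambda>n. b n x + gA x) \<longlonglongrightarrow> gA x"
            using tendsto_add[OF _ tendsto_const, of "\<lambda>n. b n x" 0 sequentially "gA x"] by simp
          show "(g n x + gE x) $ j = v j \<bullet> ((b n x + gA x) *v v j)" if "eigenbasis (An n x) v l" for n v l j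
            using derivative_ordered_eigenvalues[OF hermAn dAn dEn, where v = v and l = l and j = j] that by simp
          show "gE x $ j = v j \<bullet> (gA x *v v j)" if "eigenbasis (A x) v l" for v l j
            using derivative_ordered_eigenvalues[OF hermA dA dE', where v = v and l = l and j = j] that by simp
        qed
        then have "(\<lambda>n. (g n x + gE x) - gE x) \<longlonglongrightarrow> gE x - gE x"
          by (intro tendsto_diff tendsto_const)
        then show "(\<lambda>n. weak_partial U i (h n) x) \<longlonglongrightarrow> 0"
          using all by simp
      qed
    qed
    moreover have "AE x in lebesgue_on U. norm (weak_partial U i (h n) x) \<le> c * (M + L) + c * L" for n
      using eq[of n]
    proof eventually_elim
      fix x assume "weak_partial U i (h n) x = g n x"
      then have "norm (weak_partial U i (h n) x) \<le> c * (\<epsilon> n + L) + c * L"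
        using g(2) by simp
      also have "\<dots> \<le> c * (M + L) + c * L"
        using M[of n] \<open>c \<ge> 0\<close> by (intro add_right_mono mult_left_mono) auto
      finally show "norm (weak_partial U i (h n) x) \<le> c * (M + L) + c * L" .
    qed
    ultimately show ?thesis
      using borel_measurable_cong_AE_lebesgue_on[OF open_U eq g(1)]
      by (intro Lq_norm_tendsto_0[OF open_U bounded_U q])
  qed
  ultimately have "(\<lambda>n. Lq_norm q U (h n) + (\<Sum>i\<in>UNIV. Lq_norm q U (weak_partial U i (h n)))) \<longlonglongrightarrow>
      0 + (\<Sum>i\<in>(UNIV :: 'm set). 0)"
    by (intro tendsto_add tendsto_sum)
  then show ?thesis
    by (simp add: W1q_norm_def h_def E_def)
qed

end

theorem theorem1p5:
  fixes U :: "(real ^ 'm::finite) set" and q :: real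
  assumes "open U" and "bounded U" and "1 \<le> q"
  shows "continuous_map
           (C01_topology U (Herm :: (complex ^ ('d::{finite,linorder}) ^ ('d::{finite,linorder})) set))
           (C01_trace_topology q U)
           (characteristic_map U)"
proof -
  let ?H = "Herm :: (complex ^ ('d::{finite,linorder}) ^ ('d::{finite,linorder})) set"
  let ?E = "characteristic_map U :: (real ^ 'm \<Rightarrow> complex ^ ('d::{finite,linorder}) ^ ('d::{finite,linorder})) \<Rightarrow> _"
  have mem: "?E A \<in> C01 U UNIV \<and> ?E A \<in> W1q q U" if A: "A \<in> C01 U ?H" for A
  proof -
    obtain L where L: "L-lipschitz_on U (?E A)"
      using characteristic_map_C01[OF assms(1,2) A] .
    have bdd: "bounded (?E A ` U)"
      by (rule bounded_lipschitz_image[OF assms(1,2) L])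
    have "?E A \<in> extensional U"
      by (simp add: characteristic_map_def)
    from C01_UNIV_I[OF L bdd this] lipschitz_in_W1q[OF assms L bdd] show ?thesis ..
  qed
  \<comment> \<open>The alternative \<open>?E A' = ?E A\<close> covers empty \<open>U\<close>, where
    the suprema in the norm are unspecified but all images coincide. In the proof by contradiction
    it provides \<open>U \<noteq> {}\<close>.\<close>
  have cont: "\<exists>\<delta>>0. \<forall>A'\<in>C01 U ?H. C01_norm U (\<lambda>x. A' x - A x) < \<delta> \<longrightarrow>
      ?E A' = ?E A \<or> W1q_norm q U (\<lambda>x. ?E A' x - ?E A x) < r"
    if A: "A \<in> C01 U ?H" and "r > 0" for A r
  proof (rule ccontr)
    assume neg: "\<not> ?thesis"
    have "\<forall>n. \<exists>A'. A' \<in> C01 U ?H \<and> C01_norm U (\<lambda>x. A' x - A x) < 1 / (real n + 1) \<and> ?E A' \<noteq> ?E A \<and>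
        \<not> W1q_norm q U (\<lambda>x. ?E A' x - ?E A x) < r"
    proof
      fix n :: nat
      have "1 / (real n + 1) > 0" by simp
      then show "\<exists>A'. A' \<in> C01 U ?H \<and> C01_norm U (\<lambda>x. A' x - A x) < 1 / (real n + 1) \<and> ?E A' \<noteq> ?E A \<and>
        \<not> W1q_norm q U (\<lambda>x. ?E A' x - ?E A x) < r"
        using neg by blast
    qed
    from choice[OF this] obtain An where An: "\<And>n. An n \<in> C01 U ?H" "\<And>n. C01_norm U (\<lambda>x. An n x - A x) < 1 / (real n + 1)"
      "\<And>n. ?E (An n) \<noteq> ?E A" "\<And>n. \<not> W1q_norm q U (\<lambda>x. ?E (An n) x - ?E A x) < r"
      by blast
    have "U \<noteq> {}"
      using An(3)[of 0] by (auto simp: characteristic_map_def)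
    \<comment> \<open>The upper bound \<open>1 / (real n + 1)\<close> alone does not force
      convergence to 0; a lower bound is needed too.\<close>
    have "C01_norm U (\<lambda>x. An n x - A x) \<ge> 0" for n
    proof -
      obtain L K where "L-lipschitz_on U (An n)" "K-lipschitz_on U A"
        using C01_imp_lipschitz[OF An(1)] C01_imp_lipschitz[OF A] by metis
      then have "(L + K)-lipschitz_on U (\<lambda>x. An n x - A x)"
        by (rule lipschitz_on_diff)
      then show ?thesis
        using C01_norm_bounds(3)[OF assms(1) \<open>U \<noteq> {}\<close>] bounded_lipschitz_image[OF assms(1,2)] by blast
    qed
    then have "(\<lambda>n. C01_norm U (\<lambda>x. An n x - A x)) \<longlonglongrightarrow> 0"
      using An(2) LIMSEQ_inverse_real_of_nat
      by (intro Lim_null_comparison[of "\<lambda>n. C01_norm U (\<lambda>x. An n x - A x)" "\<lambda>n. inverse (real (Suc n))"])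
        (auto intro!: always_eventually less_imp_le simp: inverse_eq_divide add.commute)
    then have "(\<lambda>n. W1q_norm q U (\<lambda>x. ?E (An n) x - ?E A x)) \<longlonglongrightarrow> 0"
      by (rule characteristic_map_tendsto[OF assms \<open>U \<noteq> {}\<close> A An(1)])
    then have "\<forall>\<^sub>F n in sequentially. W1q_norm q U (\<lambda>x. ?E (An n) x - ?E A x) < r"
      using \<open>r > 0\<close> by (rule order_tendstoD)
    then show False
      using An(4) by (auto simp: eventually_sequentially)
  qed
  show ?thesis
    \<comment> \<open>Open sets are by definition those that contain a seminorm ball around each of
      their points. So the estimate \<open>cont\<close> gives openness of preimages directly, and no
      ball has to be shown open.\<close>
    unfolding continuous_map_def C01_topology_def C01_trace_topology_def topspace_seminorm_topology
      topspace_pullback_topology openin_pullback_topology openin_seminorm_topology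
  proof (intro conjI allI impI)
    show "?E \<in> C01 U ?H \<rightarrow> (\<lambda>f. f) -` W1q q U \<inter> C01 U UNIV"
      using mem by auto
    fix S :: "(real ^ 'm \<Rightarrow> real ^ ('d::{finite,linorder})) set"
    assume "\<exists>T. (T \<subseteq> W1q q U \<and> (\<forall>f\<in>T. \<exists>r>0. {g \<in> W1q q U. W1q_norm q U (\<lambda>x. g x - f x) < r} \<subseteq> T)) \<and>
      S = (\<lambda>f. f) -` T \<inter> C01 U UNIV"
    then obtain T where T: "\<And>f. f \<in> T \<Longrightarrow> \<exists>r>0. {g \<in> W1q q U. W1q_norm q U (\<lambda>x. g x - f x) < r} \<subseteq> T"
      and S: "S = T \<inter> C01 U UNIV"
      by auto
    show "{A \<in> C01 U ?H. ?E A \<in> S} \<subseteq> C01 U ?H" by blast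
    show "\<forall>A\<in>{A \<in> C01 U ?H. ?E A \<in> S}. \<exists>\<delta>>0. {A' \<in> C01 U ?H. C01_norm U (\<lambda>x. A' x - A x) < \<delta>}
        \<subseteq> {A \<in> C01 U ?H. ?E A \<in> S}"
    proof
      fix A assume A: "A \<in> {A \<in> C01 U ?H. ?E A \<in> S}"
      then obtain r where r: "r > 0" "{g \<in> W1q q U. W1q_norm q U (\<lambda>x. g x - ?E A x) < r} \<subseteq> T"
        using T S by blast
      obtain \<delta> where \<delta>: "\<delta> > 0" "\<And>A'. A' \<in> C01 U ?H \<Longrightarrow> C01_norm U (\<lambda>x. A' x - A x) < \<delta> \<Longrightarrow>
          ?E A' = ?E A \<or> W1q_norm q U (\<lambda>x. ?E A' x - ?E A x) < r"
        using cont[of A r] A r(1) by blast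
      have "?E A' \<in> S" if "A' \<in> C01 U ?H" "C01_norm U (\<lambda>x. A' x - A x) < \<delta>" for A'
        using \<delta>(2)[OF that] mem[OF that(1)] A r(2) S by auto
      then show "\<exists>\<delta>>0. {A' \<in> C01 U ?H. C01_norm U (\<lambda>x. A' x - A x) < \<delta>} \<subseteq> {A \<in> C01 U ?H. ?E A \<in> S}"
        using \<delta>(1) by blast
    qed
  qed
qed

end
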